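(* Let $U\in\mathcal C^2(\mathbb R^d)$ and $0<m\le L$ be such that for all $x,y\in\mathbb R^d$, $|\nabla U(x)-\nabla U(y)|\le L|x-y|$ and $(x-y)\cdot(\nabla U(x)-\nabla U(y))\ge m|x-y|^2$. Suppose moreover that $\gamma\ge 2\sqrt L$ and $0<\delta\le m/(33\gamma^3)$. Let $P$ be the transition operator of the OBABO chain with parameters $\delta,\gamma$ and potential $U$, let $\pi_\delta$ be its unique invariant probability measure, and set $K_1=\sqrt3\max(L^{1/2},L^{-1/2})$, $\kappa=m/(3\gamma)$. Then $\pi_\delta$ satisfies a log-Sobolev inequality with constant $$C_{lS}=\frac{6}{m}K_1^2\gamma^2\left(1+\delta+\frac{\delta^2L}{2}\right)^2.$$ Moreover, if $\mu_0\in\mathcal P(\mathbb R^{2d})$ satisfies a log-Sobolev inequality with constant $C'>0$ and if $(Z_k)_{k\in\mathbb N}$ is an OBABO chain with $Z_0\sim\mu_0$, then for all $1$-Lipschitz functions $\varphi$ on $\mathbb R^{2d}$, $n\ge1$ and $u\ge0$, $$\mathbb P\left(\left|\frac1n\sum_{k=1}^n\varphi(Z_k)-\pi_\delta(\varphi)\right|\ge u+\frac{2K_1}{n\kappa\delta}\mathcal W_1(\mu_0,\pi_\delta)\right)\ \le\ 2\exp\left(-\frac{nu^2\kappa\delta}{4C_{lS}+4K_1^2C'/(n\kappa\delta)}\right).$$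
   Context: Given a time-step $\delta>0$ and a friction $\gamma>0$, set $\eta=e^{-\delta\gamma/2}$. The OBABO chain is the time-homogeneous Markov chain on $\mathbb R^d\times\mathbb R^d$ whose transition from $(x_0,v_0)$ to $(x_1,v_1)$ is $$x_1=x_0+\delta\left(\eta v_0+\sqrt{1-\eta^2}\,G\right)-\frac{\delta^2}{2}\nabla U(x_0),$$ $$v_1=\eta^2v_0-\frac{\delta\eta}{2}\left(\nabla U(x_0)+\nabla U(x_1)\right)+\sqrt{1-\eta^2}\left(\eta G+G'\right),$$ where $G,G'$ are independent standard Gaussian vectors in $\mathbb R^d$. Under the hypotheses of the claim $P$ has a unique invariant probability measure $\pi_\delta$, which has finite moments of all orders. $\mathcal P(\mathbb R^{2d})$ is the set of probability measures, $\mathcal W_1$ the 1-Wasserstein distance for the Euclidean norm, and $\pi_\delta(\varphi)=\int\varphi\,\mathrm d\pi_\delta$. A probability measure $\nu$ satisfies a log-Sobolev inequality with constant $C$ if for all bounded Lipschitz $\varphi$, $$\int\varphi^2\ln(\varphi^2)\,\mathrm d\nu-\left(\int\varphi^2\,\mathrm d\nu\right)\ln\left(\int\varphi^2\,\mathrm d\nu\right)\le C\int|\nabla\varphi|^2\,\mathrm d\nu.$$ *)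

theory Defs
  imports "HOL-Probability.Probability"
begin

definition grad :: "('a::real_inner \<Rightarrow> real) \<Rightarrow> 'a \<Rightarrow> 'a" where
  "grad f x = (THE D. GDERIV f x :> D)"

definition C2_function :: "('a::euclidean_space \<Rightarrow> real) \<Rightarrow> bool" where
  "C2_function f \<longleftrightarrow>
     (\<forall>x. f differentiable (at x)) \<and>
     (\<exists>H :: 'a \<Rightarrow> 'a \<Rightarrow>\<^sub>L 'a.
        (\<forall>x. (grad f has_derivative blinfun_apply (H x)) (at x)) \<and> continuous_on UNIV H)"

text \<open>
  A Lipschitz function need not be differentiable, and the set where it fails to be may have
  positive (even full) mass for a measure that is not absolutely continuous. So the norm of the
  gradient of a Lipschitz function is read as its pointwise Lipschitz constant, which is defined
  everywhere and is the norm of the gradient at each point of differentiability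
  (\<open>slope_eq_norm_grad\<close> below).
\<close>

definition slope :: "('a::euclidean_space \<Rightarrow> real) \<Rightarrow> 'a \<Rightarrow> real" where
  "slope f x = real_of_ereal (Limsup (at x) (\<lambda>y. ereal (\<bar>f y - f x\<bar> / norm (y - x))))"

lemma grad_eqI:
  assumes "GDERIV f x :> D"
  shows "grad f x = D"
  unfolding grad_def
proof (rule the_equality)
  show "GDERIV f x :> D" by (rule assms)
next
  fix E assume "GDERIV f x :> E"
  with assms have "(\<lambda>h. inner h D) = (\<lambda>h. inner h E)"
    unfolding gderiv_def by (rule has_derivative_unique)
  then have "inner (E - D) E = inner (E - D) D"
    by (simp add: fun_eq_iff)
  then have "inner (E - D) (E - D) = 0"
    by (simp add: inner_diff_right)
  then show "E = D"
    by simp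
qed

lemma slope_eq_norm:
  assumes D: "GDERIV f x :> D"
  shows "slope f x = norm D"
proof -
  let ?q = "\<lambda>y. \<bar>f y - f x\<bar> / norm (y - x)"
  have near: "\<exists>d>0. \<forall>y. y \<noteq> x \<and> dist y x < d \<longrightarrow>
      \<bar>f y - f x - inner (y - x) D\<bar> \<le> e * norm (y - x)" if "e > 0" for e
  proof -
    from D that obtain d where "d > 0"
      "\<forall>y. norm (y - x) < d \<longrightarrow> norm (f y - f x - inner (y - x) D) \<le> e * norm (y - x)"
      unfolding gderiv_def has_derivative_at_alt by blast
    then show ?thesis by (auto simp: dist_norm)
  qed
  have "Limsup (at x) (\<lambda>y. ereal (?q y)) = ereal (norm D)"
  proof (rule antisym)
    show "Limsup (at x) (\<lambda>y. ereal (?q y)) \<le> ereal (norm D)"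
    proof (rule ereal_le_epsilon2)
      fix e :: real assume "e > 0"
        from near[OF this] obtain d where d: "d > 0"
          "\<And>y. y \<noteq> x \<Longrightarrow> dist y x < d \<Longrightarrow> \<bar>f y - f x - inner (y - x) D\<bar> \<le> e * norm (y - x)"
          by blast
        have "?q y \<le> norm D + e" if "y \<noteq> x" "dist y x < d" for y
        proof -
          have "\<bar>inner (y - x) D\<bar> \<le> norm (y - x) * norm D"
            by (rule Cauchy_Schwarz_ineq2)
          with d(2)[OF that] have "\<bar>f y - f x\<bar> \<le> (norm D + e) * norm (y - x)"
            by (simp add: algebra_simps abs_le_iff)
          with that show ?thesis by (simp add: divide_le_eq)
        qed
        with d(1) have "eventually (\<lambda>y. ereal (?q y) \<le> ereal (norm D) + ereal e) (at x)"
          unfolding eventually_at by auto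
        then show "Limsup (at x) (\<lambda>y. ereal (?q y)) \<le> ereal (norm D) + ereal e"
          by (rule Limsup_bounded)
    qed
    have dir: "ereal (norm D) \<le> Limsup (at x) (\<lambda>y. ereal (?q y)) + ereal e" if "e > 0" for e
    proof -
      from near[OF that] obtain d where d: "d > 0"
        "\<And>y. y \<noteq> x \<Longrightarrow> dist y x < d \<Longrightarrow> \<bar>f y - f x - inner (y - x) D\<bar> \<le> e * norm (y - x)"
        by blast
      have "\<exists>u::'a. norm u = 1 \<and> inner u D = norm D"
      proof (cases "D = 0")
        case True
        then show ?thesis by (intro exI[of _ "SOME b. b \<in> Basis"]) (simp add: SOME_Basis)
      next
        case False
        then show ?thesis
          by (intro exI[of _ "D /\<^sub>R norm D"])
             (simp add: power2_norm_eq_inner[symmetric] power2_eq_square)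
      qed
      then obtain u :: 'a where u: "norm u = 1" "inner u D = norm D" by blast
      have fr: "norm D - e \<le> C" if C: "eventually (\<lambda>y. ?q y \<le> C) (at x)" for C
      proof -
        from C obtain r where r: "r > 0" "\<And>y. y \<noteq> x \<Longrightarrow> dist y x < r \<Longrightarrow> ?q y \<le> C"
          unfolding eventually_at by auto
        define t where "t = min d r / 2"
        have t: "t > 0" "t < d" "t < r" using d(1) r(1) by (auto simp: t_def min_def)
        have y: "x + t *\<^sub>R u \<noteq> x" "dist (x + t *\<^sub>R u) x = t" "norm ((x + t *\<^sub>R u) - x) = t"
          using t(1) u(1) by (auto simp: dist_norm)
        have "\<bar>f (x + t *\<^sub>R u) - f x - t * norm D\<bar> \<le> e * t"
          using d(2)[OF y(1)] y t u by simp
        moreover have "\<bar>f (x + t *\<^sub>R u) - f x\<bar> \<le> C * t"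
          using r(2)[OF y(1)] y t by (simp add: divide_le_eq)
        ultimately have "t * norm D - e * t \<le> C * t"
          by linarith
        then have "(norm D - e) * t \<le> C * t"
          by (simp only: left_diff_distrib mult.commute[of t "norm D"])
        with t(1) show ?thesis by simp
      qed
      have "ereal (norm D - e) \<le> Limsup (at x) (\<lambda>y. ereal (?q y))"
      proof (rule ccontr)
        assume "\<not> ?thesis"
        then have "Limsup (at x) (\<lambda>y. ereal (?q y)) < ereal (norm D - e)"
          by simp
        then obtain b where b: "Limsup (at x) (\<lambda>y. ereal (?q y)) < ereal b" "ereal b < ereal (norm D - e)"
          using ereal_dense2 by blast
        have "eventually (\<lambda>y. ereal (?q y) < ereal b) (at x)"
          by (rule Limsup_lessD[OF b(1)])
        then have "eventually (\<lambda>y. ?q y \<le> b) (at x)"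
          by (rule eventually_mono) simp
        with fr[of b] b(2) show False by simp
      qed
      then have "ereal (norm D - e) + ereal e \<le> Limsup (at x) (\<lambda>y. ereal (?q y)) + ereal e"
        by (rule add_right_mono)
      then show ?thesis by simp
    qed
    show "ereal (norm D) \<le> Limsup (at x) (\<lambda>y. ereal (?q y))"
      by (rule ereal_le_epsilon2[OF dir])
  qed
  then show ?thesis unfolding slope_def by simp
qed

lemma slope_eq_norm_grad:
  assumes "GDERIV f x :> D"
  shows "slope f x = norm (grad f x)"
  using slope_eq_norm[OF assms] grad_eqI[OF assms] by simp

text \<open>Since \<^term>\<open>ln 0 = (0::real)\<close>, the integrand \<open>\<phi>\<^sup>2 ln \<phi>\<^sup>2\<close> vanishes where \<open>\<phi>\<close> does.
  All integrands are bounded and Borel, so the Bochner integrals are the genuine ones.\<close>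

definition log_sobolev :: "'a::euclidean_space measure \<Rightarrow> real \<Rightarrow> bool" where
  "log_sobolev \<nu> C \<longleftrightarrow>
     prob_space \<nu> \<and> sets \<nu> = sets borel \<and>
     (\<forall>\<phi> :: 'a \<Rightarrow> real. bounded (range \<phi>) \<and> (\<exists>B. B-lipschitz_on UNIV \<phi>) \<longrightarrow>
        (\<integral>z. (\<phi> z)\<^sup>2 * ln ((\<phi> z)\<^sup>2) \<partial>\<nu>) - (\<integral>z. (\<phi> z)\<^sup>2 \<partial>\<nu>) * ln (\<integral>z. (\<phi> z)\<^sup>2 \<partial>\<nu>)
          \<le> C * (\<integral>z. (slope \<phi> z)\<^sup>2 \<partial>\<nu>))"

definition couplings ::
  "'a::euclidean_space measure \<Rightarrow> 'a measure \<Rightarrow> ('a \<times> 'a) measure set" where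
  "couplings \<mu> \<nu> =
     {\<Gamma>. sets \<Gamma> = sets (borel \<Otimes>\<^sub>M borel) \<and> distr \<Gamma> borel fst = \<mu> \<and> distr \<Gamma> borel snd = \<nu>}"

definition wasserstein1 :: "'a::euclidean_space measure \<Rightarrow> 'a measure \<Rightarrow> ennreal" where
  "wasserstein1 \<mu> \<nu> = (INF \<Gamma>\<in>couplings \<mu> \<nu>. \<integral>\<^sup>+p. ennreal (dist (fst p) (snd p)) \<partial>\<Gamma>)"

definition std_gaussian :: "'a::euclidean_space measure" where
  "std_gaussian = density lborel (\<lambda>x. ennreal (\<Prod>b\<in>Basis. std_normal_density (inner x b)))"

definition obabo_step ::
  "real \<Rightarrow> real \<Rightarrow> ('a::euclidean_space \<Rightarrow> real) \<Rightarrow> 'a \<times> 'a \<Rightarrow> 'a \<times> 'a \<Rightarrow> 'a \<times> 'a" where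
  "obabo_step \<delta> \<gamma> U = (\<lambda>(x0, v0) (g, g').
     let \<eta> = exp (- \<delta> * \<gamma> / 2);
         x1 = x0 + \<delta> *\<^sub>R (\<eta> *\<^sub>R v0 + sqrt (1 - \<eta>\<^sup>2) *\<^sub>R g) - (\<delta>\<^sup>2 / 2) *\<^sub>R grad U x0;
         v1 = \<eta>\<^sup>2 *\<^sub>R v0 - (\<delta> * \<eta> / 2) *\<^sub>R (grad U x0 + grad U x1)
                + sqrt (1 - \<eta>\<^sup>2) *\<^sub>R (\<eta> *\<^sub>R g + g')
     in (x1, v1))"

definition obabo_kernel ::
  "real \<Rightarrow> real \<Rightarrow> ('a::euclidean_space \<Rightarrow> real) \<Rightarrow> 'a \<times> 'a \<Rightarrow> ('a \<times> 'a) measure" where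
  "obabo_kernel \<delta> \<gamma> U z = distr (std_gaussian \<Otimes>\<^sub>M std_gaussian) borel (obabo_step \<delta> \<gamma> U z)"

definition invariant_prob :: "('a::topological_space \<Rightarrow> 'a measure) \<Rightarrow> 'a measure \<Rightarrow> bool" where
  "invariant_prob P \<pi> \<longleftrightarrow>
     prob_space \<pi> \<and> sets \<pi> = sets borel \<and> \<pi> \<bind> P = \<pi>"

definition obabo_invariant ::
  "real \<Rightarrow> real \<Rightarrow> ('a::euclidean_space \<Rightarrow> real) \<Rightarrow> ('a \<times> 'a) measure" where
  "obabo_invariant \<delta> \<gamma> U = (THE \<pi>. invariant_prob (obabo_kernel \<delta> \<gamma> U) \<pi>)"

definition history ::
  "'w measure \<Rightarrow> (nat \<Rightarrow> 'w \<Rightarrow> 'a::topological_space) \<Rightarrow> nat \<Rightarrow> 'w measure" where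
  "history M Z k = sigma (space M) (\<Union>i\<in>{..k}. {Z i -` A \<inter> space M | A. A \<in> sets borel})"

definition markov_chain ::
  "'w measure \<Rightarrow> 'a::topological_space measure \<Rightarrow> ('a \<Rightarrow> 'a measure) \<Rightarrow>
     (nat \<Rightarrow> 'w \<Rightarrow> 'a) \<Rightarrow> bool" where
  "markov_chain M \<mu>0 P Z \<longleftrightarrow>
     prob_space M \<and> (\<forall>k. Z k \<in> M \<rightarrow>\<^sub>M borel) \<and> distr M borel (Z 0) = \<mu>0 \<and>
     (\<forall>k. \<forall>A\<in>sets borel. AE \<omega> in M.
        real_cond_exp M (history M Z k) (\<lambda>\<omega>'. indicator A (Z (Suc k) \<omega>')) \<omega>
          = measure (P (Z k \<omega>)) A)"

end

theory Submission
  imports Defs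
begin

text \<open>
  The log-Sobolev inequality is obtained from an inequality which, unlike it, involves no gradient:
  for \<open>0 < t < 1\<close> and a cost function \<open>q\<close>,
  \<open>(\<integral>z. exp (f z / t) \<partial>\<mu>) powr t \<le> (\<integral>z. exp (SUP w. f (z + w) - t / (1 - t) * q w) \<partial>\<mu>)\<close>.
  For the one-dimensional Gaussian and \<open>q(w) = w\<^sup>2 / 2\<close> this is an instance of the Prekopa--Leindler inequality.
  It is stable under products, under Lipschitz images and under weak limits, and letting \<open>t \<rightarrow> 1\<close> turns it
  into a log-Sobolev inequality in which the pointwise Lipschitz constant appears by itself, with no
  differentiability of the test function.

  The OBABO step \<open>F (z, g)\<close> with a shared noise \<open>g\<close> contracts the norm
  \<open>|x|\<^sup>2 + (2 / \<gamma>) x \<bullet> v + |v|\<^sup>2 / L\<close>, and it is Lipschitz in \<open>g\<close>. So the laws of the chain started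
  at a point satisfy the inequality above with one and the same constant, and so does their limit \<open>\<pi>\<^sub>\<delta>\<close>,
  which is realised as the almost sure limit of the chain run backwards in time.

  For the concentration bound, \<open>\<Sum> \<phi> (Z k)\<close> is split into martingale increments, each a Lipschitz function of
  one Gaussian noise, and a Lipschitz function of \<open>Z 0\<close>; Herbst's argument bounds the Laplace
  transforms of both.
\<close>

section \<open>Sup-convolution inequalities\<close>

text \<open>Gradients are the obstacle. Test functions are merely Lipschitz and
  \<open>\<pi>\<delta>\<close> is not known to have a density, so points of non-differentiability
  cannot be discarded. The slope does not tensorise: for max(|x|, |y|) at the origin the two partial
  slopes have square sum 2, while the slope is 1. Nor does its integral pass to weak limits, since
  slopes are not continuous. Neither difficulty arises for an inequality without gradients, and the
  slope returns only once, for the limit law. The orders of the constants are those of a linear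
  recursion with contraction factor \<open>r\<close> and noise size \<open>l\<close>. A quadratic
  cost reproduces itself under one step if its inverse is proportional to
  \<open>l^2 / (1 - r^2)\<close>. Here \<open>1 - r^2\<close> is
  \<open>m * \<delta> / (2 * \<gamma>)\<close> and \<open>l^2\<close> is of order
  \<open>\<delta> * \<gamma> / L\<close>, so the step size cancels and \<open>\<gamma>^2 / m\<close>
  remains, up to powers of \<open>L\<close>. In the concentration bound each noise acts on all later
  states, which gives \<open>l^2 / (1 - r)^2\<close>, of order \<open>1 / \<delta>\<close>; this is
  the factor \<open>\<kappa> * \<delta>\<close> of the exponent.\<close>

definition bdd_lipschitz :: "('a::metric_space \<Rightarrow> real) \<Rightarrow> bool" where
  "bdd_lipschitz f \<longleftrightarrow> bounded (range f) \<and> (\<exists>B. B-lipschitz_on UNIV f)"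

definition sup_conv :: "('a::real_normed_vector \<Rightarrow> real) \<Rightarrow> ('a \<Rightarrow> real) \<Rightarrow> 'a \<Rightarrow> real" where
  "sup_conv q f z = (SUP w. f (z + w) - q w)"

text \<open>For \<open>q w = (norm w)^2 / 2\<close> the sup-convolution is the Hopf-Lax operator at
  time \<open>(1 - t) / t\<close>, and the left side is the norm of \<open>exp f\<close> with
  exponent \<open>1 / t\<close>: the inequality is a form of the hypercontractivity of that
  operator. Bounded Lipschitz functions are preserved by sup-convolution and by Lipschitz
  substitution, and make all integrals finite.\<close>

definition sup_conv_ineq :: "'a::euclidean_space measure \<Rightarrow> ('a \<Rightarrow> real) \<Rightarrow> bool" where
  "sup_conv_ineq \<mu> q \<longleftrightarrow> prob_space \<mu> \<and> sets \<mu> = sets borel \<and>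
     (\<forall>f t. bdd_lipschitz f \<longrightarrow> 0 < t \<longrightarrow> t < 1 \<longrightarrow>
        (\<integral>z. exp (f z / t) \<partial>\<mu>) powr t
          \<le> (\<integral>z. exp (sup_conv (\<lambda>w. t / (1 - t) * q w) f z) \<partial>\<mu>))"

lemma lipschitz_on_abs_diff: "C-lipschitz_on UNIV f \<Longrightarrow> \<bar>f x - f y\<bar> \<le> C * norm (x - y)"
  for f :: "'a::real_normed_vector \<Rightarrow> real"
  using lipschitz_onD[of C UNIV f x y] by (simp add: dist_norm)

lemma lipschitz_on_realI: "0 \<le> C \<Longrightarrow> (\<And>x y. f x - f y \<le> C * norm (x - y)) \<Longrightarrow> C-lipschitz_on UNIV f"
  for f :: "'a::real_normed_vector \<Rightarrow> real"
  by (rule lipschitz_onI) (auto simp: dist_norm abs_le_iff, metis norm_minus_commute)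

lemma bdd_lipschitzI:
  fixes f :: "'a::real_normed_vector \<Rightarrow> real"
  assumes "\<And>x. \<bar>f x\<bar> \<le> B" "0 \<le> C" "\<And>x y. f x - f y \<le> C * norm (x - y)"
  shows "bdd_lipschitz f"
  unfolding bdd_lipschitz_def using assms lipschitz_on_realI[of C f]
  by (auto intro!: boundedI[of _ B])

lemma bdd_lipschitzE:
  fixes f :: "'a::real_normed_vector \<Rightarrow> real"
  assumes "bdd_lipschitz f"
  obtains B C where "B > 0" "\<And>x. \<bar>f x\<bar> \<le> B" "C > 0" "\<And>x y. \<bar>f x - f y\<bar> \<le> C * norm (x - y)"
proof -
  from assms obtain B where B: "B > 0" "\<And>x. \<bar>f x\<bar> \<le> B"
    unfolding bdd_lipschitz_def bounded_pos by auto
  from assms obtain C where C: "C-lipschitz_on UNIV f" unfolding bdd_lipschitz_def by auto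
  have "\<bar>f x - f y\<bar> \<le> (C + 1) * norm (x - y)" for x y
    using lipschitz_on_abs_diff[OF C, of x y] norm_ge_zero[of "x-y"] unfolding distrib_right by linarith
  moreover have "C + 1 > 0" using lipschitz_on_nonneg[OF C] by simp
  ultimately show ?thesis using that B by blast
qed

lemma bdd_lipschitz_continuous: "bdd_lipschitz f \<Longrightarrow> continuous_on A f"
  unfolding bdd_lipschitz_def using lipschitz_on_continuous_on continuous_on_subset by blast

lemma bdd_lipschitz_measurable [measurable_dest]:
  "bdd_lipschitz f \<Longrightarrow> f \<in> borel_measurable borel"
  by (rule borel_measurable_continuous_onI) (rule bdd_lipschitz_continuous)

lemma bdd_lipschitz_compose:
  assumes "bdd_lipschitz f" "D-lipschitz_on UNIV F"
  shows "bdd_lipschitz (\<lambda>x. f (F x))"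
proof -
  from assms obtain C where C: "C-lipschitz_on UNIV f" unfolding bdd_lipschitz_def by auto
  have "(C * D)-lipschitz_on UNIV (f \<circ> F)"
    by (rule lipschitz_on_compose[OF assms(2)]) (rule lipschitz_on_subset[OF C], simp)
  moreover have "bounded (range (\<lambda>x. f (F x)))"
    using assms(1) unfolding bdd_lipschitz_def by (auto elim: bounded_subset)
  ultimately show ?thesis unfolding bdd_lipschitz_def by (auto simp: o_def)
qed

context
  fixes q f :: "'a::real_normed_vector \<Rightarrow> real"
  assumes q0: "q 0 = 0" and qpos: "\<And>w. 0 \<le> q w" and f: "bdd_lipschitz f"
begin

lemma sup_conv_bdd: "bdd_above (range (\<lambda>w. f (z + w) - q w))"
proof -
  obtain B C where "\<And>x. \<bar>f x\<bar> \<le> B" using bdd_lipschitzE[OF f] by metis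
  then have "f (z + w) - q w \<le> B" for w using qpos[of w] by (smt (verit))
  then show ?thesis by (intro bdd_aboveI2)
qed

lemma sup_conv_upper: "f (z + w) - q w \<le> sup_conv q f z"
  unfolding sup_conv_def by (rule cSUP_upper[OF _ sup_conv_bdd]) simp

lemma sup_conv_upper': "f y - q (y - z) \<le> sup_conv q f z"
  using sup_conv_upper[of z "y - z"] by simp

lemma sup_conv_ge: "f z \<le> sup_conv q f z"
  using sup_conv_upper[of z 0] q0 by simp

lemma sup_conv_least: "(\<And>w. f (z + w) - q w \<le> b) \<Longrightarrow> sup_conv q f z \<le> b"
  unfolding sup_conv_def by (rule cSUP_least) auto

lemma bdd_lipschitz_sup_conv: "bdd_lipschitz (sup_conv q f)"
proof -
  obtain B C where B: "\<And>x. \<bar>f x\<bar> \<le> B" and C: "C > 0" "\<And>x y. \<bar>f x - f y\<bar> \<le> C * norm (x - y)"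
    using bdd_lipschitzE[OF f] by metis
  show ?thesis
  proof (rule bdd_lipschitzI)
    show "\<bar>sup_conv q f x\<bar> \<le> B" for x
    proof -
      have "sup_conv q f x \<le> B"
        by (rule sup_conv_least) (use B qpos in \<open>smt (verit)\<close>)
      then show ?thesis using sup_conv_ge[of x] B[of x] by linarith
    qed
    show "sup_conv q f x - sup_conv q f y \<le> C * norm (x - y)" for x y
    proof -
      have "sup_conv q f x \<le> sup_conv q f y + C * norm (x - y)"
      proof (rule sup_conv_least)
        fix w
        show "f (x + w) - q w \<le> sup_conv q f y + C * norm (x - y)"
          using C(2)[of "x+w" "y+w"] sup_conv_upper[of y w] by (simp add: algebra_simps)
      qed
      then show ?thesis by simp
    qed
  qed (use C in simp)
qed

end

lemma bdd_lipschitz_integrable: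
  assumes "prob_space \<mu>" "sets \<mu> = sets borel" "bdd_lipschitz f" "continuous_on UNIV g"
  shows "integrable \<mu> (\<lambda>z. g (f z :: real) :: real)"
proof -
  interpret prob_space \<mu> by fact
  from assms(3) have "bounded (range f)" by (simp add: bdd_lipschitz_def)
  then have "compact (closure (range f))" by (simp add: compact_eq_bounded_closed bounded_closure)
  then have "compact (g ` closure (range f))"
    by (rule compact_continuous_image[OF continuous_on_subset[OF assms(4)], rotated]) simp
  then have "bounded (g ` closure (range f))" by (rule compact_imp_bounded)
  then obtain B where B: "\<And>y. y \<in> g ` closure (range f) \<Longrightarrow> norm y \<le> B" unfolding bounded_iff by blast
  have [measurable]: "f \<in> borel_measurable \<mu>" "g \<in> borel_measurable borel"
    using assms(3,4) measurable_cong_sets[OF assms(2) refl, of borel] borel_measurable_continuous_onI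
    by (auto dest: bdd_lipschitz_measurable)
  show ?thesis
    by (rule integrable_const_bound[of _ B]) (auto intro!: AE_I2 B[simplified] imageI subsetD[OF closure_subset])
qed

lemma (in prob_space) expectation_pos:
  assumes "integrable M f" "\<And>x. 0 < (f x :: real)"
  shows "0 < (\<integral>x. f x \<partial>M)"
proof -
  have "(\<integral>x. f x \<partial>M) \<noteq> 0"
  proof
    assume "(\<integral>x. f x \<partial>M) = 0"
    then have "AE x in M. f x = 0"
      using integral_nonneg_eq_0_iff_AE[OF assms(1)] assms(2) by (simp add: less_imp_le)
    then have "AE x in M. False" by eventually_elim (metis assms(2) less_irrefl)
    then show False using AE_False by simp
  qed
  moreover have "0 \<le> (\<integral>x. f x \<partial>M)"
    by (intro integral_nonneg_AE) (simp add: assms(2) less_imp_le)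
  ultimately show ?thesis by simp
qed

text \<open>Tensorisation and transport in one statement. The inequality for \<open>\<nu>\<close> is
  applied in the fibre over each \<open>z + w\<close>, then the one for \<open>\<mu>\<close> to the
  function that is left after integrating out the noise. Both use the same \<open>t\<close>, so the
  costs simply add; the quantitative input is \<open>cost\<close>.\<close>

lemma sup_conv_ineq_compose:
  fixes \<mu> :: "'b::euclidean_space measure" and \<nu> :: "'c::euclidean_space measure"
    and F :: "'b \<times> 'c \<Rightarrow> 'd::euclidean_space"
  assumes \<mu>: "sup_conv_ineq \<mu> q0" and \<nu>: "sup_conv_ineq \<nu> q"
    and F: "D-lipschitz_on UNIV F"
    and q0: "q0 0 = 0" "\<And>w. 0 \<le> q0 w" and q: "q 0 = 0" "\<And>w. 0 \<le> q w"
    and q1: "q1 0 = 0" "\<And>w. 0 \<le> q1 w"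
    and cost: "\<And>z z' g g'. q1 (F (z', g') - F (z, g)) \<le> q0 (z' - z) + q (g' - g)"
  shows "sup_conv_ineq (distr (\<mu> \<Otimes>\<^sub>M \<nu>) borel F) q1"
proof -
  from \<mu> \<nu> have ps: "prob_space \<mu>" "prob_space \<nu>" and st [measurable_cong]: "sets \<mu> = sets borel" "sets \<nu> = sets borel"
    by (auto simp: sup_conv_ineq_def)
  interpret M: prob_space \<mu> by fact
  interpret N: prob_space \<nu> by fact
  interpret P: pair_prob_space \<mu> \<nu> ..
  have sp: "sets (\<mu> \<Otimes>\<^sub>M \<nu>) = sets borel"
    by (simp only: sets_pair_measure_cong[OF st] borel_prod)
  have Fm [measurable]: "F \<in> measurable (\<mu> \<Otimes>\<^sub>M \<nu>) borel"
    using borel_measurable_continuous_onI[OF lipschitz_on_continuous_on[OF F]]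
    by (simp add: measurable_cong_sets[OF sp refl])
  have Fz: "D-lipschitz_on UNIV (\<lambda>g. F (z, g))" for z

    using lipschitz_on_nonneg[OF F] lipschitz_onD[OF F, of "(z, _)" "(z, _)"]
    by (auto intro!: lipschitz_onI simp: dist_Pair_Pair)
  have main: "(\<integral>z. exp (f z / t) \<partial>distr (\<mu> \<Otimes>\<^sub>M \<nu>) borel F) powr t
      \<le> (\<integral>z. exp (sup_conv (\<lambda>w. t / (1 - t) * q1 w) f z) \<partial>distr (\<mu> \<Otimes>\<^sub>M \<nu>) borel F)"
    if f: "bdd_lipschitz f" and t: "0 < t" "t < 1" for f t
  proof -
    define a where "a = t / (1 - t)"
    have a: "a \<ge> 0" using t by (simp add: a_def)
    note fm = bdd_lipschitz_measurable[OF f, measurable]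
    obtain B C where B: "\<And>x. \<bar>f x\<bar> \<le> B" "B > 0" and C: "C > 0" "\<And>x y. \<bar>f x - f y\<bar> \<le> C * norm (x - y)"
      using bdd_lipschitzE[OF f] by metis
    have D: "D \<ge> 0" by (rule lipschitz_on_nonneg[OF F])
    let ?S1 = "sup_conv (\<lambda>w. a * q1 w) f"
    have S1: "bdd_lipschitz ?S1" by (rule bdd_lipschitz_sup_conv[OF _ _ f]) (use a q1 in auto)
    note S1m = bdd_lipschitz_measurable[OF S1, measurable]
    have fz: "bdd_lipschitz (\<lambda>g. f (F (z, g)))" for z by (rule bdd_lipschitz_compose[OF f Fz])
    have S1z: "bdd_lipschitz (\<lambda>g. ?S1 (F (z, g)))" for z by (rule bdd_lipschitz_compose[OF S1 Fz])
    define H where "H z = (\<integral>g. exp (f (F (z, g)) / t) \<partial>\<nu>)" for z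
    have int1: "integrable \<nu> (\<lambda>g. exp (f (F (z, g)) / t))" for z
      by (rule bdd_lipschitz_integrable[OF ps(2) st(2) fz]) (intro continuous_intros, use t in auto)
    have H_bd: "exp (- B / t) \<le> H z" "H z \<le> exp (B / t)" for z
    proof -
      have "exp (-B/t) \<le> exp (f (F (z, g)) / t)" "exp (f (F (z, g)) / t) \<le> exp (B / t)" for g
        using B(1)[of "F (z,g)"] t by (auto simp: field_simps abs_le_iff)
      then show "exp (- B / t) \<le> H z" "H z \<le> exp (B / t)"
        unfolding H_def using int1 by (auto intro!: N.integral_ge_const N.integral_le_const)
    qed
    have Hpos: "H z > 0" for z using H_bd(1)[of z] by (smt (verit) exp_gt_zero)
    \<comment> \<open>Normalised so that \<open>exp (h z / t)\<close> is the integral over the fibre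
      and \<open>exp (h z)\<close> its power \<open>t\<close>: the first is the form in which the
      inequality for \<open>\<mu>\<close> takes it, the second the form in which the inequality for
      \<open>\<nu>\<close> bounds it.\<close>
    define h where "h z = t * ln (H z)" for z
    have exph: "exp (h z / t) = H z" "exp (h z) = H z powr t" for z
      using Hpos[of z] t by (simp_all add: h_def powr_def)
    have h: "bdd_lipschitz h"
    proof (rule bdd_lipschitzI)
      show "\<bar>h z\<bar> \<le> B" for z
      proof -
        have "- B / t \<le> ln (H z)" "ln (H z) \<le> B / t"
          using H_bd[of z] Hpos[of z] by (simp_all add: ln_ge_iff) (metis ln_exp ln_mono Hpos exp_gt_zero)
        then show ?thesis using t by (simp add: h_def abs_le_iff field_simps)
      qed
      show "0 \<le> C * D" using C D by simp
      show "h z - h z' \<le> C * D * norm (z - z')" for z z'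
      proof -
        have "H z \<le> exp (C * D * norm (z - z') / t) * H z'"
        proof -
          have "exp (f (F (z, g)) / t) \<le> exp (C * D * norm (z - z') / t) * exp (f (F (z', g)) / t)" for g
          proof -
            have "norm (F (z, g) - F (z', g)) \<le> D * norm (z - z')"
              using lipschitz_onD[OF F, of "(z,g)" "(z',g)"] by (simp add: dist_norm norm_Pair)
            then have "f (F (z, g)) - f (F (z', g)) \<le> C * (D * norm (z - z'))"
              using C(2)[of "F (z,g)" "F (z',g)"] mult_left_mono[of _ _ C] C(1) by (smt (verit))
            then show ?thesis unfolding exp_add[symmetric] add_divide_distrib[symmetric]
              using t by (simp add: divide_right_mono algebra_simps)
          qed
          then have "H z \<le> (\<integral>g. exp (C * D * norm (z - z') / t) * exp (f (F (z', g)) / t) \<partial>\<nu>)"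
            unfolding H_def by (intro integral_mono int1 integrable_mult_right) auto
          then show ?thesis by (simp add: H_def)
        qed
        then have "ln (H z) \<le> ln (exp (C * D * norm (z - z') / t) * H z')"
          using Hpos by (simp add: ln_mono)
        also have "\<dots> = C * D * norm (z - z') / t + ln (H z')"
          using Hpos[of z'] by (subst ln_mult) auto
        finally show ?thesis using t by (simp add: h_def field_simps)
      qed
    qed
    \<comment> \<open>The supremum over \<open>w\<close> stays outside the integral: each
      \<open>w\<close> is treated separately and its cost leaves as the constant factor
      \<open>exp (a * q0 w)\<close>, so no measurable choice of a maximiser is involved.\<close>
    have pt: "exp (sup_conv (\<lambda>w. a * q0 w) h z) \<le> (\<integral>g. exp (?S1 (F (z, g))) \<partial>\<nu>)" for z
    proof -
      let ?R = "\<integral>g. exp (?S1 (F (z, g))) \<partial>\<nu>"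
      have intR: "integrable \<nu> (\<lambda>g. exp (?S1 (F (z, g))))"
        by (rule bdd_lipschitz_integrable[OF ps(2) st(2) S1z]) (intro continuous_intros)
      have Rpos: "?R > 0" by (rule N.expectation_pos[OF intR]) simp
      have "sup_conv (\<lambda>w. a * q0 w) h z \<le> ln ?R"
      proof (rule sup_conv_least)
        fix w
        let ?S = "sup_conv (\<lambda>v. a * q v) (\<lambda>g. f (F (z + w, g)))"
        have S: "bdd_lipschitz ?S" by (rule bdd_lipschitz_sup_conv[OF _ _ fz]) (use a q in auto)
        have "exp (h (z + w)) \<le> (\<integral>g. exp (?S g) \<partial>\<nu>)"
          unfolding exph using \<nu> fz[of "z+w"] t unfolding sup_conv_ineq_def H_def a_def by blast
        also have "\<dots> \<le> (\<integral>g. exp (a * q0 w) * exp (?S1 (F (z, g))) \<partial>\<nu>)"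
        proof (rule integral_mono)
          show "integrable \<nu> (\<lambda>g. exp (?S g))"
            by (rule bdd_lipschitz_integrable[OF ps(2) st(2) S]) (intro continuous_intros)
          show "integrable \<nu> (\<lambda>g. exp (a * q0 w) * exp (?S1 (F (z, g))))"
            using intR by simp
          fix g
          have "?S g \<le> a * q0 w + ?S1 (F (z, g))"
          proof (rule sup_conv_least[OF _ _ fz])
            fix v
            have "a * q1 (F (z + w, g + v) - F (z, g)) \<le> a * (q0 w + q v)"
              using cost[of "z+w" "g+v" z g] a by (simp add: mult_left_mono)
            moreover have "f (F (z + w, g + v)) - a * q1 (F (z + w, g + v) - F (z, g)) \<le> ?S1 (F (z, g))"
              by (rule sup_conv_upper'[OF _ _ f]) (use a q1 in auto)
            ultimately show "f (F (z + w, g + v)) - a * q v \<le> a * q0 w + ?S1 (F (z, g))"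
              by (simp add: algebra_simps)
          qed (use a q in auto)
          then show "exp (?S g) \<le> exp (a * q0 w) * exp (?S1 (F (z, g)))"
            unfolding exp_add[symmetric] by simp
        qed
        also have "\<dots> = exp (a * q0 w) * ?R" by simp
        finally have "exp (h (z + w)) \<le> exp (a * q0 w) * ?R" .
        then have "exp (h (z + w) - a * q0 w) \<le> ?R" by (simp add: exp_diff field_simps)
        then show "h (z + w) - a * q0 w \<le> ln ?R" using Rpos by (simp add: ln_ge_iff)
      qed (use a q0 h in auto)
      then show ?thesis using Rpos by (simp add: ln_ge_iff)
    qed
    have intP: "integrable (\<mu> \<Otimes>\<^sub>M \<nu>) (\<lambda>p. g (k (F p)))"
      if "bdd_lipschitz k" "continuous_on UNIV g" for k :: "_ \<Rightarrow> real" and g :: "real \<Rightarrow> real"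
      by (rule bdd_lipschitz_integrable[OF _ sp bdd_lipschitz_compose[OF that(1) F] that(2)]) unfold_locales
    have e1: "(\<integral>z. exp (f z / t) \<partial>distr (\<mu> \<Otimes>\<^sub>M \<nu>) borel F) = (\<integral>z. exp (h z / t) \<partial>\<mu>)"
    proof -
      have "(\<integral>z. exp (f z / t) \<partial>distr (\<mu> \<Otimes>\<^sub>M \<nu>) borel F) = (\<integral>p. exp (f (F p) / t) \<partial>(\<mu> \<Otimes>\<^sub>M \<nu>))"
        by (rule integral_distr) simp_all
      also have "\<dots> = (\<integral>z. H z \<partial>\<mu>)" unfolding H_def
        by (rule P.integral_fst'[symmetric], rule intP[OF f, of "\<lambda>x. exp (x/t)"])
          (intro continuous_intros, use t in auto)
      finally show ?thesis by (simp add: exph)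
    qed
    have "(\<integral>z. exp (h z / t) \<partial>\<mu>) powr t \<le> (\<integral>z. exp (sup_conv (\<lambda>w. a * q0 w) h z) \<partial>\<mu>)"
      using \<mu> h t unfolding sup_conv_ineq_def a_def by blast
    also have "\<dots> \<le> (\<integral>z. (\<integral>g. exp (?S1 (F (z, g))) \<partial>\<nu>) \<partial>\<mu>)"
    proof (rule integral_mono[OF _ _ pt])
      show "integrable \<mu> (\<lambda>z. exp (sup_conv (\<lambda>w. a * q0 w) h z))"
        by (rule bdd_lipschitz_integrable[OF ps(1) st(1) bdd_lipschitz_sup_conv[OF _ _ h]])
          (use a q0 in \<open>auto intro!: continuous_intros\<close>)
      show "integrable \<mu> (\<lambda>z. \<integral>g. exp (?S1 (F (z, g))) \<partial>\<nu>)"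
        by (rule P.integrable_fst') (rule intP[OF S1], intro continuous_intros)
    qed
    also have "\<dots> = (\<integral>p. exp (?S1 (F p)) \<partial>(\<mu> \<Otimes>\<^sub>M \<nu>))"
      by (rule P.integral_fst') (rule intP[OF S1], intro continuous_intros)
    also have "\<dots> = (\<integral>z. exp (?S1 z) \<partial>distr (\<mu> \<Otimes>\<^sub>M \<nu>) borel F)"
      by (rule integral_distr[symmetric]) simp_all
    finally show ?thesis unfolding e1 a_def .
  qed
  show ?thesis unfolding sup_conv_ineq_def
    using main P.prob_space_distr[OF Fm] by simp
qed

section \<open>The one-dimensional Gaussian\<close>

lemma emeasure_lborel_affine:
  fixes S :: "real set"
  assumes "compact S" "c > 0"
  shows "emeasure lborel ((\<lambda>x. c * x + d) ` S) = ennreal c * emeasure lborel S"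
proof -
  have "emeasure lebesgue ((\<lambda>x. c *\<^sub>R x + d) ` S) = \<bar>c\<bar> ^ DIM(real) * emeasure lebesgue S"
    by (rule emeasure_lebesgue_affine)
  moreover have "compact ((\<lambda>x. c * x + d) ` S)"
    by (intro compact_continuous_image assms continuous_intros)
  ultimately show ?thesis using assms by (simp add: borel_compact)
qed

text \<open>With \<open>a0\<close> the maximum of \<open>A\<close> and \<open>b0\<close> the minimum
  of \<open>B\<close>, the sets \<open>t A + (1 - t) b0\<close> and \<open>t a0 + (1 - t) B\<close>
  both lie in \<open>S\<close>, the first to the left and the second to the right of their only
  common point, so their measures add.\<close>

lemma brunn_minkowski_real:
  fixes A B S :: "real set"
  assumes A: "compact A" "A \<noteq> {}" and B: "compact B" "B \<noteq> {}" and t: "0 < t" "t < 1"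
    and S: "S \<in> sets borel" and sub: "\<And>a b. a \<in> A \<Longrightarrow> b \<in> B \<Longrightarrow> t * a + (1 - t) * b \<in> S"
  shows "ennreal t * emeasure lborel A + ennreal (1 - t) * emeasure lborel B \<le> emeasure lborel S"
proof -
  obtain a0 where a0: "a0 \<in> A" "\<And>a. a \<in> A \<Longrightarrow> a \<le> a0" using compact_attains_sup[OF A] by blast
  obtain b0 where b0: "b0 \<in> B" "\<And>b. b \<in> B \<Longrightarrow> b0 \<le> b" using compact_attains_inf[OF B] by blast
  define c where "c = t * a0 + (1 - t) * b0"
  let ?A = "(\<lambda>a. t * a + (1 - t) * b0) ` A" and ?B = "(\<lambda>b. (1 - t) * b + t * a0) ` B"
  have cA: "compact ?A" and cB: "compact ?B"
    by (intro compact_continuous_image A B continuous_intros)+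
  have [measurable]: "?A \<in> sets borel" "?B \<in> sets borel" using cA cB by (auto intro: borel_compact)
  have le: "x \<le> c" if "x \<in> ?A" for x using that a0 t by (auto simp: c_def mult_left_mono)
  have ge: "c \<le> x" if "x \<in> ?B" for x using that b0 t by (auto simp: c_def mult_left_mono)
  have "ennreal t * emeasure lborel A + ennreal (1 - t) * emeasure lborel B
      = emeasure lborel ?A + emeasure lborel ?B"
    using t by (simp add: emeasure_lborel_affine A B)
  also have "emeasure lborel ?A = emeasure lborel (?A - {c})"
    by (rule emeasure_Diff_null_set[symmetric]) (auto simp: null_sets_def)
  also have "emeasure lborel (?A - {c}) + emeasure lborel ?B = emeasure lborel ((?A - {c}) \<union> ?B)"
  proof (rule plus_emeasure)
    show "(?A - {c}) \<inter> ?B = {}" using le ge by fastforce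
  qed auto
  also have "\<dots> \<le> emeasure lborel S"
  proof (rule emeasure_mono)
    show "(?A - {c}) \<union> ?B \<subseteq> S" using sub a0 b0 by (auto simp: add.commute)
  qed (use S in simp)
  finally show ?thesis .
qed

lemma layer_cake:
  fixes u :: "real \<Rightarrow> real"
  assumes [measurable]: "u \<in> borel_measurable borel" and u: "\<And>x. 0 \<le> u x"
  shows "(\<integral>\<^sup>+x. ennreal (u x) \<partial>lborel)
    = (\<integral>\<^sup>+r. indicator {0<..} r * emeasure lborel {x. r \<le> u x} \<partial>lborel)"
proof -
  have "(\<integral>\<^sup>+x. ennreal (u x) \<partial>lborel) = (\<integral>\<^sup>+x. (\<integral>\<^sup>+r. indicator {0<..u x} r \<partial>lborel) \<partial>lborel)"
    using u by (simp)
  also have "\<dots> = (\<integral>\<^sup>+x. (\<integral>\<^sup>+r. indicator {0<..} r * indicator {x. r \<le> u x} x \<partial>lborel) \<partial>lborel)"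
    by (intro nn_integral_cong) (auto simp: indicator_def)
  also have "\<dots> = (\<integral>\<^sup>+r. (\<integral>\<^sup>+x. indicator {0<..} r * indicator {x. r \<le> u x} x \<partial>lborel) \<partial>lborel)"
    by (rule lborel_pair.Fubini') measurable
  also have "\<dots> = (\<integral>\<^sup>+r. indicator {0<..} r * emeasure lborel {x. r \<le> u x} \<partial>lborel)"
    by (simp add: nn_integral_cmult)
  finally show ?thesis .
qed

text \<open>Since both maxima are 1, the superlevel sets of \<open>u\<close> and \<open>v\<close>
  are nonempty at every level in (0, 1], so the one-dimensional Brunn-Minkowski inequality applies
  level by level. Integration over the levels gives an arithmetic mean on the left, which is
  stronger than the geometric mean of the usual statement.\<close>

lemma prekopa_leindler_normalized:
  fixes u v h :: "real \<Rightarrow> real"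
  assumes [measurable]: "u \<in> borel_measurable borel" "v \<in> borel_measurable borel" "h \<in> borel_measurable borel"
    and pos: "\<And>x. 0 \<le> u x" "\<And>x. 0 \<le> v x" "\<And>x. 0 \<le> h x"
    and cu: "\<And>r. 0 < r \<Longrightarrow> compact {x. r \<le> u x}" and cv: "\<And>r. 0 < r \<Longrightarrow> compact {x. r \<le> v x}"
    and max: "\<And>x. u x \<le> 1" "u xu = 1" "\<And>x. v x \<le> 1" "v xv = 1"
    and t: "0 < t" "t < 1"
    and h: "\<And>x y r. 0 < r \<Longrightarrow> r \<le> u x \<Longrightarrow> r \<le> v y \<Longrightarrow> r \<le> h (t * x + (1 - t) * y)"
  shows "ennreal t * (\<integral>\<^sup>+x. ennreal (u x) \<partial>lborel) + ennreal (1 - t) * (\<integral>\<^sup>+x. ennreal (v x) \<partial>lborel)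
    \<le> (\<integral>\<^sup>+x. ennreal (h x) \<partial>lborel)"
proof -
  have m: "(\<lambda>r. indicator {0<..} r * emeasure lborel {x. r \<le> w x}) \<in> borel_measurable lborel"
    if [measurable]: "w \<in> borel_measurable borel" for w :: "real \<Rightarrow> real"
  proof -
    have "(\<lambda>r. \<integral>\<^sup>+x. indicator {0<..} r * indicator {x. r \<le> w x} x \<partial>lborel) \<in> borel_measurable lborel"
      by measurable
    then show ?thesis by (simp add: nn_integral_cmult)
  qed
  have "ennreal t * (\<integral>\<^sup>+x. ennreal (u x) \<partial>lborel) + ennreal (1 - t) * (\<integral>\<^sup>+x. ennreal (v x) \<partial>lborel)
    = (\<integral>\<^sup>+r. ennreal t * (indicator {0<..} r * emeasure lborel {x. r \<le> u x})
         + ennreal (1 - t) * (indicator {0<..} r * emeasure lborel {x. r \<le> v x}) \<partial>lborel)"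
    using pos by (simp add: layer_cake nn_integral_add nn_integral_cmult m del: nn_integral_indicator)
  also have "\<dots> \<le> (\<integral>\<^sup>+r. indicator {0<..} r * emeasure lborel {x. r \<le> h x} \<partial>lborel)"
  proof (rule nn_integral_mono)
    fix r :: real
    consider "r \<le> 0" | "r > 1" | "0 < r" "r \<le> 1" by linarith
    then show "ennreal t * (indicator {0<..} r * emeasure lborel {x. r \<le> u x})
         + ennreal (1 - t) * (indicator {0<..} r * emeasure lborel {x. r \<le> v x})
         \<le> indicator {0<..} r * emeasure lborel {x. r \<le> h x}"
    proof cases
      case 2
      then have "{x. r \<le> u x} = {}" "{x. r \<le> v x} = {}"
        using max by (auto simp: not_le intro: le_less_trans)
      then show ?thesis by simp
    next
      case 3
      have "ennreal t * emeasure lborel {x. r \<le> u x} + ennreal (1 - t) * emeasure lborel {x. r \<le> v x}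
          \<le> emeasure lborel {x. r \<le> h x}"
        proof (rule brunn_minkowski_real)
        show "{x. r \<le> u x} \<noteq> {}" "{x. r \<le> v x} \<noteq> {}" using max(2,4) 3 by (auto intro: exI[of _ xu] exI[of _ xv])
      qed (use 3 cu cv t h in auto)
      then show ?thesis using 3 by simp
    qed simp
  qed
  also have "\<dots> = (\<integral>\<^sup>+x. ennreal (h x) \<partial>lborel)"
    using pos by (simp add: layer_cake)
  finally show ?thesis .
qed

abbreviation std_normal :: "real measure" where
  "std_normal \<equiv> density lborel (\<lambda>x. ennreal (std_normal_density x))"

lemma integral_std_normal:
  fixes f :: "real \<Rightarrow> real"
  assumes "f \<in> borel_measurable borel"
  shows "(\<integral>x. f x \<partial>std_normal) = (\<integral>x. f x * exp (- x\<^sup>2 / 2) \<partial>lborel) / sqrt (2 * pi)"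
    and "integrable std_normal f \<longleftrightarrow> integrable lborel (\<lambda>x. f x * exp (- x\<^sup>2 / 2))"
proof -
  have "(\<integral>x. f x \<partial>std_normal) = (\<integral>x. (1 / sqrt (2 * pi)) * (f x * exp (- x\<^sup>2 / 2)) \<partial>lborel)"
    using assms by (subst integral_density) (auto simp: std_normal_density_def mult_ac)
  then show "(\<integral>x. f x \<partial>std_normal) = (\<integral>x. f x * exp (- x\<^sup>2 / 2) \<partial>lborel) / sqrt (2 * pi)"
    by (simp only: integral_mult_right_zero) simp
  have "integrable std_normal f \<longleftrightarrow> integrable lborel (\<lambda>x. (1 / sqrt (2 * pi)) * (f x * exp (- x\<^sup>2 / 2)))"
    using assms by (subst integrable_density) (auto simp: std_normal_density_def mult_ac)
  also have "\<dots> \<longleftrightarrow> integrable lborel (\<lambda>x. f x * exp (- x\<^sup>2 / 2))"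
    by (rule trans[OF integrable_mult_left_iff]) simp
  finally show "integrable std_normal f \<longleftrightarrow> integrable lborel (\<lambda>x. f x * exp (- x\<^sup>2 / 2))" .
qed

lemma prob_space_std_normal: "prob_space std_normal"
  by (rule prob_space_normal_density) simp

text \<open>Prekopa-Leindler with \<open>u\<close> the weighted \<open>exp (f / t)\<close>,
  \<open>v\<close> the Gaussian weight alone and \<open>h\<close> the weighted exponential of the
  sup-convolution. Half the excess of \<open>t * x^2 + (1 - t) * y^2\<close> over the square of the
  mean point is exactly the cost of moving from the mean point to \<open>x\<close>.\<close>

lemma sup_conv_ineq_std_normal: "sup_conv_ineq std_normal (\<lambda>w. w\<^sup>2 / 2)"
proof -
  interpret prob_space std_normal by (rule prob_space_std_normal)
  have sts: "sets std_normal = sets borel" by simp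
  have "(\<integral>z. exp (f z / t) \<partial>std_normal) powr t
     \<le> (\<integral>z. exp (sup_conv (\<lambda>w. t / (1 - t) * (w\<^sup>2 / 2)) f z) \<partial>std_normal)"
    if f: "bdd_lipschitz f" and t: "0 < t" "t < 1" for f :: "real \<Rightarrow> real" and t
  proof -
    define q :: "real \<Rightarrow> real" where "q = (\<lambda>w. t / (1 - t) * (w\<^sup>2 / 2))"
    let ?S = "sup_conv q f"
    note fm [measurable] = bdd_lipschitz_measurable[OF f]
    have q: "q 0 = 0" "\<And>w. 0 \<le> q w" using t by (auto simp: q_def)
    have S: "bdd_lipschitz ?S" by (rule bdd_lipschitz_sup_conv[of q, OF q f])
    note Sm [measurable] = bdd_lipschitz_measurable[OF S]
    obtain B C where B: "\<And>x. \<bar>f x\<bar> \<le> B" using bdd_lipschitzE[OF f] by metis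
    define u where "u x = exp (f x / t) * exp (- x\<^sup>2 / 2)" for x
    define v :: "real \<Rightarrow> real" where "v x = exp (- x\<^sup>2 / 2)" for x
    have upos: "u x > 0" for x by (simp add: u_def)
    have cont_u: "continuous_on UNIV u" unfolding u_def
      by (intro continuous_intros bdd_lipschitz_continuous[OF f]) (use t in auto)
    have cont_v: "continuous_on UNIV v" unfolding v_def by (intro continuous_intros) auto
    have compact_level: "compact {x. r \<le> k x}"
      if "r > 0" and ck: "continuous_on UNIV k" and k: "\<And>x. k x \<le> exp b * exp (- x\<^sup>2 / 2)" for r b :: real and k :: "real \<Rightarrow> real"
    proof -
      have "closed {x. r \<le> k x}"
        by (rule closed_Collect_le) (auto intro!: ck continuous_intros)
      \<comment> \<open>A crude radius that avoids square roots: \<open>s \<le> (s + 1)^2\<close>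
        for \<open>s \<ge> 0\<close>.\<close>
      moreover have "\<bar>x\<bar> \<le> 2 * \<bar>b - ln r\<bar> + 1" if "r \<le> k x" for x
      proof -
        have "ln r \<le> ln (exp b * exp (- x\<^sup>2 / 2))"
          using \<open>r > 0\<close> order_trans[OF that k] by (subst ln_le_cancel_iff) auto
        then have "x\<^sup>2 \<le> 2 * (b - ln r)" unfolding exp_add[symmetric] ln_exp by simp
        then have "x\<^sup>2 \<le> 2 * \<bar>b - ln r\<bar>" by (rule order_trans) (intro mult_left_mono abs_ge_self, simp)
        have "2 * w \<le> (2 * w + 1)\<^sup>2" if "0 \<le> w" for w :: real
          using that by (simp add: power2_eq_square algebra_simps)
        from this[of "\<bar>b - ln r\<bar>"] have "2 * \<bar>b - ln r\<bar> \<le> (2 * \<bar>b - ln r\<bar> + 1)\<^sup>2" by simp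
        with \<open>x\<^sup>2 \<le> 2 * \<bar>b - ln r\<bar>\<close> have "x\<^sup>2 \<le> (2 * \<bar>b - ln r\<bar> + 1)\<^sup>2" by (rule order_trans)
        then show ?thesis by (simp add: abs_le_square_iff[symmetric])
      qed
      then have "bounded {x. r \<le> k x}" unfolding bounded_iff by auto
      ultimately show ?thesis by (simp add: compact_eq_bounded_closed)
    qed
    have u_le: "u x \<le> exp (B / t) * exp (- x\<^sup>2 / 2)" for x
      using B[of x] t by (simp add: u_def divide_right_mono abs_le_iff)
    have cu: "compact {x. r \<le> u x}" if "r > 0" for r by (rule compact_level[OF that cont_u u_le])
    have cv: "compact {x. r \<le> v x}" if "r > 0" for r
      by (rule compact_level[OF that cont_v, of 0]) (simp add: v_def)
    obtain xu where xu: "\<And>x. u x \<le> u xu"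
    proof -
      obtain xu where "xu \<in> {x. u 0 \<le> u x}" "\<And>x. x \<in> {x. u 0 \<le> u x} \<Longrightarrow> u x \<le> u xu"
        using continuous_attains_sup[OF cu[OF upos, of 0], of u] continuous_on_subset[OF cont_u] by blast
      then have "u x \<le> u xu" for x by (cases "u 0 \<le> u x") (auto simp: not_le intro: less_imp_le[OF less_le_trans])
      then show ?thesis by (rule that)
    qed
    \<comment> \<open>The maximum of \<open>u\<close>. Dividing \<open>u\<close> by it makes both
      maxima 1; \<open>h\<close> is divided by \<open>a powr t\<close> to match, and the factor
      cancels in the end.\<close>
    define a where "a = u xu"
    have a: "a > 0" by (simp add: a_def upos)
    define h where "h x = exp (?S x) * exp (- x\<^sup>2 / 2) / a powr t" for x
    have [measurable]: "u \<in> borel_measurable borel" "v \<in> borel_measurable borel" "h \<in> borel_measurable borel"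
      unfolding u_def v_def h_def by measurable
    have key: "ennreal t * (\<integral>\<^sup>+x. ennreal (u x / a) \<partial>lborel) + ennreal (1 - t) * (\<integral>\<^sup>+x. ennreal (v x) \<partial>lborel)
      \<le> (\<integral>\<^sup>+x. ennreal (h x) \<partial>lborel)"
    proof (rule prekopa_leindler_normalized)
      show "compact {x. r \<le> u x / a}" if "0 < r" for r
        using cu[of "r * a"] that a by (simp add: field_simps)
      show "r \<le> h (t * x + (1 - t) * y)" if r: "0 < r" "r \<le> u x / a" "r \<le> v y" for x y r
      proof -
        let ?z = "t * x + (1 - t) * y"
        have id: "t * x\<^sup>2 + (1 - t) * y\<^sup>2 = ?z\<^sup>2 + t * (1 - t) * (x - y)\<^sup>2"
          by (simp add: power2_eq_square algebra_simps)
        have "r * a powr t = (r * a) powr t * r powr (1 - t)"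
          using r a by (simp add: powr_mult powr_add[symmetric] mult_ac)
        also have "\<dots> \<le> u x powr t * v y powr (1 - t)"
          by (intro mult_mono powr_mono2) (use r a t in \<open>auto simp: field_simps\<close>)
        also have "\<dots> = exp (f x - t * x\<^sup>2 / 2 - (1 - t) * y\<^sup>2 / 2)"
          using t by (simp add: u_def v_def powr_def exp_add[symmetric] field_simps)
        also have "f x - t * x\<^sup>2 / 2 - (1 - t) * y\<^sup>2 / 2 = f x - t * (1 - t) * (x - y)\<^sup>2 / 2 - ?z\<^sup>2 / 2"
          using id by (simp add: field_simps)
        also have "t * (1 - t) * (x - y)\<^sup>2 / 2 = q (x - ?z)"
        proof -
          have "x - ?z = (1 - t) * (x - y)" by (simp add: algebra_simps)
          then have "(x - ?z)\<^sup>2 = (1 - t) * ((1 - t) * (x - y)\<^sup>2)" by (simp add: power2_eq_square)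
          moreover have "t * (1 - t) * d / 2 = t / (1 - t) * ((1 - t) * ((1 - t) * d) / 2)" for d
            using t by (simp add: divide_simps)
          ultimately show ?thesis unfolding q_def by metis
        qed
        also have "exp (f x - q (x - ?z) - ?z\<^sup>2 / 2) \<le> exp (?S ?z - ?z\<^sup>2 / 2)"
          using sup_conv_upper'[of q f x ?z, OF q f] by simp
        finally have "r * a powr t \<le> exp (?S ?z - ?z\<^sup>2 / 2)" .
        moreover have "h ?z = exp (?S ?z - ?z\<^sup>2 / 2) / a powr t"
          by (simp only: h_def exp_add[symmetric]) simp
        ultimately show ?thesis using a by (simp only: pos_le_divide_eq powr_gt_zero)
      qed
      show "v 0 = 1" "u xu / a = 1" using a by (simp_all add: v_def a_def)
    qed (use a cv upos xu t in \<open>auto simp: v_def h_def a_def field_simps less_imp_le\<close>)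
    have iu: "integrable lborel u"
      using integral_std_normal(2)[of "\<lambda>x. exp (f x / t)"]
        bdd_lipschitz_integrable[OF prob_space_axioms sts f, of "\<lambda>x. exp (x / t)"] t
      by (simp add: u_def[abs_def] continuous_intros)
    have iv: "integrable lborel v"
      using integral_std_normal(2)[of "\<lambda>x. 1"] by (simp add: v_def[abs_def])
    have ih: "integrable lborel (\<lambda>x. exp (?S x) * exp (- x\<^sup>2 / 2))"
      using integral_std_normal(2)[of "\<lambda>x. exp (?S x)"]
        bdd_lipschitz_integrable[OF prob_space_axioms sts S, of exp]
      by (simp add: continuous_intros)
    have Iv: "(\<integral>x. v x \<partial>lborel) = sqrt (2 * pi)"
      using integral_std_normal(1)[of "\<lambda>x. 1"] prob_space by (simp add: v_def[abs_def] field_simps)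
    define A where "A = (\<integral>x. u x \<partial>lborel)"
    have A: "(\<integral>z. exp (f z / t) \<partial>std_normal) = A / sqrt (2 * pi)"
      unfolding A_def u_def by (rule integral_std_normal) measurable
    have Apos: "A > 0"
    proof -
      have "0 < (\<integral>z. exp (f z / t) \<partial>std_normal)"
        by (rule expectation_pos, rule bdd_lipschitz_integrable[OF prob_space_axioms sts f, of "\<lambda>x. exp (x/t)"])
           (use t in \<open>auto intro!: continuous_intros\<close>)
      then show ?thesis unfolding A by (simp add: zero_less_divide_iff)
    qed
    define H where "H = (\<integral>x. exp (?S x) * exp (- x\<^sup>2 / 2) \<partial>lborel)"
    have H: "(\<integral>z. exp (?S z) \<partial>std_normal) = H / sqrt (2 * pi)"
      unfolding H_def by (rule integral_std_normal) measurable
    have H0: "H \<ge> 0" unfolding H_def by (rule integral_nonneg_AE) simp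
    have "t * (A / a) + (1 - t) * sqrt (2 * pi) \<le> H / a powr t"
    proof -
      have 1: "(\<integral>\<^sup>+x. ennreal (u x / a) \<partial>lborel) = ennreal (A / a)"
        using iu upos a by (subst nn_integral_eq_integral) (auto simp: A_def less_imp_le)
      have 2: "(\<integral>\<^sup>+x. ennreal (v x) \<partial>lborel) = ennreal (sqrt (2 * pi))"
        using iv by (subst nn_integral_eq_integral) (auto simp: Iv v_def)
      have 3: "(\<integral>\<^sup>+x. ennreal (h x) \<partial>lborel) = ennreal (H / a powr t)"
        unfolding h_def using ih a by (subst nn_integral_eq_integral) (auto simp: H_def)
      show ?thesis using key Apos a t H0 unfolding 1 2 3
        by (simp add: ennreal_mult[symmetric] ennreal_plus[symmetric] del: ennreal_plus)
    qed
    \<comment> \<open>The weighted arithmetic-geometric mean inequality leads back to the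
      multiplicative form, which is homogeneous in \<open>a\<close>.\<close>
    then have "(A / a) powr t * sqrt (2 * pi) powr (1 - t) \<le> H / a powr t"
      using Youngs_inequality_0[of t "1 - t" "A / a" "sqrt (2 * pi)"] t Apos a by simp
    then have "A powr t * sqrt (2 * pi) powr (1 - t) \<le> H"
      using a Apos by (simp add: powr_divide field_simps)
    then have "A powr t * sqrt (2 * pi) powr (1 - t) * sqrt (2 * pi) powr t \<le> H * sqrt (2 * pi) powr t"
      by (rule mult_right_mono) simp
    moreover have "sqrt (2 * pi) powr (1 - t) * sqrt (2 * pi) powr t = sqrt (2 * pi)"
      by (subst powr_add[symmetric]) simp
    ultimately have "A powr t * sqrt (2 * pi) \<le> H * sqrt (2 * pi) powr t"
      by (simp only: mult.assoc)
    then have "(A / sqrt (2 * pi)) powr t \<le> H / sqrt (2 * pi)"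
      using Apos by (simp add: powr_divide divide_le_eq pos_le_divide_eq mult.commute)
    then show ?thesis unfolding A H q_def[symmetric] .
  qed
  then show ?thesis unfolding sup_conv_ineq_def using prob_space_axioms by simp
qed

section \<open>The standard Gaussian\<close>

text \<open>Start of two inductions, over the coordinates of the Gaussian and over the steps of the
  chain. The reason is only that \<open>w = 0\<close> competes in the supremum at no cost.\<close>

lemma sup_conv_ineq_return:
  fixes z :: "'a::euclidean_space"
  assumes q: "q 0 = 0" "\<And>w. 0 \<le> q w"
  shows "sup_conv_ineq (return borel z) q"
proof -
  have "(\<integral>x. exp (f x / t) \<partial>return borel z) powr t
      \<le> (\<integral>x. exp (sup_conv (\<lambda>w. t / (1 - t) * q w) f x) \<partial>return borel z)"
    if f: "bdd_lipschitz f" and t: "0 < t" "t < 1" for f t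
  proof -
    let ?S = "sup_conv (\<lambda>w. t / (1 - t) * q w) f"
    have a: "t / (1 - t) * q 0 = 0" "\<And>w. 0 \<le> t / (1 - t) * q w" using q t by auto
    note [measurable] = bdd_lipschitz_measurable[OF f]
      bdd_lipschitz_measurable[OF bdd_lipschitz_sup_conv[of "\<lambda>w. t / (1 - t) * q w", OF a f]]
    have "(\<integral>x. exp (f x / t) \<partial>return borel z) powr t = exp (f z)"
      using t by (subst integral_return) (auto simp: powr_def)
    also have "\<dots> \<le> exp (?S z)"
      using sup_conv_ge[of "\<lambda>w. t / (1 - t) * q w", OF a f] by simp
    also have "\<dots> = (\<integral>x. exp (?S x) \<partial>return borel z)" by (subst integral_return) (simp_all only: space_borel UNIV_I, measurable)
    finally show ?thesis .
  qed
  then show ?thesis by (simp add: sup_conv_ineq_def prob_space_return)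
qed

text \<open>The Gaussian on the span of \<open>I\<close>, but as a law on the whole space, so that
  the induction over the basis adds coordinates without changing the type.\<close>

definition partial_gaussian :: "'a::euclidean_space set \<Rightarrow> 'a measure" where
  "partial_gaussian I = distr (\<Pi>\<^sub>M b\<in>I. std_normal) borel (\<lambda>x. \<Sum>b\<in>I. x b *\<^sub>R b)"

lemma partial_gaussian_empty: "partial_gaussian {} = return borel (0 :: 'a::euclidean_space)"
proof -
  have "distr (\<Pi>\<^sub>M b\<in>{}::'a set. std_normal) borel (\<lambda>x. 0) = return borel (0::'a)"
  proof (rule measure_eqI)
    fix A :: "'a set" assume "A \<in> sets (distr (\<Pi>\<^sub>M b\<in>{}::'a set. std_normal) borel (\<lambda>x. 0))"
    then show "emeasure (distr (\<Pi>\<^sub>M b\<in>{}::'a set. std_normal) borel (\<lambda>x. 0)) A = emeasure (return borel (0::'a)) A"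
      by (cases "0 \<in> A") (auto simp: emeasure_distr PiM_empty space_PiM)
  qed simp
  then show ?thesis by (simp add: partial_gaussian_def)
qed

text \<open>The new coordinate overwrites the old one instead of being added to it. On the support
  of \<open>partial_gaussian I\<close> the old coordinate along \<open>b\<close> is 0, so the law is
  the same; but the cost condition of \<open>sup_conv_ineq_compose\<close> is required for all pairs
  of points, also off the support.\<close>

lemma partial_gaussian_insert:
  fixes b :: "'a::euclidean_space"
  assumes I: "finite I" "I \<subseteq> Basis" and b: "b \<in> Basis" "b \<notin> I"
  shows "partial_gaussian (insert b I)
    = distr (partial_gaussian I \<Otimes>\<^sub>M std_normal) borel (\<lambda>p. fst p - (fst p \<bullet> b) *\<^sub>R b + snd p *\<^sub>R b)"
proof -
  interpret N: prob_space std_normal by (rule prob_space_std_normal)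
  interpret product_prob_space "\<lambda>_::'a. std_normal" by unfold_locales
  interpret PI: prob_space "\<Pi>\<^sub>M b\<in>I. std_normal" by (rule prob_space_PiM) (rule prob_space_std_normal)
  have st: "sets std_normal = sets borel" by simp
  let ?s = "\<lambda>I x. \<Sum>b\<in>I. x b *\<^sub>R b"
  have [measurable]: "?s J \<in> measurable (\<Pi>\<^sub>M b\<in>J. std_normal) borel" for J :: "'a set"
    by measurable
  have pair_meas: "sets (borel \<Otimes>\<^sub>M borel) = sets (borel :: ('a \<times> real) measure)" by (simp only: borel_prod)
  have [measurable]: "(\<lambda>p::'a \<times> real. fst p - (fst p \<bullet> b) *\<^sub>R b + snd p *\<^sub>R b) \<in> measurable (borel \<Otimes>\<^sub>M borel) borel"
    by measurable
  have "partial_gaussian (insert b I)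
     = distr (distr (std_normal \<Otimes>\<^sub>M (\<Pi>\<^sub>M i\<in>I. std_normal)) (\<Pi>\<^sub>M i\<in>insert b I. std_normal) (\<lambda>(x, X). X(b := x))) borel (?s (insert b I))"
    unfolding partial_gaussian_def
    by (subst distr_pair_PiM_eq_PiM) (auto intro: prob_space_std_normal)
  also have "\<dots> = distr (std_normal \<Otimes>\<^sub>M (\<Pi>\<^sub>M i\<in>I. std_normal)) borel (?s (insert b I) \<circ> (\<lambda>(x, X). X(b := x)))"
    by (rule distr_distr) measurable
  also have "\<dots> = distr (distr ((\<Pi>\<^sub>M i\<in>I. std_normal) \<Otimes>\<^sub>M std_normal) (std_normal \<Otimes>\<^sub>M (\<Pi>\<^sub>M i\<in>I. std_normal)) (\<lambda>(x, y). (y, x))) borel (?s (insert b I) \<circ> (\<lambda>(x, X). X(b := x)))"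
  proof -
    interpret Q: pair_sigma_finite std_normal "\<Pi>\<^sub>M i\<in>I. std_normal" ..
    show ?thesis by (subst Q.distr_pair_swap) rule
  qed
  also have "\<dots> = distr ((\<Pi>\<^sub>M i\<in>I. std_normal) \<Otimes>\<^sub>M std_normal) borel ((?s (insert b I) \<circ> (\<lambda>(x, X). X(b := x))) \<circ> (\<lambda>(x, y). (y, x)))"
    by (rule distr_distr) measurable
  also have "\<dots> = distr ((\<Pi>\<^sub>M i\<in>I. std_normal) \<Otimes>\<^sub>M std_normal) borel
      ((\<lambda>p. fst p - (fst p \<bullet> b) *\<^sub>R b + snd p *\<^sub>R b) \<circ> (\<lambda>(X, x). (?s I X, x)))"
  proof (rule distr_cong)
    fix p assume "p \<in> space ((\<Pi>\<^sub>M i\<in>I. std_normal) \<Otimes>\<^sub>M std_normal)"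
    obtain X x where p: "p = (X, x)" by (cases p)
    have "?s I X \<bullet> b = 0"
      unfolding inner_sum_left
    proof (intro sum.neutral ballI)
      fix c assume "c \<in> I"
      then have "c \<bullet> b = 0" using I b by (auto simp: inner_Basis)
      then show "(X c *\<^sub>R c) \<bullet> b = 0" by simp
    qed
    moreover have "?s (insert b I) (X(b := x)) = x *\<^sub>R b + ?s I X"
      using I b by (simp) (intro sum.cong, auto)
    ultimately show "((?s (insert b I) \<circ> (\<lambda>(x, X). X(b := x))) \<circ> (\<lambda>(x, y). (y, x))) p
      = ((\<lambda>p. fst p - (fst p \<bullet> b) *\<^sub>R b + snd p *\<^sub>R b) \<circ> (\<lambda>(X, x). (?s I X, x))) p"
      by (simp add: p)
  qed simp_all
  also have "\<dots> = distr (distr ((\<Pi>\<^sub>M i\<in>I. std_normal) \<Otimes>\<^sub>M std_normal) (borel \<Otimes>\<^sub>M std_normal) (\<lambda>(X, x). (?s I X, x)))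
       borel (\<lambda>p. fst p - (fst p \<bullet> b) *\<^sub>R b + snd p *\<^sub>R b)"
    by (rule distr_distr[symmetric]) measurable
  also have "distr ((\<Pi>\<^sub>M i\<in>I. std_normal) \<Otimes>\<^sub>M std_normal) (borel \<Otimes>\<^sub>M std_normal) (\<lambda>(X, x). (?s I X, x))
    = partial_gaussian I \<Otimes>\<^sub>M distr std_normal std_normal (\<lambda>x. x)"
    unfolding partial_gaussian_def
    by (rule pair_measure_distr[symmetric]) (auto intro: N.sigma_finite_measure_axioms)
  finally show ?thesis by simp
qed

text \<open>Directions outside \<open>I\<close> carry no cost, so adding the coordinate
  \<open>b\<close> adds exactly the cost of the one-dimensional noise, and the constant does not
  grow with the dimension.\<close>

lemma sup_conv_ineq_partial_gaussian:
  assumes "finite I" "I \<subseteq> Basis"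
  shows "sup_conv_ineq (partial_gaussian I) (\<lambda>w :: 'a::euclidean_space. (\<Sum>b\<in>I. (w \<bullet> b)\<^sup>2) / 2)"
  using assms
proof (induction I)
  case empty
  show ?case unfolding partial_gaussian_empty by (rule sup_conv_ineq_return) auto
next
  case (insert b I)
  let ?F = "\<lambda>p::'a \<times> real. fst p - (fst p \<bullet> b) *\<^sub>R b + snd p *\<^sub>R b"
  have b: "b \<in> Basis" and IB: "I \<subseteq> Basis" using insert by auto
  have bb: "b \<bullet> b = 1" "\<And>c. c \<in> I \<Longrightarrow> b \<bullet> c = 0"
    using b IB insert.hyps by (auto simp: inner_Basis)
  show ?case unfolding partial_gaussian_insert[OF insert.hyps(1) IB b insert.hyps(2)]
  proof (rule sup_conv_ineq_compose[OF insert.IH[OF IB] sup_conv_ineq_std_normal, of 3 ?F])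
    have lin: "bounded_linear ?F" by (intro bounded_linear_intros)
    have "norm (?F p) \<le> 3 * norm p" for p
    proof -
      have "norm (?F p) \<le> norm (fst p) + norm ((fst p \<bullet> b) *\<^sub>R b) + norm (snd p *\<^sub>R b)"
        by (smt (verit) norm_triangle_ineq norm_triangle_ineq4)
      also have "norm ((fst p \<bullet> b) *\<^sub>R b) \<le> norm (fst p)" using b Basis_le_norm by simp
      finally show ?thesis using norm_fst_le[of p] norm_snd_le[of p] b
        by (simp add: mult_ac) (smt (verit) norm_fst_le norm_snd_le prod.collapse real_norm_def)
    qed
    note bd = this
    show "3-lipschitz_on UNIV ?F"
    proof (rule lipschitz_onI)
      show "dist (?F p) (?F p') \<le> 3 * dist p p'" for p p'
        using bd[of "p - p'"] unfolding dist_norm linear_diff[OF bounded_linear.linear[OF lin], of p p'] .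
    qed simp
    show "(\<Sum>c\<in>insert b I. ((?F (z', g') - ?F (z, g)) \<bullet> c)\<^sup>2) / 2
        \<le> (\<Sum>c\<in>I. ((z' - z) \<bullet> c)\<^sup>2) / 2 + (g' - g)\<^sup>2 / 2" for z z' g g'
    proof -
      have "(\<Sum>c\<in>I. ((?F (z', g') - ?F (z, g)) \<bullet> c)\<^sup>2) = (\<Sum>c\<in>I. ((z' - z) \<bullet> c)\<^sup>2)"
        by (intro sum.cong) (auto simp: inner_diff_left inner_add_left bb)
      moreover have "(?F (z', g') - ?F (z, g)) \<bullet> b = g' - g"
        by (simp add: inner_diff_left inner_add_left bb)
      ultimately show ?thesis using insert.hyps by (simp add: add_divide_distrib)
    qed
  qed (auto intro: sum_nonneg)
qed

lemma std_gaussian_eq: "(std_gaussian :: 'a::euclidean_space measure) = partial_gaussian Basis"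
proof -
  interpret L: product_sigma_finite "\<lambda>_::'a. lborel :: real measure" by unfold_locales
  interpret N: prob_space std_normal by (rule prob_space_std_normal)
  interpret product_prob_space "\<lambda>_::'a. std_normal" by unfold_locales
  let ?s = "\<lambda>x. \<Sum>b\<in>Basis. x b *\<^sub>R b :: 'a"
  let ?d = "\<lambda>x::'a \<Rightarrow> real. ennreal (\<Prod>b\<in>Basis. std_normal_density (x b))"
  have dens: "density (\<Pi>\<^sub>M b\<in>Basis. lborel) ?d = (\<Pi>\<^sub>M b\<in>Basis. std_normal)"
  proof (rule PiM_eqI)
    show "sets (density (\<Pi>\<^sub>M b\<in>Basis. lborel) ?d) = sets (\<Pi>\<^sub>M b\<in>Basis::'a set. std_normal)"
      by (simp cong: sets_PiM_cong)
    fix A :: "'a \<Rightarrow> real set" assume "\<And>i. i \<in> Basis \<Longrightarrow> A i \<in> sets std_normal"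
    then have A [measurable]: "\<And>i. i \<in> Basis \<Longrightarrow> A i \<in> sets borel" by simp
    have "emeasure (density (\<Pi>\<^sub>M b\<in>Basis. lborel) ?d) (Pi\<^sub>E Basis A)
      = (\<integral>\<^sup>+x. ?d x * indicator (Pi\<^sub>E Basis A) x \<partial>(\<Pi>\<^sub>M b\<in>Basis. lborel))"
      by (rule emeasure_density) (auto intro!: sets_PiM_I_finite)
    also have "\<dots> = (\<integral>\<^sup>+x. (\<Prod>b\<in>Basis. ennreal (std_normal_density (x b)) * indicator (A b) (x b)) \<partial>(\<Pi>\<^sub>M b\<in>Basis. lborel))"
    proof (rule nn_integral_cong)
      fix x :: "'a \<Rightarrow> real" assume "x \<in> space (\<Pi>\<^sub>M b\<in>Basis. lborel)"
      then have x: "x \<in> extensional Basis" by (simp add: space_PiM PiE_def)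
      have "indicator (Pi\<^sub>E Basis A) x = (\<Prod>b\<in>Basis. indicator (A b) (x b) :: ennreal)"
        using x
        by (cases "x \<in> Pi Basis A") (auto simp: PiE_def Pi_iff indicator_def intro: prod.neutral[symmetric])
      then show "?d x * indicator (Pi\<^sub>E Basis A) x = (\<Prod>b\<in>Basis. ennreal (std_normal_density (x b)) * indicator (A b) (x b))"
        by (simp add: prod.distrib prod_ennreal)
    qed
    also have "\<dots> = (\<Prod>b\<in>Basis. \<integral>\<^sup>+y. ennreal (std_normal_density y) * indicator (A b) y \<partial>lborel)"
      by (rule L.product_nn_integral_prod) auto
    also have "\<dots> = (\<Prod>b\<in>Basis. emeasure std_normal (A b))"
      by (intro prod.cong refl) (simp add: emeasure_density)
    finally show "emeasure (density (\<Pi>\<^sub>M b\<in>Basis. lborel) ?d) (Pi\<^sub>E Basis A) = (\<Prod>b\<in>Basis. emeasure std_normal (A b))" .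
  qed simp
  have "(std_gaussian :: 'a measure) = density (distr (\<Pi>\<^sub>M b\<in>Basis. lborel) borel ?s)
      (\<lambda>x. ennreal (\<Prod>b\<in>Basis. std_normal_density (inner x b)))"
    unfolding std_gaussian_def lborel_eq_real by (subst lborel_def) simp
  also have "\<dots> = distr (density (\<Pi>\<^sub>M b\<in>Basis. lborel) (\<lambda>x. ennreal (\<Prod>b\<in>Basis. std_normal_density (inner (?s x) b)))) borel ?s"
    by (rule density_distr) measurable
  also have "(\<lambda>x. ennreal (\<Prod>b\<in>Basis. std_normal_density (inner (?s x) b))) = ?d"
    by (auto simp: fun_eq_iff inner_sum_left inner_Basis if_distrib[of "\<lambda>y. _ * y"] cong: if_cong)
  finally show ?thesis by (simp add: partial_gaussian_def dens)
qed

lemma sup_conv_ineq_std_gaussian: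
  "sup_conv_ineq (std_gaussian :: 'a::euclidean_space measure) (\<lambda>w. (norm w)\<^sup>2 / 2)"
proof -
  have "(\<Sum>b\<in>Basis. (w \<bullet> b)\<^sup>2) = (norm w)\<^sup>2" for w :: 'a
    by (subst norm_eq_sqrt_inner, subst euclidean_inner) (simp add: sum_nonneg power2_eq_square)
  then show ?thesis
    using sup_conv_ineq_partial_gaussian[of "Basis :: 'a set"] by (simp add: std_gaussian_eq)
qed

lemma prob_space_std_gaussian: "prob_space (std_gaussian :: 'a::euclidean_space measure)"
  and sets_std_gaussian [measurable_cong, simp]: "sets (std_gaussian :: 'a measure) = sets borel"
  using sup_conv_ineq_std_gaussian by (auto simp: sup_conv_ineq_def)

lemma space_std_gaussian [simp]: "space (std_gaussian :: 'a::euclidean_space measure) = UNIV"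
  using sets_eq_imp_space_eq[OF sets_std_gaussian] by simp

lemma integrable_norm_std_gaussian: "integrable (std_gaussian :: 'a::euclidean_space measure) norm"
proof -
  interpret N: prob_space std_normal by (rule prob_space_std_normal)
  have 0: "integrable std_normal (\<lambda>x. \<bar>x\<bar>)"
    using integrable_std_normal_moment_abs[of 1] by (subst integrable_density) auto
  have "integrable (\<Pi>\<^sub>M b\<in>Basis::'a set. std_normal) (\<lambda>x. \<Sum>b\<in>Basis. \<bar>x b\<bar>)"
  proof (intro Bochner_Integration.integrable_sum)
    fix b :: 'a assume b: "b \<in> Basis"
    have "integrable (distr (\<Pi>\<^sub>M b\<in>Basis::'a set. std_normal) std_normal (\<lambda>x. x b)) (\<lambda>x. \<bar>x\<bar>)"
      by (subst distr_PiM_component) (use b 0 prob_space_std_normal in auto)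
    then show "integrable (\<Pi>\<^sub>M b\<in>Basis::'a set. std_normal) (\<lambda>x. \<bar>x b\<bar>)"
      by (subst (asm) integrable_distr_eq) (use b in auto)
  qed
  then have "integrable (\<Pi>\<^sub>M b\<in>Basis::'a set. std_normal) (\<lambda>x. norm (\<Sum>b\<in>Basis. x b *\<^sub>R b :: 'a))"
  proof (rule Bochner_Integration.integrable_bound)
    show "AE x in (\<Pi>\<^sub>M b\<in>Basis::'a set. std_normal). norm (norm (\<Sum>b\<in>Basis. x b *\<^sub>R b)) \<le> norm (\<Sum>b\<in>Basis. \<bar>x b\<bar>)"
      by (intro AE_I2) (auto intro!: order_trans[OF norm_sum] sum_mono simp: sum_nonneg)
  qed measurable
  then show ?thesis unfolding std_gaussian_eq partial_gaussian_def
    by (subst integrable_distr_eq) auto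
qed

lemma sup_conv_ineq_gaussian_pair:
  "sup_conv_ineq (std_gaussian \<Otimes>\<^sub>M std_gaussian :: ('a::euclidean_space \<times> 'a) measure) (\<lambda>w. (norm w)\<^sup>2 / 2)"
proof -
  have s: "sets (std_gaussian \<Otimes>\<^sub>M std_gaussian) = sets (borel :: ('a \<times> 'a) measure)"
    by (simp only: sets_pair_measure_cong[OF sets_std_gaussian sets_std_gaussian] borel_prod)
  have "sup_conv_ineq (distr (std_gaussian \<Otimes>\<^sub>M std_gaussian) borel (\<lambda>p :: 'a \<times> 'a. p)) (\<lambda>w. (norm w)\<^sup>2 / 2)"
    by (rule sup_conv_ineq_compose[OF sup_conv_ineq_std_gaussian sup_conv_ineq_std_gaussian])
      (auto intro: lipschitz_on_id simp: norm_Pair field_simps)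
  also have "distr (std_gaussian \<Otimes>\<^sub>M std_gaussian) borel (\<lambda>p :: 'a \<times> 'a. p) = std_gaussian \<Otimes>\<^sub>M std_gaussian"
    by (rule distr_id2) (rule s[symmetric])
  finally show ?thesis .
qed

section \<open>From sup-convolution to log-Sobolev inequalities\<close>

text \<open>The slope at scale \<open>r\<close>. Unlike \<open>slope\<close> it controls every
  increment \<open>f (x + w) - f x\<close> with \<open>norm w < r\<close>, as the sup-convolution
  requires; \<open>slope\<close> is its limit as \<open>r\<close> tends to 0.\<close>

definition local_lip :: "real \<Rightarrow> ('a::euclidean_space \<Rightarrow> real) \<Rightarrow> 'a \<Rightarrow> real" where
  "local_lip r f x = (SUP w\<in>ball 0 r - {0}. \<bar>f (x + w) - f x\<bar> / norm w)"

lemma punctured_ball_nonempty: "r > 0 \<Longrightarrow> ball (0::'a::euclidean_space) r - {0} \<noteq> {}"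
proof -
  assume "r > 0"
  obtain b :: 'a where b: "b \<in> Basis" using nonempty_Basis by blast
  have "(r / 2) *\<^sub>R b \<in> ball 0 r - {0}" using b \<open>r > 0\<close> nonzero_Basis[OF b] by auto
  then show ?thesis by blast
qed

context
  fixes f :: "'a::euclidean_space \<Rightarrow> real" and K
  assumes f: "K-lipschitz_on UNIV f"
begin

lemma quotient_le: "\<bar>f (x + w) - f x\<bar> / norm w \<le> K"
  using lipschitz_on_abs_diff[OF f, of "x + w" x] lipschitz_on_nonneg[OF f]
  by (cases "w = 0") (auto simp: divide_le_eq)

lemma local_lip_bdd: "bdd_above ((\<lambda>w. \<bar>f (x + w) - f x\<bar> / norm w) ` (ball 0 r - {0}))"
  by (rule bdd_aboveI2[OF quotient_le])

lemma local_lip_upper: "w \<noteq> 0 \<Longrightarrow> norm w < r \<Longrightarrow> \<bar>f (x + w) - f x\<bar> / norm w \<le> local_lip r f x"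
  unfolding local_lip_def by (rule cSUP_upper[OF _ local_lip_bdd]) auto

lemma local_lip_le: "r > 0 \<Longrightarrow> local_lip r f x \<le> K"
  unfolding local_lip_def by (rule cSUP_least[OF punctured_ball_nonempty quotient_le])

lemma local_lip_nonneg: "r > 0 \<Longrightarrow> 0 \<le> local_lip r f x"
proof -
  assume r: "r > 0"
  obtain w :: 'a where "w \<noteq> 0" "norm w < r" using punctured_ball_nonempty[OF r, where 'a='a]
    by (metis Diff_iff all_not_in_conv insertI1 mem_ball_0)
  then have "\<bar>f (x + w) - f x\<bar> / norm w \<le> local_lip r f x" by (rule local_lip_upper)
  then show ?thesis by (rule order_trans[rotated]) simp
qed

text \<open>The function is lower semicontinuous: where it exceeds \<open>a\<close>, a single
  \<open>w\<close> already witnesses this, and for fixed \<open>w\<close> that is an open condition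
  on \<open>x\<close>. Measurability of \<open>slope\<close> follows by passing to the
  limit.\<close>

lemma local_lip_measurable: "r > 0 \<Longrightarrow> local_lip r f \<in> borel_measurable borel"
proof (rule borel_measurableI_greater)
  fix a assume r: "r > 0"
  have "{x. a < local_lip r f x} = (\<Union>w\<in>ball 0 r - {0}. {x. a < \<bar>f (x + w) - f x\<bar> / norm w})"
    unfolding local_lip_def by (subst less_cSUP_iff[OF punctured_ball_nonempty[OF r] local_lip_bdd]) auto
  moreover have "open (\<Union>w\<in>ball 0 r - {0}. {x. a < \<bar>f (x + w) - f x\<bar> / norm w})"
  proof (intro open_UN ballI open_Collect_less continuous_intros)
    note c = lipschitz_on_continuous_on[OF f]
    show "continuous_on UNIV f" by (rule c)
    show "continuous_on UNIV (\<lambda>x. f (x + w))" for w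
      by (rule continuous_on_compose2[OF c]) (auto intro: continuous_intros)
  qed auto
  ultimately show "{x \<in> space borel. a < local_lip r f x} \<in> sets borel" by simp
qed

lemma local_lip_tendsto_slope:
  assumes r: "r \<longlonglongrightarrow> 0" "\<And>n. r n > 0"
  shows "(\<lambda>n. local_lip (r n) f x) \<longlonglongrightarrow> slope f x"
proof -
  let ?q = "\<lambda>y. ereal (\<bar>f y - f x\<bar> / norm (y - x))"
  let ?L = "Limsup (at x) ?q"
  have q: "ereal (\<bar>f y - f x\<bar> / norm (y - x)) \<le> local_lip e f x" if "y \<in> ball x e - {x}" for y e
    using local_lip_upper[of "y - x" e x] that by (auto simp: dist_norm norm_minus_commute)
  have L: "?L = (INF e\<in>{0<..}. SUP y\<in>ball x e - {x}. ?q y)"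
    by (rule Limsup_at)
  have up: "?L \<le> ereal (local_lip e f x)" if "e > 0" for e
  proof -
    have "?L \<le> (SUP y\<in>ball x e - {x}. ?q y)" unfolding L by (rule INF_lower) (use that in simp)
    also have "\<dots> \<le> ereal (local_lip e f x)" by (rule SUP_least) (rule q)
    finally show ?thesis .
  qed
  have "0 \<le> ?L" unfolding L
  proof (rule INF_greatest)
    fix e :: real assume "e \<in> {0<..}"
    then obtain w :: 'a where w: "w \<in> ball 0 e - {0}" using punctured_ball_nonempty[of e, where 'a='a] by fastforce
    have "0 \<le> ?q (x + w)" by simp
    also have "\<dots> \<le> (SUP y\<in>ball x e - {x}. ?q y)" by (rule SUP_upper) (use w in \<open>auto simp: dist_norm\<close>)
    finally show "0 \<le> (SUP y\<in>ball x e - {x}. ?q y)" .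
  qed
  \<comment> \<open>The limsup is finite, so \<open>real_of_ereal\<close> in the definition of
    \<open>slope\<close> loses nothing.\<close>
  then obtain l where l: "?L = ereal l" using up[of 1] by (cases ?L) auto
  then have sl: "slope f x = l" by (simp add: slope_def)
  show ?thesis unfolding sl
  proof (rule LIMSEQ_I)
    fix \<epsilon> :: real assume \<epsilon>: "\<epsilon> > 0"
    then have "(INF e\<in>{0<..}. SUP y\<in>ball x e - {x}. ?q y) < ereal (l + \<epsilon> / 2)" using l L by simp
    then obtain e where e: "e > 0" "(SUP y\<in>ball x e - {x}. ?q y) < ereal (l + \<epsilon> / 2)"
      unfolding INF_less_iff by auto
    from LIMSEQ_D[OF r(1) e(1)] obtain N where N: "\<And>n. n \<ge> N \<Longrightarrow> r n < e" using r(2) by (force simp: less_imp_le)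
    have "norm (local_lip (r n) f x - l) < \<epsilon>" if "n \<ge> N" for n
    proof -
      have "local_lip (r n) f x \<le> l + \<epsilon> / 2" unfolding local_lip_def
      proof (rule cSUP_least[OF punctured_ball_nonempty[OF r(2)]])
        fix w :: 'a assume w: "w \<in> ball 0 (r n) - {0}"
        have "?q (x + w) \<le> (SUP y\<in>ball x e - {x}. ?q y)"
          by (rule SUP_upper) (use w N[OF that] in \<open>auto simp: dist_norm\<close>)
        then have "?q (x + w) \<le> ereal (l + \<epsilon> / 2)" by (rule order_trans[OF _ less_imp_le[OF e(2)]])
        then show "\<bar>f (x + w) - f x\<bar> / norm w \<le> l + \<epsilon> / 2" by simp
      qed
      moreover have "l \<le> local_lip (r n) f x" using up[OF r(2), of n] l by simp
      ultimately show ?thesis using \<epsilon> by simp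
    qed
    then show "\<exists>no. \<forall>n\<ge>no. norm (local_lip (r n) f x - l) < \<epsilon>" by blast
  qed
qed

lemma slope_nonneg: "0 \<le> slope f x"
  by (rule LIMSEQ_le_const[OF local_lip_tendsto_slope[OF LIMSEQ_inverse_real_of_nat]])
    (auto intro!: local_lip_nonneg)

lemma slope_le: "slope f x \<le> K"
  by (rule LIMSEQ_le_const2[OF local_lip_tendsto_slope[OF LIMSEQ_inverse_real_of_nat]])
    (auto intro!: local_lip_le)

lemma slope_measurable: "slope f \<in> borel_measurable borel"
  by (rule borel_measurable_LIMSEQ_real[OF local_lip_tendsto_slope[OF LIMSEQ_inverse_real_of_nat]])
    (auto intro!: local_lip_measurable)

end

text \<open>Small balls around \<open>x\<close> are mapped by \<open>\<phi>\<close> into any given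
  neighbourhood of \<open>\<phi> x\<close>, where the difference quotients of \<open>h\<close> are
  at most \<open>\<bar>d\<bar> + \<epsilon>\<close>. The Lipschitz bound on the composition makes
  its slope the limit of its local Lipschitz constants.\<close>

lemma slope_chain:
  fixes \<phi> :: "'a::euclidean_space \<Rightarrow> real"
  assumes \<phi>: "K-lipschitz_on UNIV \<phi>" and h\<phi>: "K'-lipschitz_on UNIV (\<lambda>x. h (\<phi> x))"
    and h: "(h has_real_derivative d) (at (\<phi> x))"
  shows "slope (\<lambda>x. h (\<phi> x)) x \<le> \<bar>d\<bar> * slope \<phi> x"
proof -
  have "slope (\<lambda>x. h (\<phi> x)) x \<le> (\<bar>d\<bar> + \<epsilon>) * slope \<phi> x" if \<epsilon>: "\<epsilon> > 0" for \<epsilon>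
  proof -
    obtain e where e: "e > 0" "\<And>s. \<bar>s - \<phi> x\<bar> < e \<Longrightarrow> \<bar>h s - h (\<phi> x) - (s - \<phi> x) * d\<bar> \<le> \<epsilon> * \<bar>s - \<phi> x\<bar>"
      using h \<epsilon> unfolding has_field_derivative_def has_derivative_at_alt by (force simp: mult.commute)
    have near: "\<bar>h s - h (\<phi> x)\<bar> \<le> (\<bar>d\<bar> + \<epsilon>) * \<bar>s - \<phi> x\<bar>" if "\<bar>s - \<phi> x\<bar> < e" for s
    proof -
      have "\<bar>h s - h (\<phi> x)\<bar> \<le> \<epsilon> * \<bar>s - \<phi> x\<bar> + \<bar>(s - \<phi> x) * d\<bar>" using e(2)[OF that] by linarith
      then show ?thesis unfolding abs_mult distrib_right using mult.commute[of "\<bar>s - \<phi> x\<bar>" "\<bar>d\<bar>"] by linarith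
    qed
    \<comment> \<open>\<open>K + 1\<close> instead of \<open>K\<close> covers \<open>K = 0\<close>
      and keeps the image of the ball strictly within distance \<open>e\<close> of
      \<open>\<phi> x\<close>.\<close>
    define r where "r n = e / (K + 1) * inverse (real (Suc n))" for n
    have K: "K \<ge> 0" by (rule lipschitz_on_nonneg[OF \<phi>])
    have r: "r \<longlonglongrightarrow> 0" "\<And>n. r n > 0"
      unfolding r_def using tendsto_mult_left[OF LIMSEQ_inverse_real_of_nat, of "e / (K + 1)"] e K
      by (auto intro!: mult_pos_pos divide_pos_pos)
    have le: "local_lip (r n) (\<lambda>x. h (\<phi> x)) x \<le> (\<bar>d\<bar> + \<epsilon>) * local_lip (r n) \<phi> x" for n
      unfolding local_lip_def[of _ "\<lambda>x. h (\<phi> x)"]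
    proof (rule cSUP_least[OF punctured_ball_nonempty[OF r(2)]])
      fix w :: 'a assume w: "w \<in> ball 0 (r n) - {0}"
      have "\<bar>\<phi> (x + w) - \<phi> x\<bar> \<le> K * norm w" using lipschitz_on_abs_diff[OF \<phi>, of "x + w" x] by simp
      also have "\<dots> \<le> K * (e / (K + 1))"
      proof (rule mult_left_mono[OF _ K])
        have "r n \<le> e / (K + 1)" unfolding r_def
          using e K by (intro mult_left_le) (auto simp: field_simps)
        then show "norm w \<le> e / (K + 1)" using w by simp
      qed
      also have "\<dots> < e" using e K by (simp add: field_simps)
      finally have "\<bar>h (\<phi> (x + w)) - h (\<phi> x)\<bar> / norm w \<le> (\<bar>d\<bar> + \<epsilon>) * \<bar>\<phi> (x + w) - \<phi> x\<bar> / norm w"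
        by (intro divide_right_mono near) auto
      also have "\<dots> \<le> (\<bar>d\<bar> + \<epsilon>) * local_lip (r n) \<phi> x"
        unfolding times_divide_eq_right[symmetric]
        by (rule mult_left_mono[OF local_lip_upper[OF \<phi>]]) (use w \<epsilon> in auto)
      finally show "\<bar>h (\<phi> (x + w)) - h (\<phi> x)\<bar> / norm w \<le> (\<bar>d\<bar> + \<epsilon>) * local_lip (r n) \<phi> x" .
    qed
    show ?thesis
      by (rule LIMSEQ_le[OF local_lip_tendsto_slope[OF h\<phi> r] tendsto_mult_left[OF local_lip_tendsto_slope[OF \<phi> r]]])
        (use le in blast)
  qed
  note bound = this
  have s: "0 \<le> slope \<phi> x" by (rule slope_nonneg[OF \<phi>])
  show ?thesis
  proof (rule field_le_epsilon)
    fix \<epsilon> :: real assume \<epsilon>: "\<epsilon> > 0"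
    have "slope (\<lambda>x. h (\<phi> x)) x \<le> (\<bar>d\<bar> + \<epsilon> / (slope \<phi> x + 1)) * slope \<phi> x"
      by (rule bound) (use \<epsilon> s in auto)
    also have "\<dots> \<le> \<bar>d\<bar> * slope \<phi> x + \<epsilon>"
      using \<epsilon> s by (simp add: field_simps)
    finally show "slope (\<lambda>x. h (\<phi> x)) x \<le> \<bar>d\<bar> * slope \<phi> x + \<epsilon>" .
  qed
qed

text \<open>For \<open>t = 1 / (1 + s)\<close> the two sides of the sup-convolution inequality agree
  at \<open>s = 0\<close>, so their derivatives there are ordered in the same way. The derivative of
  the left side is the entropy of \<open>exp f\<close>; on the right the sup-convolution exceeds
  \<open>f\<close> by about \<open>s * C * (slope f z)^2 / 2\<close>.\<close>

lemma sup_conv_ineq_entropy: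
  fixes f :: "'a::euclidean_space \<Rightarrow> real"
  assumes \<mu>: "sup_conv_ineq \<mu> q" and q: "q 0 = 0" "\<And>w. (norm w)\<^sup>2 / (2 * C) \<le> q w" and C: "C > 0"
    and f: "bdd_lipschitz f"
  shows "(\<integral>z. f z * exp (f z) \<partial>\<mu>) - (\<integral>z. exp (f z) \<partial>\<mu>) * ln (\<integral>z. exp (f z) \<partial>\<mu>)
    \<le> C / 2 * (\<integral>z. exp (f z) * (slope f z)\<^sup>2 \<partial>\<mu>)"
proof -
  from \<mu> have ps: "prob_space \<mu>" and st [measurable_cong]: "sets \<mu> = sets borel"
    by (auto simp: sup_conv_ineq_def)
  interpret prob_space \<mu> by fact
  obtain B where B: "\<And>x. \<bar>f x\<bar> \<le> B" using bdd_lipschitzE[OF f] by metis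
  from f obtain K' where K': "K'-lipschitz_on UNIV f" unfolding bdd_lipschitz_def by auto
  define K where "K = K' + 1"
  have K: "K-lipschitz_on UNIV f" "K > 0" unfolding K_def
    using lipschitz_on_le[OF K', of "K' + 1"] lipschitz_on_nonneg[OF K'] by auto
  note fm [measurable] = bdd_lipschitz_measurable[OF f]
  have qpos: "0 \<le> q w" for w using q(2)[of w] C by (smt (verit) divide_nonneg_pos zero_le_power2)
  define s where "s n = inverse (real (Suc n))" for n
  have s: "s n > 0" "s \<longlonglongrightarrow> 0" for n unfolding s_def by (simp, rule LIMSEQ_inverse_real_of_nat)
  define A where "A = C * K\<^sup>2 / 2"
  \<comment> \<open>From this radius on the cost \<open>(norm w)^2 / (2 * C * s n)\<close> is at
    least \<open>K * norm w\<close>, so far points never improve the supremum and only the Lipschitz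
    constant at scale \<open>r n\<close> matters.\<close>
  define r where "r n = 2 * C * K * s n" for n
  have r: "r n > 0" "r \<longlonglongrightarrow> 0" for n
    unfolding r_def using K C s tendsto_mult_left[OF s(2), of "2 * C * K"] by auto
  define a where "a n z = C * (local_lip (r n) f z)\<^sup>2 / 2" for n z
  have a: "0 \<le> a n z" "a n z \<le> A" for n z
    using local_lip_nonneg[OF K(1) r(1), of n z] local_lip_le[OF K(1) r(1), of n z] C
    by (auto simp: a_def A_def intro!: power_mono)
  have A0: "0 \<le> A" using order_trans[OF a] .
  have [measurable]: "a n \<in> borel_measurable borel" for n
    unfolding a_def using local_lip_measurable[OF K(1) r(1), of n] by measurable
  have [measurable]: "slope f \<in> borel_measurable borel" by (rule slope_measurable[OF K(1)])
  define E where "E = (\<integral>z. exp (f z) \<partial>\<mu>)"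
  define F where "F = (\<integral>z. f z * exp (f z) \<partial>\<mu>)"
  define S where "S n = sup_conv (\<lambda>w. 1 / s n * q w) f" for n
  have S_bl: "bdd_lipschitz (S n)" for n unfolding S_def
    by (rule bdd_lipschitz_sup_conv[OF _ _ f]) (use s(1)[of n] q qpos in auto)
  have int: "integrable \<mu> (\<lambda>z. g (k z))" if "bdd_lipschitz k" "continuous_on UNIV g"
    for k :: "'a \<Rightarrow> real" and g :: "real \<Rightarrow> real"
    by (rule bdd_lipschitz_integrable[OF ps st that])
  have iE: "integrable \<mu> (\<lambda>z. exp (f z))" by (rule int[OF f]) (intro continuous_intros)
  have iF: "integrable \<mu> (\<lambda>z. f z * exp (f z))"
    by (rule int[OF f, of "\<lambda>x. x * exp x"]) (intro continuous_intros)
  have Epos: "E > 0" unfolding E_def by (rule expectation_pos[OF iE]) simp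
  have S_le: "S n z \<le> f z + s n * a n z" for n z
    unfolding S_def
  proof (rule sup_conv_least)
    fix w
    have "f (z + w) - (norm w)\<^sup>2 / (2 * C * s n) \<le> f z + s n * a n z"
    proof (cases "w = 0 \<or> norm w \<ge> r n")
      case True
      have "f (z + w) - f z \<le> K * norm w" using lipschitz_on_abs_diff[OF K(1), of "z + w" z] by simp
      also have "\<dots> \<le> (norm w)\<^sup>2 / (2 * C * s n)"
        using True C s(1)[of n] mult_right_mono[of "r n" "norm w" "norm w"]
        by (auto simp: r_def field_simps power2_eq_square)
      finally show ?thesis using a(1)[of n z] s(1)[of n] by (smt (verit) mult_nonneg_nonneg)
    next
      case False
      let ?D = "local_lip (r n) f z"
      have "\<bar>f (z + w) - f z\<bar> / norm w \<le> ?D" using False by (intro local_lip_upper[OF K(1)]) auto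
      then have "f (z + w) - f z \<le> ?D * norm w" using False by (auto simp: divide_le_eq)
      also have "\<dots> \<le> (norm w)\<^sup>2 / (2 * C * s n) + s n * a n z"
      proof -
        \<comment> \<open>The expression \<open>?D * norm w - (norm w)^2 / (2 * C * s n)\<close> is
          largest at \<open>norm w = C * s n * ?D\<close>, with value
          \<open>s n * a n z\<close>.\<close>
        have "0 \<le> (norm w - C * s n * ?D)\<^sup>2 / (2 * C * s n)" using C s(1)[of n] by simp
        also have "\<dots> = (norm w)\<^sup>2 / (2 * C * s n) + s n * a n z - ?D * norm w"
          using C s(1)[of n] by (simp add: a_def field_simps power2_eq_square)
        finally show ?thesis by simp
      qed
      finally show ?thesis by simp
    qed
    moreover have "(norm w)\<^sup>2 / (2 * C * s n) \<le> 1 / s n * q w"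
      using q(2)[of w] s(1)[of n] C by (simp add: field_simps)
    ultimately show "f (z + w) - 1 / s n * q w \<le> f z + s n * a n z" by linarith
  qed (use s(1)[of n] q qpos f in auto)
  \<comment> \<open>Both sides are linearised in \<open>s n\<close>: the left from below by
    \<open>1 + y \<le> exp y\<close>, the right from above by
    \<open>exp y \<le> 1 + y * exp y\<close>. What remains is a difference quotient at 0 on the
    left.\<close>
  have step: "((E + s n * F) powr (1 / (1 + s n)) - E) / s n \<le> exp (s n * A) * (\<integral>z. exp (f z) * a n z \<partial>\<mu>)"
    if pos: "E + s n * F > 0" for n
  proof -
    define t where "t = 1 / (1 + s n)"
    have t: "0 < t" "t < 1" "t / (1 - t) = 1 / s n" "1 / t = 1 + s n"
      using s(1)[of n] by (auto simp: t_def field_simps)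
    have "E + s n * F = (\<integral>z. exp (f z) + s n * (f z * exp (f z)) \<partial>\<mu>)"
      using iE iF by (simp add: E_def F_def)
    also have "\<dots> \<le> (\<integral>z. exp (f z / t) \<partial>\<mu>)"
    proof (rule integral_mono)
      show "integrable \<mu> (\<lambda>z. exp (f z / t))" by (rule int[OF f]) (intro continuous_intros, use t in auto)
      show "exp (f z) + s n * (f z * exp (f z)) \<le> exp (f z / t)" for z
      proof -
        have "exp (f z / t) = exp (f z) * exp (s n * f z)"
          using t(4) by (simp add: divide_inverse exp_add[symmetric] algebra_simps)
        moreover have "exp (f z) * (1 + s n * f z) \<le> exp (f z) * exp (s n * f z)"
          by (intro mult_left_mono exp_ge_add_one_self) simp
        ultimately show ?thesis by (simp add: algebra_simps)
      qed
    qed (use iE iF in simp)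
    finally have "(E + s n * F) powr t \<le> (\<integral>z. exp (f z / t) \<partial>\<mu>) powr t"
      using pos t by (intro powr_mono2) auto
    also have "\<dots> \<le> (\<integral>z. exp (S n z) \<partial>\<mu>)"
      using \<mu> f t unfolding sup_conv_ineq_def S_def by metis
    also have "\<dots> \<le> (\<integral>z. exp (f z) + s n * exp (s n * A) * (exp (f z) * a n z) \<partial>\<mu>)"
    proof (rule integral_mono)
      show "integrable \<mu> (\<lambda>z. exp (S n z))" by (rule int[OF S_bl]) (intro continuous_intros)
      have "integrable \<mu> (\<lambda>z. exp (f z) * a n z)"
        by (rule Bochner_Integration.integrable_bound[OF integrable_mult_left[OF iE, of A]])
          (use a A0 in \<open>auto intro!: AE_I2 mult_left_mono simp: abs_mult\<close>)
      then show "integrable \<mu> (\<lambda>z. exp (f z) + s n * exp (s n * A) * (exp (f z) * a n z))"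
        using iE by auto
      show "exp (S n z) \<le> exp (f z) + s n * exp (s n * A) * (exp (f z) * a n z)" for z
      proof -
        define y where "y = s n * a n z"
        have y: "0 \<le> y" "y \<le> s n * A" using a[of n z] s(1)[of n] by (auto simp: y_def)
        have "1 - y \<le> exp (- y)" using exp_ge_add_one_self[of "- y"] by simp
        then have "exp y * (1 - y) \<le> exp y * exp (- y)" by (intro mult_left_mono) auto
        then have "exp y \<le> 1 + y * exp y" by (simp add: exp_minus algebra_simps)
        also have "\<dots> \<le> 1 + y * exp (s n * A)" using y by (intro add_left_mono mult_left_mono) auto
        finally have "exp (f z) * exp y \<le> exp (f z) * (1 + y * exp (s n * A))" by (intro mult_left_mono) auto
        moreover have "exp (S n z) \<le> exp (f z) * exp y"
          unfolding exp_add[symmetric] y_def using S_le by simp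
        ultimately show ?thesis by (simp add: y_def algebra_simps)
      qed
    qed
    also have "\<dots> = E + s n * exp (s n * A) * (\<integral>z. exp (f z) * a n z \<partial>\<mu>)"
    proof (subst Bochner_Integration.integral_add)
      show "integrable \<mu> (\<lambda>z. s n * exp (s n * A) * (exp (f z) * a n z))"
        by (intro integrable_mult_right Bochner_Integration.integrable_bound[OF integrable_mult_left[OF iE, of A]])
          (use a A0 in \<open>auto intro!: AE_I2 mult_left_mono simp: abs_mult\<close>)
    qed (simp_all add: iE E_def)
    finally show ?thesis unfolding t_def using s(1)[of n] by (simp add: field_simps)
  qed
  have lim_r: "(\<lambda>n. exp (s n * A) * (\<integral>z. exp (f z) * a n z \<partial>\<mu>))
      \<longlonglongrightarrow> exp (0 * A) * (\<integral>z. exp (f z) * (C * (slope f z)\<^sup>2 / 2) \<partial>\<mu>)"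
  proof (intro tendsto_mult tendsto_exp s tendsto_const)
    show "(\<lambda>n. \<integral>z. exp (f z) * a n z \<partial>\<mu>) \<longlonglongrightarrow> (\<integral>z. exp (f z) * (C * (slope f z)\<^sup>2 / 2) \<partial>\<mu>)"
    proof (rule integral_dominated_convergence[where w = "\<lambda>z. exp (f z) * A"])
      show "AE z in \<mu>. (\<lambda>n. exp (f z) * a n z) \<longlonglongrightarrow> exp (f z) * (C * (slope f z)\<^sup>2 / 2)"
        unfolding a_def
        by (intro AE_I2 tendsto_mult tendsto_const tendsto_divide tendsto_power local_lip_tendsto_slope[OF K(1)] r) auto
      show "AE z in \<mu>. norm (exp (f z) * a n z) \<le> exp (f z) * A" for n
        using a by (auto intro!: AE_I2 mult_left_mono simp: abs_mult)
    qed (use iE in auto)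
  qed
  have lim_l: "(\<lambda>n. ((E + s n * F) powr (1 / (1 + s n)) - E) / s n) \<longlonglongrightarrow> F - E * ln E"
  proof -
    let ?k = "\<lambda>x. (E + x * F) powr (1 / (1 + x))"
    have "((\<lambda>x. exp (ln (E + x * F) / (1 + x))) has_real_derivative (F - E * ln E)) (at 0)"
      by (rule derivative_eq_intros refl | use Epos in \<open>force simp: field_simps\<close>)+
    moreover have "eventually (\<lambda>x. exp (ln (E + x * F) / (1 + x)) = ?k x) (nhds 0)"
    proof -
      have "((\<lambda>x. E + x * F) \<longlongrightarrow> E + 0 * F) (nhds 0)" by (intro tendsto_intros filterlim_ident)
      then have "eventually (\<lambda>x. E + x * F > 0) (nhds 0)" using Epos by (auto dest: order_tendstoD)
      then show ?thesis by eventually_elim (simp add: powr_def)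
    qed
    ultimately have "(?k has_real_derivative (F - E * ln E)) (at 0)"
      by (subst (asm) DERIV_cong_ev[OF refl _ refl])
    then have "((\<lambda>h. (?k h - E) / h) \<longlongrightarrow> F - E * ln E) (at 0)"
      using Epos by (simp add: DERIV_def)
    then show ?thesis
      by (rule filterlim_compose) (use s in \<open>auto simp: filterlim_at less_imp_neq[symmetric] intro!: eventuallyI\<close>)
  qed
  have ev: "eventually (\<lambda>n. E + s n * F > 0) sequentially"
  proof -
    have "(\<lambda>n. E + s n * F) \<longlonglongrightarrow> E + 0 * F" by (intro tendsto_intros s)
    then show ?thesis using Epos by (auto dest: order_tendstoD)
  qed
  have "F - E * ln E \<le> exp (0 * A) * (\<integral>z. exp (f z) * (C * (slope f z)\<^sup>2 / 2) \<partial>\<mu>)"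
    by (rule tendsto_le[OF _ lim_r lim_l]) (use ev step in \<open>auto elim: eventually_mono\<close>)
  also have "(\<lambda>z. exp (f z) * (C * (slope f z)\<^sup>2 / 2)) = (\<lambda>z. C / 2 * (exp (f z) * (slope f z)\<^sup>2))"
    by auto
  finally show ?thesis by (simp add: E_def F_def del: times_divide_eq_left)
qed

lemma bdd_lipschitz_comp_deriv:
  fixes f :: "'a::real_normed_vector \<Rightarrow> real" and g :: "real \<Rightarrow> real"
  assumes f: "bdd_lipschitz f" and B: "\<And>x. \<bar>f x\<bar> \<le> B"
    and g: "\<And>s. \<bar>s\<bar> \<le> B \<Longrightarrow> (g has_real_derivative g' s) (at s)" and D: "\<And>s. \<bar>s\<bar> \<le> B \<Longrightarrow> \<bar>g' s\<bar> \<le> D"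
  shows "bdd_lipschitz (\<lambda>x. g (f x))"
proof -
  obtain C where C: "C > 0" "\<And>x y. \<bar>f x - f y\<bar> \<le> C * norm (x - y)" using bdd_lipschitzE[OF f] by metis
  have B0: "0 \<le> B" using B[of undefined] by linarith
  have D0: "0 \<le> D" using D[of 0] B0 by simp
  have gb: "\<bar>g s - g t\<bar> \<le> D * \<bar>s - t\<bar>" if "\<bar>s\<bar> \<le> B" "\<bar>t\<bar> \<le> B" for s t
  proof -
    have "norm (g s - g t) \<le> D * norm (s - t)"
    proof (rule field_differentiable_bound[of "{-B..B}" g g'])
      fix z assume "z \<in> {-B..B}"
      then have z: "\<bar>z\<bar> \<le> B" by auto
      show "(g has_field_derivative g' z) (at z within {-B..B})"
        by (rule has_field_derivative_at_within[OF g[OF z]])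
      show "norm (g' z) \<le> D" using D[OF z] by simp
    qed (use that in auto)
    then show ?thesis by simp
  qed
  show ?thesis
  proof (rule bdd_lipschitzI)
    show "\<bar>g (f x)\<bar> \<le> \<bar>g 0\<bar> + D * B" for x
    proof -
      have "\<bar>g (f x) - g 0\<bar> \<le> D * \<bar>f x - 0\<bar>" by (rule gb) (use B B0 in auto)
      also have "\<dots> \<le> D * B" using B[of x] D0 by (simp add: mult_left_mono)
      finally show ?thesis by linarith
    qed
    show "g (f x) - g (f y) \<le> D * C * norm (x - y)" for x y
    proof -
      have "g (f x) - g (f y) \<le> D * \<bar>f x - f y\<bar>" using gb[OF B B, of x y] by linarith
      also have "\<dots> \<le> D * (C * norm (x - y))" using C(2) D0 by (intro mult_left_mono)
      finally show ?thesis by simp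
    qed
  qed (use D0 C in simp)
qed

lemma abs_xlnx_le: "0 < y \<Longrightarrow> \<bar>y * ln y\<bar> \<le> 1 + y\<^sup>2" for y :: real
proof -
  assume y: "0 < y"
  define w where "w = y * ln y"
  have "y * ln y \<le> y * (y - 1)" using y by (intro mult_left_mono ln_le_minus_one) auto
  then have 1: "w \<le> y * y - y" by (simp add: w_def algebra_simps)
  have "ln (inverse y) \<le> inverse y - 1" by (rule ln_le_minus_one) (use y in simp)
  then have "y * (1 - inverse y) \<le> y * ln y" using y by (intro mult_left_mono) (auto simp: ln_inverse)
  then have 2: "y - 1 \<le> w" using y by (simp add: w_def algebra_simps)
  show ?thesis using 1 2 mult_pos_pos[OF y y] y
    unfolding w_def[symmetric] power2_eq_square abs_le_iff by linarith
qed

lemma xlnx_tendsto: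
  assumes "0 \<le> (a::real)"
  shows "(\<lambda>n. (a + inverse (real (Suc n))) * ln (a + inverse (real (Suc n)))) \<longlonglongrightarrow> a * ln a"
proof (cases "a = 0")
  case True
  have "(\<lambda>n. - (ln (real (Suc n)) / real (Suc n))) \<longlonglongrightarrow> - 0"
    by (intro tendsto_minus LIMSEQ_Suc lim_ln_over_n)
  moreover have eq: "(0 + inverse k) * ln (0 + inverse k) = - (ln k / k)" if "0 < k" for k :: real
    using that by (simp add: ln_inverse divide_inverse)
  have "(\<lambda>n. (0 + inverse (real (Suc n))) * ln (0 + inverse (real (Suc n)))) = (\<lambda>n. - (ln (real (Suc n)) / real (Suc n)))"
    by (rule ext, rule eq) simp
  ultimately show ?thesis unfolding True by (simp only: minus_zero mult_zero_left)
next
  case False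
  have "(\<lambda>n. (a + inverse (real (Suc n))) * ln (a + inverse (real (Suc n)))) \<longlonglongrightarrow> (a + 0) * ln (a + 0)"
    by (intro tendsto_intros LIMSEQ_inverse_real_of_nat) (use False in auto)
  then show ?thesis by simp
qed

text \<open>The entropy inequality is applied to \<open>ln (\<phi>^2 + e n)\<close>, where the added
  constant keeps the logarithm bounded and Lipschitz across the zeros of \<open>\<phi>\<close>. By
  the chain rule for slopes, \<open>exp f\<close> times the squared slope of \<open>f\<close> is at
  most 4 times the squared slope of \<open>\<phi>\<close>, and the 4 turns \<open>C / 2\<close> into
  \<open>2 * C\<close>.\<close>

lemma log_sobolev_if_sup_conv_ineq:
  fixes \<mu> :: "'a::euclidean_space measure"
  assumes \<mu>: "sup_conv_ineq \<mu> q" and q: "q 0 = 0" "\<And>w. (norm w)\<^sup>2 / (2 * C) \<le> q w" and C: "C > 0"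
  shows "log_sobolev \<mu> (2 * C)"
proof -
  from \<mu> have ps: "prob_space \<mu>" and st [measurable_cong]: "sets \<mu> = sets borel"
    by (auto simp: sup_conv_ineq_def)
  interpret prob_space \<mu> by fact
  have "(\<integral>z. (\<phi> z)\<^sup>2 * ln ((\<phi> z)\<^sup>2) \<partial>\<mu>) - (\<integral>z. (\<phi> z)\<^sup>2 \<partial>\<mu>) * ln (\<integral>z. (\<phi> z)\<^sup>2 \<partial>\<mu>)
          \<le> (2 * C) * (\<integral>z. (slope \<phi> z)\<^sup>2 \<partial>\<mu>)"
    if \<phi>: "bdd_lipschitz \<phi>" for \<phi> :: "'a \<Rightarrow> real"
  proof -
    obtain B where B: "\<And>x. \<bar>\<phi> x\<bar> \<le> B" using bdd_lipschitzE[OF \<phi>] by metis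
    from \<phi> obtain K where K: "K-lipschitz_on UNIV \<phi>" unfolding bdd_lipschitz_def by auto
    note [measurable] = bdd_lipschitz_measurable[OF \<phi>] slope_measurable[OF K]
    have B2: "(\<phi> z)\<^sup>2 \<le> B\<^sup>2" for z using B[of z] by (simp add: abs_le_square_iff[symmetric])
    have slope2: "(slope \<phi> z)\<^sup>2 \<le> K\<^sup>2" for z
      using slope_nonneg[OF K, of z] slope_le[OF K, of z] by (rule power_mono[rotated])
    have islope: "integrable \<mu> (\<lambda>z. (slope \<phi> z)\<^sup>2)"
      by (rule integrable_const_bound[of _ "K\<^sup>2"]) (use slope2 in auto)
    have i2: "integrable \<mu> (\<lambda>z. (\<phi> z)\<^sup>2)"
      by (rule integrable_const_bound[of _ "B\<^sup>2"]) (use B2 in auto)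
    define e where "e n = inverse (real (Suc n))" for n
    have e: "0 < e n" "e n \<le> 1" for n by (auto simp: e_def field_simps)
    define E where "E = (\<integral>z. (\<phi> z)\<^sup>2 \<partial>\<mu>)"
    have E0: "0 \<le> E" unfolding E_def by (intro integral_nonneg_AE) simp
    have le: "(\<integral>z. ((\<phi> z)\<^sup>2 + e n) * ln ((\<phi> z)\<^sup>2 + e n) \<partial>\<mu>) - (E + e n) * ln (E + e n)
        \<le> 2 * C * (\<integral>z. (slope \<phi> z)\<^sup>2 \<partial>\<mu>)" for n
    proof -
      let ?h = "\<lambda>s. ln (s\<^sup>2 + e n)"
      let ?f = "\<lambda>z. ?h (\<phi> z)"
      have pos: "0 < s\<^sup>2 + e n" for s :: real by (intro add_nonneg_pos e) simp
      have d: "(?h has_real_derivative 2 * s / (s\<^sup>2 + e n)) (at s)" for s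
        using pos[of s] by (auto intro!: derivative_eq_intros simp: field_simps)
      have f: "bdd_lipschitz ?f"
      proof (rule bdd_lipschitz_comp_deriv[OF \<phi> B d])
        show "\<bar>2 * s / (s\<^sup>2 + e n)\<bar> \<le> 2 * B / e n" if "\<bar>s\<bar> \<le> B" for s
          unfolding abs_divide using pos[of s] e[of n] that by (intro frac_le) auto
      qed
      from f obtain K' where K': "K'-lipschitz_on UNIV ?f" unfolding bdd_lipschitz_def by auto
      have exp_f: "exp (?f z) = (\<phi> z)\<^sup>2 + e n" for z using pos[of "\<phi> z"] by simp
      have int_e: "(\<integral>z. (\<phi> z)\<^sup>2 + e n \<partial>\<mu>) = E + e n" using i2 prob_space by (simp add: E_def)
      have "(\<integral>z. ?f z * exp (?f z) \<partial>\<mu>) - (\<integral>z. exp (?f z) \<partial>\<mu>) * ln (\<integral>z. exp (?f z) \<partial>\<mu>)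
          \<le> C / 2 * (\<integral>z. exp (?f z) * (slope ?f z)\<^sup>2 \<partial>\<mu>)"
        by (rule sup_conv_ineq_entropy[OF \<mu> q C f])
      also have "\<dots> \<le> C / 2 * (\<integral>z. 4 * (slope \<phi> z)\<^sup>2 \<partial>\<mu>)"
      proof (intro mult_left_mono integral_mono')
        show "exp (?f z) * (slope ?f z)\<^sup>2 \<le> 4 * (slope \<phi> z)\<^sup>2" for z
        proof -
          let ?p = "(\<phi> z)\<^sup>2 + e n"
          have "slope ?f z \<le> \<bar>2 * \<phi> z / ?p\<bar> * slope \<phi> z"
            by (rule slope_chain[OF K K' d])
          then have "(slope ?f z)\<^sup>2 \<le> (\<bar>2 * \<phi> z / ?p\<bar> * slope \<phi> z)\<^sup>2"
            using slope_nonneg[OF K'] by (rule power_mono)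
          then have "?p * (slope ?f z)\<^sup>2 \<le> ?p * (\<bar>2 * \<phi> z / ?p\<bar> * slope \<phi> z)\<^sup>2"
            using pos[of "\<phi> z"] by (intro mult_left_mono) auto
          also have "\<dots> = 4 * ((\<phi> z)\<^sup>2 / ?p) * (slope \<phi> z)\<^sup>2"
            using pos[of "\<phi> z"] by (simp add: power_mult_distrib power_divide) (simp add: power2_eq_square)
          also have "\<dots> \<le> 4 * 1 * (slope \<phi> z)\<^sup>2"
            using pos[of "\<phi> z"] e[of n] by (intro mult_right_mono mult_left_mono) (auto simp: divide_le_eq)
          finally show ?thesis unfolding exp_f by simp
        qed
      qed (use C islope in auto)
      finally show ?thesis unfolding exp_f int_e by (simp add: mult.commute)
    qed
    have "(\<integral>z. (\<phi> z)\<^sup>2 * ln ((\<phi> z)\<^sup>2) \<partial>\<mu>) - E * ln E \<le> 2 * C * (\<integral>z. (slope \<phi> z)\<^sup>2 \<partial>\<mu>)"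
    proof (rule LIMSEQ_le_const2)
      show "(\<lambda>n. (\<integral>z. ((\<phi> z)\<^sup>2 + e n) * ln ((\<phi> z)\<^sup>2 + e n) \<partial>\<mu>) - (E + e n) * ln (E + e n))
        \<longlonglongrightarrow> (\<integral>z. (\<phi> z)\<^sup>2 * ln ((\<phi> z)\<^sup>2) \<partial>\<mu>) - E * ln E"
      proof (rule tendsto_diff)
        show "(\<lambda>n. (E + e n) * ln (E + e n)) \<longlonglongrightarrow> E * ln E"
          unfolding e_def by (rule xlnx_tendsto[OF E0])
        show "(\<lambda>n. \<integral>z. ((\<phi> z)\<^sup>2 + e n) * ln ((\<phi> z)\<^sup>2 + e n) \<partial>\<mu>) \<longlonglongrightarrow> (\<integral>z. (\<phi> z)\<^sup>2 * ln ((\<phi> z)\<^sup>2) \<partial>\<mu>)"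
        \<comment> \<open>One constant dominates all approximants, because
          \<open>\<bar>y * ln y\<bar> \<le> 1 + y^2\<close> for positive \<open>y\<close> and
          \<open>e n \<le> 1\<close>.\<close>
        proof (rule integral_dominated_convergence[where w = "\<lambda>_. 1 + (B\<^sup>2 + 1)\<^sup>2"])
          show "AE z in \<mu>. (\<lambda>n. ((\<phi> z)\<^sup>2 + e n) * ln ((\<phi> z)\<^sup>2 + e n)) \<longlonglongrightarrow> (\<phi> z)\<^sup>2 * ln ((\<phi> z)\<^sup>2)"
            unfolding e_def by (intro AE_I2 xlnx_tendsto) simp
          show "AE z in \<mu>. norm (((\<phi> z)\<^sup>2 + e n) * ln ((\<phi> z)\<^sup>2 + e n)) \<le> 1 + (B\<^sup>2 + 1)\<^sup>2" for n
          proof (rule AE_I2)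
            fix z
            have "norm (((\<phi> z)\<^sup>2 + e n) * ln ((\<phi> z)\<^sup>2 + e n)) \<le> 1 + ((\<phi> z)\<^sup>2 + e n)\<^sup>2"
              unfolding real_norm_def by (rule abs_xlnx_le) (intro add_nonneg_pos e, simp)
            also have "((\<phi> z)\<^sup>2 + e n)\<^sup>2 \<le> (B\<^sup>2 + 1)\<^sup>2"
              using B2[of z] e[of n] by (intro power_mono) (auto intro: add_nonneg_nonneg)
            finally show "norm (((\<phi> z)\<^sup>2 + e n) * ln ((\<phi> z)\<^sup>2 + e n)) \<le> 1 + (B\<^sup>2 + 1)\<^sup>2" by simp
          qed
        qed auto
      qed
    qed (use le in auto)
    then show ?thesis by (simp add: E_def)
  qed
  then show ?thesis unfolding log_sobolev_def bdd_lipschitz_def using ps st by auto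
qed

section \<open>Herbst's argument: Laplace transforms of Lipschitz functions\<close>

lemma exp_minus_one_minus_le: "\<bar>exp x - 1 - x\<bar> \<le> x\<^sup>2 * exp \<bar>x\<bar>" for x :: real
proof -
  have le: "exp y - 1 \<le> y * exp y" for y :: real
  proof -
    have "exp y * (1 + (- y)) \<le> exp y * exp (- y)" by (intro mult_left_mono exp_ge_add_one_self) simp
    then show ?thesis by (simp add: exp_minus algebra_simps)
  qed
  have ge: "y \<le> exp y - 1" for y :: real using exp_ge_add_one_self[of y] by linarith
  have "\<bar>exp x - 1\<bar> \<le> \<bar>x\<bar> * exp \<bar>x\<bar>"
  proof (cases "0 \<le> x")
    case False
    then have "1 - exp x \<le> - x" using ge[of x] by simp
    also have "\<dots> \<le> - x * exp (- x)" using False mult_left_mono[of 1 "exp (-x)" "-x"] by simp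
    finally show ?thesis using False by (simp add: abs_if)
  qed (use le[of x] in simp)
  then have "\<bar>x\<bar> * \<bar>exp x - 1\<bar> \<le> \<bar>x\<bar> * (\<bar>x\<bar> * exp \<bar>x\<bar>)" by (rule mult_left_mono) simp
  moreover have "exp x - 1 - x \<le> \<bar>x\<bar> * \<bar>exp x - 1\<bar>"
  proof -
    have "x * exp x - x \<le> \<bar>x * (exp x - 1)\<bar>" by (simp add: algebra_simps)
    then show ?thesis using le[of x] by (simp add: abs_mult)
  qed
  ultimately show ?thesis using ge[of x] by (simp add: power2_eq_square abs_if split: if_splits)
qed

lemma laplace_transform_derivative:
  fixes f :: "'a \<Rightarrow> real"
  assumes "prob_space \<mu>" and [measurable]: "f \<in> borel_measurable \<mu>" and B: "\<And>x. \<bar>f x\<bar> \<le> B"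
  shows "((\<lambda>l. \<integral>z. exp (l * f z) \<partial>\<mu>) has_real_derivative (\<integral>z. f z * exp (l * f z) \<partial>\<mu>)) (at l)"
proof -
  interpret prob_space \<mu> by fact
  have B0: "0 \<le> B" using B[of undefined] by linarith
  let ?H = "\<lambda>l. \<integral>z. exp (l * f z) \<partial>\<mu>"
  have le: "l * f z \<le> \<bar>l\<bar> * B" for l z
    using mult_mono[OF order_refl B, of "\<bar>l\<bar>" z] abs_ge_self[of "l * f z"] by (simp add: abs_mult)
  have i: "integrable \<mu> (\<lambda>z. exp (l * f z))" for l
    by (rule integrable_const_bound[of _ "exp (\<bar>l\<bar> * B)"]) (use le in auto)
  have i': "integrable \<mu> (\<lambda>z. f z * exp (l * f z))" for l
  proof (rule integrable_const_bound[of _ "B * exp (\<bar>l\<bar> * B)"])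
    have "norm (f z * exp (l * f z)) \<le> B * exp (\<bar>l\<bar> * B)" for z
      unfolding real_norm_def abs_mult abs_exp_cancel by (intro mult_mono B B0) (simp_all add: le)
    then show "AE z in \<mu>. norm (f z * exp (l * f z)) \<le> B * exp (\<bar>l\<bar> * B)" by simp
  qed measurable
  let ?D = "\<integral>z. f z * exp (l * f z) \<partial>\<mu>"
  define M where "M = B\<^sup>2 * exp B * exp (\<bar>l\<bar> * B)"
  have M: "M \<ge> 0" by (simp add: M_def)
  have bd: "\<bar>?H (l + h) - ?H l - h * ?D\<bar> \<le> M * h\<^sup>2" if h: "\<bar>h\<bar> \<le> 1" for h
  proof -
    have "?H (l + h) - ?H l - h * ?D = (\<integral>z. exp ((l + h) * f z) - exp (l * f z) - h * (f z * exp (l * f z)) \<partial>\<mu>)"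
      using i i' by simp
    also have "\<bar>\<dots>\<bar> \<le> (\<integral>z. M * h\<^sup>2 \<partial>\<mu>)"
    proof (rule integral_abs_bound[THEN order_trans], rule integral_mono)
      show "integrable \<mu> (\<lambda>z. \<bar>exp ((l + h) * f z) - exp (l * f z) - h * (f z * exp (l * f z))\<bar>)"
        using i i' by (intro integrable_abs Bochner_Integration.integrable_diff integrable_mult_right)
      show "\<bar>exp ((l + h) * f z) - exp (l * f z) - h * (f z * exp (l * f z))\<bar> \<le> M * h\<^sup>2" for z
      proof -
        have "exp ((l + h) * f z) - exp (l * f z) - h * (f z * exp (l * f z))
           = exp (l * f z) * (exp (h * f z) - 1 - h * f z)"
          by (simp add: exp_add algebra_simps)
        then have "\<bar>exp ((l + h) * f z) - exp (l * f z) - h * (f z * exp (l * f z))\<bar>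
           = exp (l * f z) * \<bar>exp (h * f z) - 1 - h * f z\<bar>" by (simp add: abs_mult)
        also have "\<dots> \<le> exp (\<bar>l\<bar> * B) * ((B\<^sup>2 * h\<^sup>2) * exp B)"
        proof (intro mult_mono)
          have "\<bar>exp (h * f z) - 1 - h * f z\<bar> \<le> (h * f z)\<^sup>2 * exp \<bar>h * f z\<bar>" by (rule exp_minus_one_minus_le)
          also have "\<dots> \<le> (B\<^sup>2 * h\<^sup>2) * exp B"
          proof (intro mult_mono)
            have "(f z)\<^sup>2 \<le> B\<^sup>2" using B[of z] by (simp add: abs_le_square_iff[symmetric])
            then show "(h * f z)\<^sup>2 \<le> B\<^sup>2 * h\<^sup>2" by (simp add: power_mult_distrib mult.commute[of "h\<^sup>2"] mult_right_mono)
            have "\<bar>h\<bar> * \<bar>f z\<bar> \<le> 1 * B" by (rule mult_mono) (use h B in auto)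
            then show "exp \<bar>h * f z\<bar> \<le> exp B" by (simp add: abs_mult)
          qed auto
          finally show "\<bar>exp (h * f z) - 1 - h * f z\<bar> \<le> (B\<^sup>2 * h\<^sup>2) * exp B" .
        qed (use le in auto)
        finally show ?thesis by (simp add: M_def mult_ac)
      qed
    qed simp
    finally show ?thesis using prob_space by simp
  qed
  show ?thesis unfolding DERIV_def
  proof (rule LIM_I)
    fix r :: real assume r: "r > 0"
    show "\<exists>s>0. \<forall>h. h \<noteq> 0 \<and> norm (h - 0) < s \<longrightarrow> norm ((?H (l + h) - ?H l) / h - ?D) < r"
    proof (intro exI[of _ "min 1 (r / (M + 1))"] conjI allI impI)
      show "0 < min 1 (r / (M + 1))" using r M by simp
      fix h :: real assume h: "h \<noteq> 0 \<and> norm (h - 0) < min 1 (r / (M + 1))"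
      have "(?H (l + h) - ?H l) / h - ?D = (?H (l + h) - ?H l - h * ?D) / h"
        using h by (simp add: field_simps)
      then have "norm ((?H (l + h) - ?H l) / h - ?D) \<le> M * h\<^sup>2 / \<bar>h\<bar>"
        using bd[of h] h by (simp add: abs_divide divide_right_mono)
      also have "\<dots> = M * \<bar>h\<bar>" using h by (simp add: power2_eq_square field_simps abs_if)
      also have "\<dots> \<le> M * (r / (M + 1))" using h M by (intro mult_left_mono) auto
      also have "\<dots> < r" using r M by (simp add: field_simps)
      finally show "norm ((?H (l + h) - ?H l) / h - ?D) < r" .
    qed
  qed
qed

text \<open>For \<open>exp (l / 2 * f)\<close> the log-Sobolev inequality reads
  \<open>l * H' l - H l * ln (H l) \<le> c * l^2 * H l\<close> with \<open>c = C * K^2 / 4\<close>,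
  which says that \<open>ln (H l) / l\<close> has derivative at most \<open>c\<close>. As
  \<open>l\<close> tends to 0 this quotient tends to the mean of \<open>f\<close>, so its value at 1
  is at most the mean plus \<open>c\<close>.\<close>

lemma log_sobolev_exp_bounded:
  fixes \<mu> :: "'a::euclidean_space measure"
  assumes ls: "log_sobolev \<mu> C" and C: "C \<ge> 0" and f: "bdd_lipschitz f" and K: "K-lipschitz_on UNIV f"
  shows "(\<integral>z. exp (f z) \<partial>\<mu>) \<le> exp ((\<integral>z. f z \<partial>\<mu>) + C * K\<^sup>2 / 4)"
proof -
  from ls have ps: "prob_space \<mu>" and st [measurable_cong]: "sets \<mu> = sets borel"
    by (auto simp: log_sobolev_def)
  interpret prob_space \<mu> by fact
  note [measurable] = bdd_lipschitz_measurable[OF f]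
  obtain B where B: "\<And>x. \<bar>f x\<bar> \<le> B" using bdd_lipschitzE[OF f] by metis
  define H where "H l = (\<integral>z. exp (l * f z) \<partial>\<mu>)" for l
  define H' where "H' l = (\<integral>z. f z * exp (l * f z) \<partial>\<mu>)" for l
  have dH: "(H has_real_derivative H' l) (at l)" for l
    unfolding H_def[abs_def] H'_def by (rule laplace_transform_derivative[OF ps _ B]) measurable
  have i: "integrable \<mu> (\<lambda>z. exp (l * f z))" for l
    by (rule bdd_lipschitz_integrable[OF ps st f, of "\<lambda>x. exp (l * x)"]) (intro continuous_intros)
  have Hpos: "H l > 0" for l unfolding H_def by (rule expectation_pos[OF i]) simp
  define c where "c = C * K\<^sup>2 / 4"
  have ent: "l * H' l - H l * ln (H l) \<le> c * l\<^sup>2 * H l" if l: "0 < l" for l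
  proof -
    let ?\<phi> = "\<lambda>z. exp (l / 2 * f z)"
    have d: "((\<lambda>s. exp (l / 2 * s)) has_real_derivative l / 2 * exp (l / 2 * s)) (at s)" for s
      by (auto intro!: derivative_eq_intros)
    have \<phi>: "bdd_lipschitz ?\<phi>"
    proof (rule bdd_lipschitz_comp_deriv[OF f B d])
      show "\<bar>l / 2 * exp (l / 2 * s)\<bar> \<le> l / 2 * exp (l / 2 * B)" if "\<bar>s\<bar> \<le> B" for s
        using that l by (simp add: abs_mult mult_left_mono)
    qed
    from \<phi> obtain K' where K': "K'-lipschitz_on UNIV ?\<phi>" unfolding bdd_lipschitz_def by auto
    have sq: "(?\<phi> z)\<^sup>2 = exp (l * f z)" for z by (simp add: exp_double[symmetric])
    have sl: "(slope ?\<phi> z)\<^sup>2 \<le> (l\<^sup>2 * K\<^sup>2 / 4) * exp (l * f z)" for z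
    proof -
      have "slope ?\<phi> z \<le> \<bar>l / 2 * exp (l / 2 * f z)\<bar> * slope f z"
        by (rule slope_chain[OF K K' d])
      also have "\<dots> \<le> \<bar>l / 2 * exp (l / 2 * f z)\<bar> * K"
        by (rule mult_left_mono[OF slope_le[OF K]]) simp
      finally have "(slope ?\<phi> z)\<^sup>2 \<le> (\<bar>l / 2 * exp (l / 2 * f z)\<bar> * K)\<^sup>2"
        using slope_nonneg[OF K'] by (rule power_mono)
      also have "\<dots> = (l\<^sup>2 * K\<^sup>2 / 4) * exp (l * f z)"
        unfolding sq[symmetric] by (simp add: power_mult_distrib power_divide)
      finally show ?thesis .
    qed
    have [measurable]: "slope ?\<phi> \<in> borel_measurable borel" by (rule slope_measurable[OF K'])
    have "(\<integral>z. (?\<phi> z)\<^sup>2 * ln ((?\<phi> z)\<^sup>2) \<partial>\<mu>) - (\<integral>z. (?\<phi> z)\<^sup>2 \<partial>\<mu>) * ln (\<integral>z. (?\<phi> z)\<^sup>2 \<partial>\<mu>)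
      \<le> C * (\<integral>z. (slope ?\<phi> z)\<^sup>2 \<partial>\<mu>)"
      using ls \<phi> unfolding log_sobolev_def bdd_lipschitz_def by blast
    also have "\<dots> \<le> C * (\<integral>z. (l\<^sup>2 * K\<^sup>2 / 4) * exp (l * f z) \<partial>\<mu>)"
      by (intro mult_left_mono integral_mono' integrable_mult_right i C sl) simp
    also have "\<dots> = c * l\<^sup>2 * H l" by (simp add: H_def c_def)
    also have "(\<integral>z. (?\<phi> z)\<^sup>2 * ln ((?\<phi> z)\<^sup>2) \<partial>\<mu>) = l * H' l"
      unfolding sq ln_exp H'_def by (subst integral_mult_right_zero[symmetric]) (simp add: mult_ac)
    finally show ?thesis by (simp only: sq H_def)
  qed
  define \<psi> where "\<psi> l = ln (H l) / l - c * l" for l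
  have mono: "\<psi> 1 \<le> \<psi> e" if e: "0 < e" "e \<le> 1" for e
  proof (rule DERIV_nonpos_imp_nonincreasing[OF e(2)])
    fix l assume l: "e \<le> l" "l \<le> 1"
    then have l0: "0 < l" using e by simp
    have "(\<psi> has_real_derivative (H' l / H l * l - ln (H l)) / l\<^sup>2 - c) (at l)"
      unfolding \<psi>_def[abs_def] using l0 Hpos[of l]
      by (auto intro!: derivative_eq_intros dH simp: power2_eq_square)
    moreover have "(H' l / H l * l - ln (H l)) / l\<^sup>2 - c \<le> 0"
      using ent[OF l0] l0 Hpos[of l] by (simp add: field_simps)
    ultimately show "\<exists>y. (\<psi> has_real_derivative y) (at l) \<and> y \<le> 0" by blast
  qed
  have H0: "H 0 = 1" "H' 0 = (\<integral>z. f z \<partial>\<mu>)" using prob_space by (simp_all add: H_def H'_def)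
  have "(\<lambda>n. (H (inverse (real (Suc n))) - 1) / inverse (real (Suc n))) \<longlonglongrightarrow> H' 0"
  proof -
    have "((\<lambda>h. (H (0 + h) - H 0) / h) \<longlongrightarrow> H' 0) (at 0)" using dH[of 0] by (simp only: DERIV_def)
    then have "((\<lambda>h. (H h - 1) / h) \<longlongrightarrow> H' 0) (at 0)" by (simp add: H0)
    then show ?thesis
      by (rule filterlim_compose)
        (auto simp: filterlim_at intro!: LIMSEQ_inverse_real_of_nat[simplified])
  qed
  \<comment> \<open>Near 0 only an upper bound of \<open>\<psi>\<close> is required:
    \<open>ln y \<le> y - 1\<close> compares it with the difference quotient of \<open>H\<close>,
    whose limit is the mean of \<open>f\<close>.\<close>
  then have "\<psi> 1 \<le> H' 0"
  proof (rule LIMSEQ_le_const)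
    have "\<psi> 1 \<le> (H (inverse (real (Suc n))) - 1) / inverse (real (Suc n))" for n
    proof -
      let ?e = "inverse (real (Suc n))"
      have e: "0 < ?e" "?e \<le> 1" by (auto simp: field_simps)
      have "\<psi> 1 \<le> \<psi> ?e" by (rule mono[OF e])
      also have "\<dots> \<le> ln (H ?e) / ?e" using C e by (simp add: \<psi>_def c_def)
      also have "\<dots> \<le> (H ?e - 1) / ?e" using ln_le_minus_one[OF Hpos, of ?e] e by (intro divide_right_mono) auto
      finally show ?thesis .
    qed
    then show "\<exists>N. \<forall>n\<ge>N. \<psi> 1 \<le> (H (inverse (real (Suc n))) - 1) / inverse (real (Suc n))" by blast
  qed
  then have "ln (H 1) \<le> (\<integral>z. f z \<partial>\<mu>) + c" by (simp add: \<psi>_def H0)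
  then have "H 1 \<le> exp ((\<integral>z. f z \<partial>\<mu>) + c)" using Hpos[of 1] by (metis exp_le_cancel_iff exp_ln)
  then show ?thesis by (simp add: H_def c_def)
qed

text \<open>Truncation at \<open>- n\<close> and \<open>n\<close> keeps the Lipschitz constant, and
  Fatou's lemma removes it. The nonnegative integral makes the finiteness of the exponential moment
  part of the conclusion.\<close>

lemma log_sobolev_exp_moment:
  fixes \<mu> :: "'a::euclidean_space measure"
  assumes ls: "log_sobolev \<mu> C" and C: "C \<ge> 0" and K: "K-lipschitz_on UNIV f" and int: "integrable \<mu> f"
  shows "(\<integral>\<^sup>+z. ennreal (exp (f z)) \<partial>\<mu>) \<le> ennreal (exp ((\<integral>z. f z \<partial>\<mu>) + C * K\<^sup>2 / 4))"
proof -
  from ls have ps: "prob_space \<mu>" and st [measurable_cong]: "sets \<mu> = sets borel"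
    by (auto simp: log_sobolev_def)
  interpret prob_space \<mu> by fact
  define g where "g n z = max (- real n) (min (real n) (f z))" for n z
  have gK: "K-lipschitz_on UNIV (g n)" for n
  proof (rule lipschitz_on_realI[OF lipschitz_on_nonneg[OF K]])
    show "g n x - g n y \<le> K * norm (x - y)" for x y
      using lipschitz_on_abs_diff[OF K, of x y] by (simp add: g_def max_def min_def abs_le_iff)
  qed
  have gb: "\<bar>g n z\<bar> \<le> real n" for n z by (auto simp: g_def max_def min_def)
  have g: "bdd_lipschitz (g n)" for n
    unfolding bdd_lipschitz_def using gK gb by (auto intro!: boundedI[of _ "real n"])
  have lim: "(\<lambda>n. g n z) \<longlonglongrightarrow> f z" for z
  proof (rule tendsto_eventually)
    obtain N where "\<bar>f z\<bar> \<le> real N" using real_arch_simple by blast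
    then show "\<forall>\<^sub>F n in sequentially. g n z = f z"
      by (intro eventually_sequentiallyI[of N]) (auto simp: g_def max_def min_def)
  qed
  have [measurable]: "f \<in> borel_measurable borel"
    by (rule borel_measurable_continuous_onI[OF lipschitz_on_continuous_on[OF K]])
  note gm [measurable] = bdd_lipschitz_measurable[OF g]
  have limI: "(\<lambda>n. \<integral>z. g n z \<partial>\<mu>) \<longlonglongrightarrow> (\<integral>z. f z \<partial>\<mu>)"
    by (rule integral_dominated_convergence[where w = "\<lambda>z. \<bar>f z\<bar>"])
      (use int lim in \<open>auto simp: g_def max_def min_def\<close>)
  have "(\<integral>\<^sup>+z. ennreal (exp (f z)) \<partial>\<mu>) = (\<integral>\<^sup>+z. liminf (\<lambda>n. ennreal (exp (g n z))) \<partial>\<mu>)"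
    by (intro nn_integral_cong lim_imp_Liminf[symmetric] tendsto_ennrealI tendsto_exp lim) simp
  also have "\<dots> \<le> liminf (\<lambda>n. \<integral>\<^sup>+z. ennreal (exp (g n z)) \<partial>\<mu>)"
    by (rule nn_integral_liminf) measurable
  also have "\<dots> \<le> liminf (\<lambda>n. ennreal (exp ((\<integral>z. g n z \<partial>\<mu>) + C * K\<^sup>2 / 4)))"
  proof (intro Liminf_mono always_eventually allI)
    fix n
    have "(\<integral>\<^sup>+z. ennreal (exp (g n z)) \<partial>\<mu>) = ennreal (\<integral>z. exp (g n z) \<partial>\<mu>)"
      by (intro nn_integral_eq_integral bdd_lipschitz_integrable[OF ps st g, of exp]) (auto intro: continuous_intros)
    then show "(\<integral>\<^sup>+z. ennreal (exp (g n z)) \<partial>\<mu>) \<le> ennreal (exp ((\<integral>z. g n z \<partial>\<mu>) + C * K\<^sup>2 / 4))"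
      using log_sobolev_exp_bounded[OF ls C g gK] by (simp add: ennreal_leI)
  qed
  also have "\<dots> = ennreal (exp ((\<integral>z. f z \<partial>\<mu>) + C * K\<^sup>2 / 4))"
    by (intro lim_imp_Liminf tendsto_ennrealI tendsto_exp tendsto_add limI tendsto_const) simp
  finally show ?thesis .
qed

section \<open>Contraction of the OBABO step\<close>

text \<open>Since \<open>grad\<close> is a definite description, the derivative has to be
  represented by an inner product before anything is known about it; the adjoint at 1 is the Riesz
  vector.\<close>

lemma GDERIV_grad:
  fixes f :: "'a::euclidean_space \<Rightarrow> real"
  assumes "f differentiable (at x)"
  shows "GDERIV f x :> grad f x"
proof -
  from assms obtain f' where f': "(f has_derivative f') (at x)" unfolding differentiable_def by blast
  then have "linear f'" by (rule has_derivative_linear)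
  then have "f' h = inner h (adjoint f' 1)" for h
    by (simp add: adjoint_works)
  then have "f' = (\<lambda>h. inner h (adjoint f' 1))" by (rule ext)
  then obtain D where "f' = (\<lambda>h. inner h D)" by (rule that)
  then have "GDERIV f x :> D" using f' by (simp add: gderiv_def)
  then show ?thesis using grad_eqI by force
qed

lemma GDERIV_line:
  assumes "GDERIV f (y + t *\<^sub>R d) :> D"
  shows "((\<lambda>t. f (y + t *\<^sub>R d)) has_real_derivative inner d D) (at t)"
proof -
  have 1: "((\<lambda>t. y + t *\<^sub>R d) has_derivative (\<lambda>h. h *\<^sub>R d)) (at t)"
    by (auto intro!: derivative_eq_intros)
  have "((\<lambda>t. f (y + t *\<^sub>R d)) has_derivative (\<lambda>h. inner (h *\<^sub>R d) D)) (at t)"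
    using has_derivative_compose[OF 1, of f "\<lambda>h. inner h D"] assms by (simp add: gderiv_def)
  then show ?thesis by (simp add: has_field_derivative_def mult.commute[of _ "inner d D"])
qed

lemma descent_lemma:
  assumes G: "\<And>x. GDERIV f x :> G x" and L: "\<And>x y. norm (G x - G y) \<le> L * norm (x - y)"
  shows "f (y + d) \<le> f y + inner d (G y) + L / 2 * (norm d)\<^sup>2"
proof -
  define k where "k t = f (y + t *\<^sub>R d) - t * inner d (G y) - L * t\<^sup>2 / 2 * (norm d)\<^sup>2" for t
  have "k 1 \<le> k 0"
  proof (rule DERIV_nonpos_imp_nonincreasing[of 0 1 k])
    fix t :: real assume t: "0 \<le> t" "t \<le> 1"
    have "(k has_real_derivative inner d (G (y + t *\<^sub>R d)) - inner d (G y) - L * t * (norm d)\<^sup>2) (at t)"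
      unfolding k_def[abs_def]
      by (rule derivative_eq_intros GDERIV_line[OF G] refl | simp)+
    moreover have "inner d (G (y + t *\<^sub>R d)) - inner d (G y) - L * t * (norm d)\<^sup>2 \<le> 0"
    proof -
      have "inner d (G (y + t *\<^sub>R d) - G y) \<le> norm d * norm (G (y + t *\<^sub>R d) - G y)"
        by (rule norm_cauchy_schwarz)
      also have "\<dots> \<le> norm d * (L * norm (t *\<^sub>R d))"
        using L[of "y + t *\<^sub>R d" y] by (intro mult_left_mono) auto
      also have "\<dots> = L * t * (norm d)\<^sup>2" using t by (simp add: power2_eq_square)
      finally show ?thesis by (simp add: inner_diff_right)
    qed
    ultimately show "\<exists>z. (k has_real_derivative z) (at t) \<and> z \<le> 0" by blast
  qed simp
  then show ?thesis by (simp add: k_def)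
qed

lemma convex_above_tangent:
  assumes G: "\<And>x. GDERIV f x :> G x" and mono: "\<And>x y. 0 \<le> inner (x - y) (G x - G y)"
  shows "f x + inner (y - x) (G x) \<le> f y"
proof -
  define k where "k t = f (x + t *\<^sub>R (y - x)) - t * inner (y - x) (G x)" for t
  have "k 0 \<le> k 1"
  proof (rule DERIV_nonneg_imp_nondecreasing[of 0 1 k])
    fix t :: real assume t: "0 \<le> t" "t \<le> 1"
    have "(k has_real_derivative inner (y - x) (G (x + t *\<^sub>R (y - x))) - inner (y - x) (G x)) (at t)"
      unfolding k_def[abs_def]
      by (rule derivative_eq_intros GDERIV_line[OF G] refl | simp)+
    moreover have "0 \<le> inner (y - x) (G (x + t *\<^sub>R (y - x))) - inner (y - x) (G x)"
      using mono[of "x + t *\<^sub>R (y - x)" x] t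
      by (cases "t = 0") (auto simp: inner_diff_right zero_le_mult_iff simp flip: right_diff_distrib)
    ultimately show "\<exists>z. (k has_real_derivative z) (at t) \<and> 0 \<le> z" by blast
  qed simp
  then show ?thesis by (simp add: k_def)
qed

text \<open>Baillon--Haddad: minimise the tilted function \<open>z \<mapsto> f z - inner z (G x)\<close>, whose minimum is at
  \<open>x\<close>, by one gradient step from \<open>y\<close>.\<close>

lemma cocoercive:
  assumes G: "\<And>x. GDERIV f x :> G x" and L: "\<And>x y. norm (G x - G y) \<le> L * norm (x - y)" "L > 0"
    and mono: "\<And>x y. 0 \<le> inner (x - y) (G x - G y)"
  shows "(norm (G x - G y))\<^sup>2 \<le> L * inner (x - y) (G x - G y)"
proof -
  have half: "f x - inner x (G x) \<le> f y - inner y (G x) - (norm (G y - G x))\<^sup>2 / (2 * L)" for x y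
  proof -
    define d where "d = - (1 / L) *\<^sub>R (G y - G x)"
    have "f x + inner (y + d - x) (G x) \<le> f (y + d)" by (rule convex_above_tangent[OF G mono])
    also have "\<dots> \<le> f y + inner d (G y) + L / 2 * (norm d)\<^sup>2" by (rule descent_lemma[OF G L(1)])
    finally have "f x - inner x (G x) \<le> f y - inner y (G x) + inner d (G y - G x) + L / 2 * (norm d)\<^sup>2"
      by (simp add: inner_diff_left inner_diff_right inner_add_left)
    moreover have "inner d (G y - G x) = - ((norm (G y - G x))\<^sup>2 / L)"
      by (simp add: d_def power2_norm_eq_inner)
    moreover have "(norm d)\<^sup>2 = (norm (G y - G x))\<^sup>2 / L\<^sup>2"
      using L(2) by (simp add: d_def power_mult_distrib power_divide)
    then have "L / 2 * (norm d)\<^sup>2 = (norm (G y - G x))\<^sup>2 / (2 * L)"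
      using L(2) by (simp add: power2_eq_square)
    moreover have "(norm (G y - G x))\<^sup>2 / L = 2 * ((norm (G y - G x))\<^sup>2 / (2 * L))" by simp
    ultimately show ?thesis by linarith
  qed
  have "(norm (G x - G y))\<^sup>2 / (2 * L) + (norm (G x - G y))\<^sup>2 / (2 * L) \<le> inner (x - y) (G x - G y)"
    using half[of x y] half[of y x] by (simp add: inner_diff_left inner_diff_right norm_minus_commute)
  then show ?thesis using L(2) by (simp add: field_simps)
qed

text \<open>The second order is needed for the contraction estimate, where the terms of first order
  in the cross coefficient cancel.\<close>

lemma exp_neg_le: "0 \<le> x \<Longrightarrow> exp (- x) \<le> 1 - x + x\<^sup>2 / 2" for x :: real
proof -
  assume x: "0 \<le> x"
  define k where "k x = 1 - x + x\<^sup>2 / 2 - exp (- x)" for x :: real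
  have "k 0 \<le> k x"
  proof (rule DERIV_nonneg_imp_nondecreasing[OF x])
    fix t :: real
    have "(k has_real_derivative (- 1 + t + exp (- t))) (at t)"
      unfolding k_def[abs_def] by (auto intro!: derivative_eq_intros)
    moreover have "0 \<le> - 1 + t + exp (- t)" using exp_ge_add_one_self[of "- t"] by linarith
    ultimately show "\<exists>y. (k has_real_derivative y) (at t) \<and> 0 \<le> y" by blast
  qed
  then show ?thesis by (simp add: k_def)
qed

text \<open>The case \<open>L = 1\<close>, to which the general case reduces by rescaling time and velocity. Since the shared noise
  moves the two positions, \<open>g0\<close> and \<open>g1\<close> are gradient differences at unrelated points: neither is a perturbation
  of the other, and only cocoercivity constrains them. In the cross term the contributions of orders
  \<open>\<delta>\<close> and \<open>\<delta>\<^sup>2\<close> cancel.\<close>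

lemma contraction_scaled:
  fixes X V g0 g1 :: "'a::real_inner"
  assumes \<gamma>: "\<gamma> \<ge> 2" and \<delta>: "0 < \<delta>" "\<delta> \<le> m / (33 * \<gamma> ^ 3)" and m: "0 < m" "m \<le> 1"
    and e: "e = exp (- \<delta> * \<gamma> / 2)"
    and y: "y = X + (\<delta> * e) *\<^sub>R V - (\<delta>\<^sup>2 / 2) *\<^sub>R g0"
    and w: "w = e\<^sup>2 *\<^sub>R V - (\<delta> * e / 2) *\<^sub>R (g0 + g1)"
    and g0: "m * (norm X)\<^sup>2 \<le> inner X g0" "(norm g0)\<^sup>2 \<le> inner X g0"
    and g1: "m * (norm y)\<^sup>2 \<le> inner y g1" "(norm g1)\<^sup>2 \<le> inner y g1"
  shows "(norm y)\<^sup>2 + 2 / \<gamma> * inner y w + (norm w)\<^sup>2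
    \<le> (1 - m * \<delta> / (2 * \<gamma>)) * ((norm X)\<^sup>2 + 2 / \<gamma> * inner X V + (norm V)\<^sup>2)"
proof -
  define \<beta> where "\<beta> = 1 / \<gamma>"
  define x where "x = \<delta> * \<gamma>"
  define k where "k = m * \<delta> * \<beta> / 2"
  \<comment> \<open>The value at the pair (\<open>\<delta>\<close>, \<open>e\<close>) of the
    quadratic form to be contracted. In (\<open>y\<close>, \<open>w\<close>) the vector
    \<open>V\<close> appears with \<open>e\<close> times this pair and \<open>g0\<close> with
    \<open>- \<delta> / 2\<close> times it, so \<open>A\<close> occurs in the coefficients of
    \<open>c\<close>, \<open>q0\<close> and \<open>n0\<close> alike.\<close>
  define A where "A = \<delta>\<^sup>2 + 2 * \<beta> * \<delta> * e + e\<^sup>2"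
  define a b c where "a = (norm X)\<^sup>2" and "b = inner X V" and "c = (norm V)\<^sup>2"
  define p0 q0 n0 where "p0 = inner X g0" and "q0 = inner V g0" and "n0 = (norm g0)\<^sup>2"
  define s1 q1 n1 r where "s1 = inner y g1" and "q1 = inner V g1" and "n1 = (norm g1)\<^sup>2" and "r = inner g0 g1"
  have \<beta>: "0 < \<beta>" "\<beta> \<le> 1 / 2" "\<beta> * \<gamma> = 1" using \<gamma> by (auto simp: \<beta>_def field_simps)
  have \<delta>\<gamma>3: "33 * (\<delta> * \<gamma> ^ 3) \<le> m" using \<delta> \<gamma> by (simp add: field_simps)
  have x0: "0 < x" using \<delta> \<gamma> by (simp add: x_def)
  have g2: "4 \<le> \<gamma>\<^sup>2" using power_mono[OF \<gamma>, of 2] by simp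
  have xm: "33 * (x * \<gamma>\<^sup>2) \<le> m" using \<delta>\<gamma>3 by (simp add: x_def power2_eq_square power3_eq_cube mult_ac)
  have x1: "132 * x \<le> m" using xm mult_left_mono[OF g2, of x] x0 by linarith
  then have x2: "x \<le> 1 / 132" using m by linarith
  have xx: "x\<^sup>2 \<le> x / 132" using mult_left_mono[OF x2, of x] x0 by (simp add: power2_eq_square)
  have \<delta>x: "\<delta> = x * \<beta>" using \<beta> by (simp add: x_def mult.assoc mult.commute)
  have b2: "\<beta>\<^sup>2 \<le> 1 / 4" using power_mono[OF \<beta>(2), of 2] \<beta> by (simp add: power2_eq_square)
  have \<beta>\<delta>: "0 \<le> \<beta> * \<delta>" "\<beta> * \<delta> \<le> x / 4"
    using mult_left_mono[OF b2, of x] x0 \<beta> \<delta> by (auto simp: \<delta>x power2_eq_square mult_ac)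
  have \<delta>2: "\<delta>\<^sup>2 = x * (\<beta> * \<delta>)" by (simp add: \<delta>x power2_eq_square)
  have \<delta>2': "0 \<le> \<delta>\<^sup>2" "\<delta>\<^sup>2 \<le> x\<^sup>2 / 4"
  proof -
    have "x * (\<beta> * \<delta>) \<le> x * (x / 4)" using x0 by (intro mult_left_mono \<beta>\<delta>) auto
    then show "\<delta>\<^sup>2 \<le> x\<^sup>2 / 4" unfolding \<delta>2 power2_eq_square[of x] by simp
  qed simp
  have k0: "0 \<le> k" "k \<le> x / 8"
    using mult_right_mono[OF m(2) \<beta>\<delta>(1)] mult_nonneg_nonneg[OF less_imp_le[OF m(1)] \<beta>\<delta>(1)] \<beta>\<delta> m by (auto simp: k_def mult_ac)
  have ee: "e = exp (- (x / 2))" by (simp add: e x_def)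
  have e0: "0 < e" "e \<le> 1" using x0 by (auto simp: ee)
  have e1: "1 - x / 2 \<le> e" "e \<le> 1 - x / 2 + x\<^sup>2 / 8"
    using exp_ge_add_one_self[of "- (x/2)"] exp_neg_le[of "x/2"] x0 by (auto simp: ee power2_eq_square)
  have e2: "e\<^sup>2 = exp (- x)" by (simp add: ee exp_double[symmetric])
  have e21: "1 - x \<le> e\<^sup>2" "e\<^sup>2 \<le> 1 - x + x\<^sup>2 / 2"
    using exp_ge_add_one_self[of "- x"] exp_neg_le[of x] x0 by (auto simp: e2)
  have e4: "(e\<^sup>2)\<^sup>2 \<le> 1 - 2 * x + 2 * x\<^sup>2"
  proof -
    have "(e\<^sup>2)\<^sup>2 = exp (- (2 * x))" by (simp add: e2 exp_double[symmetric])
    then show ?thesis using exp_neg_le[of "2 * x"] x0 by (simp add: power_mult_distrib)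
  qed
  have e20: "0 \<le> e\<^sup>2" "e\<^sup>2 \<le> 1" using e0 by (auto simp: power_le_one)
  have A_le: "A \<le> 1" "0 \<le> A"
  proof -
    have "\<beta> * \<delta> * e \<le> x / 4" using mult_mono[OF \<beta>\<delta>(2) e0(2)] \<beta>\<delta> e0 x0 by simp
    then show "A \<le> 1" unfolding A_def using \<delta>2' e21 xx x0 by (simp add: mult.assoc)
    show "0 \<le> A" unfolding A_def using \<beta> \<delta> e0 by simp
  qed
  have Ae2: "A * e\<^sup>2 \<le> 1 - 3 / 2 * x + 9 / 4 * x\<^sup>2"
  proof -
    have "A * e\<^sup>2 = \<delta>\<^sup>2 * e\<^sup>2 + 2 * (\<beta> * \<delta>) * (e * e\<^sup>2) + (e\<^sup>2)\<^sup>2"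
      by (simp add: A_def algebra_simps power2_eq_square)
    moreover have "\<delta>\<^sup>2 * e\<^sup>2 \<le> x\<^sup>2 / 4 * 1" using \<delta>2' e20 by (intro mult_mono) auto
    moreover have "(\<beta> * \<delta>) * (e * e\<^sup>2) \<le> x / 4 * 1"
      using \<beta>\<delta> e0 e20 x0 by (intro mult_mono mult_le_one) auto
    ultimately show ?thesis using e4 by linarith
  qed
  have id: "(norm y)\<^sup>2 + 2 * \<beta> * inner y w + (norm w)\<^sup>2
    = a + 2 * ((\<delta> + \<beta> * e) * e) * b + A * e\<^sup>2 * c - \<delta> * (\<delta> + \<beta> * e) * p0 - \<delta> * e * A * q0
      + \<delta>\<^sup>2 / 4 * A * n0 - \<beta> * e * \<delta> * s1 - \<delta> * e ^ 3 * q1 + \<delta>\<^sup>2 * e\<^sup>2 / 2 * r + e\<^sup>2 * \<delta>\<^sup>2 / 4 * n1"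
    unfolding a_def b_def c_def p0_def q0_def n0_def s1_def q1_def n1_def r_def A_def y w power2_norm_eq_inner
    by (simp add: inner_add_left inner_add_right inner_diff_left inner_diff_right inner_commute
        [of V X] inner_commute[of g0 X] inner_commute[of g1 X] inner_commute[of g0 V] inner_commute[of g1 V] inner_commute[of g1 g0])
      (simp add: field_simps power2_eq_square power3_eq_cube)
  have c0: "0 \<le> c" "0 \<le> a" "0 \<le> n0" "0 \<le> n1" by (auto simp: a_def c_def n0_def n1_def)
  \<comment> \<open>The weight \<open>\<gamma>\<close> balances two budgets. The two gradient terms
    together take \<open>\<delta> * \<gamma> = x\<close> of the dissipation of about
    \<open>3 / 2 * x\<close> that \<open>A * e^2\<close> provides. They also leave
    \<open>\<beta> * \<delta> / 2 * (n0 + n1)\<close>, which by cocoercivity uses up about half of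
    \<open>\<beta> * \<delta> * e * (p0 + s1)\<close>.\<close>
  have amgm: "- inner V g \<le> \<gamma> / 2 * c + \<beta> / 2 * (norm g)\<^sup>2" for g
  proof -
    have "0 \<le> (norm (V + \<beta> *\<^sub>R g))\<^sup>2" by simp
    also have "\<dots> = c + 2 * \<beta> * inner V g + \<beta>\<^sup>2 * (norm g)\<^sup>2"
      by (simp add: c_def power2_norm_eq_inner inner_add_left inner_add_right inner_commute[of g V])
        (simp add: power2_eq_square algebra_simps)
    finally have "0 \<le> \<gamma> * (c + 2 * \<beta> * inner V g + \<beta>\<^sup>2 * (norm g)\<^sup>2)" using \<gamma> by simp
    also have "\<dots> = \<gamma> * c + 2 * (\<beta> * \<gamma>) * inner V g + (\<beta> * \<gamma>) * \<beta> * (norm g)\<^sup>2"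
      by (simp add: algebra_simps power2_eq_square)
    finally show ?thesis unfolding \<beta>(3) by simp
  qed
  have tm: "- (u * q) \<le> \<delta> * (\<gamma> / 2 * c + \<beta> / 2 * n)"
    if "0 \<le> u" "u \<le> \<delta>" "- q \<le> \<gamma> / 2 * c + \<beta> / 2 * n" "0 \<le> n" for u q n
  proof -
    have "u * (- q) \<le> u * (\<gamma> / 2 * c + \<beta> / 2 * n)" using that by (intro mult_left_mono) auto
    also have "\<dots> \<le> \<delta> * (\<gamma> / 2 * c + \<beta> / 2 * n)" using that c0 \<gamma> \<beta> by (intro mult_right_mono) auto
    finally show ?thesis by simp
  qed
  have e3: "e ^ 3 \<le> 1" using e0 by (simp add: power_le_one)
  have eA: "e * A \<le> 1" "0 \<le> e * A" using mult_mono[OF e0(2) A_le(1)] A_le e0 by auto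
  have t0: "- (\<delta> * e * A * q0) \<le> \<delta> * (\<gamma> / 2 * c + \<beta> / 2 * n0)"
    by (rule tm) (use amgm[of g0] eA \<delta> c0 mult_left_mono[OF eA(1), of \<delta>] in \<open>auto simp: q0_def n0_def mult.assoc\<close>)
  have t1: "- (\<delta> * e ^ 3 * q1) \<le> \<delta> * (\<gamma> / 2 * c + \<beta> / 2 * n1)"
    by (rule tm) (use amgm[of g1] e3 e0 \<delta> c0 mult_left_mono[OF e3, of \<delta>] in \<open>auto simp: q1_def n1_def\<close>)
  have r_le: "r \<le> (n0 + n1) / 2"
  proof -
    have "0 \<le> (norm (g0 - g1))\<^sup>2" by simp
    also have "\<dots> = n0 - 2 * r + n1"
      by (simp add: n0_def n1_def r_def power2_norm_eq_inner inner_diff_left inner_diff_right inner_commute[of g1 g0])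
    finally show ?thesis by simp
  qed
  have t2: "\<delta>\<^sup>2 / 4 * A * n0 + \<delta>\<^sup>2 * e\<^sup>2 / 2 * r + e\<^sup>2 * \<delta>\<^sup>2 / 4 * n1 \<le> \<delta>\<^sup>2 / 2 * (n0 + n1)"
  proof -
    have "\<delta>\<^sup>2 * (A * n0) \<le> \<delta>\<^sup>2 * (1 * n0)" using A_le c0 by (intro mult_left_mono mult_right_mono) auto
    moreover have "\<delta>\<^sup>2 * (e\<^sup>2 * r) \<le> \<delta>\<^sup>2 * ((n0 + n1) / 2)"
    proof (rule mult_left_mono)
      have "e\<^sup>2 * r \<le> e\<^sup>2 * ((n0 + n1) / 2)" by (rule mult_left_mono[OF r_le e20(1)])
      also have "\<dots> \<le> 1 * ((n0 + n1) / 2)" using c0 e20 by (intro mult_right_mono) auto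
      finally show "e\<^sup>2 * r \<le> (n0 + n1) / 2" by simp
    qed simp
    moreover have "\<delta>\<^sup>2 * (e\<^sup>2 * n1) \<le> \<delta>\<^sup>2 * (1 * n1)" using e20 c0 by (intro mult_left_mono mult_right_mono) auto
    ultimately show ?thesis by (simp add: field_simps)
  qed
  have p0: "m * a \<le> p0" "n0 \<le> p0" "0 \<le> p0" using g0 c0 m order_trans[OF _ g0(1), of 0] by (auto simp: a_def p0_def n0_def)
  have s1: "m * (norm y)\<^sup>2 \<le> s1" "n1 \<le> s1" "0 \<le> s1" using g1 m order_trans[OF _ g1(1), of 0] by (auto simp: s1_def n1_def)
  have "(norm y)\<^sup>2 + 2 * \<beta> * inner y w + (norm w)\<^sup>2
    \<le> a + 2 * ((\<delta> + \<beta> * e) * e) * b + A * e\<^sup>2 * c - \<delta> * (\<delta> + \<beta> * e) * p0 - \<beta> * e * \<delta> * s1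
      + \<delta> * (\<gamma> / 2 * c + \<beta> / 2 * n0) + \<delta> * (\<gamma> / 2 * c + \<beta> / 2 * n1) + \<delta>\<^sup>2 / 2 * (n0 + n1)"
    unfolding id using t0 t1 t2 by linarith
  also have "\<dots> = a + 2 * ((\<delta> + \<beta> * e) * e) * b + (A * e\<^sup>2 + x) * c - \<delta>\<^sup>2 * p0
      - \<beta> * \<delta> * e * (p0 + s1) + \<beta> * \<delta> * (1 / 2 + x / 2) * (n0 + n1)"
  proof -
    have 1: "\<delta> * (\<gamma> / 2 * c + \<beta> / 2 * n) = x / 2 * c + \<beta> * \<delta> / 2 * n" for n
      by (simp add: x_def algebra_simps)
    have 2: "\<delta> * (\<delta> + \<beta> * e) * p0 = \<delta>\<^sup>2 * p0 + \<beta> * \<delta> * e * p0"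
      by (simp add: algebra_simps power2_eq_square)
    have 3: "\<delta>\<^sup>2 / 2 * (n0 + n1) = \<beta> * \<delta> * (x / 2) * (n0 + n1)" by (simp add: \<delta>2)
    show ?thesis unfolding 1 2 3 by (simp add: field_simps)
  qed
  \<comment> \<open>\<open>49 / 100\<close> is a lower bound of \<open>e - (1 / 2 + x / 2)\<close>,
    which is at least \<open>1 / 2 - x\<close>.\<close>
  also have "\<dots> \<le> a + 2 * ((\<delta> + \<beta> * e) * e) * b + (A * e\<^sup>2 + x) * c - \<beta> * \<delta> * (49 / 100 * (p0 + s1))"
  proof -
    have "\<beta> * \<delta> * (1 / 2 + x / 2) * (n0 + n1) \<le> \<beta> * \<delta> * (1 / 2 + x / 2) * (p0 + s1)"
      using p0 s1 \<beta>\<delta> x0 by (intro mult_left_mono) auto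
    moreover have "\<beta> * \<delta> * (49 / 100 * (p0 + s1)) \<le> \<beta> * \<delta> * ((e - (1 / 2 + x / 2)) * (p0 + s1))"
      using p0 s1 \<beta>\<delta> x2 e1 by (intro mult_left_mono mult_right_mono) auto
    moreover have "0 \<le> \<delta>\<^sup>2 * p0" using p0 by simp
    ultimately show ?thesis by (simp add: algebra_simps)
  qed
  \<comment> \<open>Strong convexity bounds \<open>s1\<close> in terms of \<open>y\<close>, not of
    \<open>X\<close>. Because \<open>y\<close> differs from \<open>X\<close> only by
    \<open>d\<close>, of order \<open>\<delta>\<close>, almost all of \<open>m * a\<close> is gained
    a second time: \<open>1989 / 1000\<close> stands for nearly 2.\<close>
  also have "\<dots> \<le> a + 2 * ((\<delta> + \<beta> * e) * e) * b + (A * e\<^sup>2 + x) * c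
      - \<beta> * \<delta> * (49 / 100 * (m * (1989 / 1000 * a - 198 * \<delta>\<^sup>2 * c)))"
  proof -
    define d where "d = (\<delta> * e) *\<^sub>R V - (\<delta>\<^sup>2 / 2) *\<^sub>R g0"
    have yd: "y = X + d" by (simp add: y d_def)
    have n0a: "n0 \<le> a"
    proof -
      have "0 \<le> (norm (X - g0))\<^sup>2" by simp
      also have "\<dots> = a - 2 * p0 + n0"
        by (simp add: a_def p0_def n0_def power2_norm_eq_inner inner_diff_left inner_diff_right inner_commute[of g0 X])
      finally show ?thesis using p0 by simp
    qed
    have d2: "(norm d)\<^sup>2 \<le> 2 * \<delta>\<^sup>2 * c + 1 / 100000 * a"
    proof -
      have para: "(norm (u - v))\<^sup>2 \<le> 2 * ((norm u)\<^sup>2 + (norm v)\<^sup>2)" for u v :: 'a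
      proof -
        have "0 \<le> (norm (u + v))\<^sup>2" by simp
        then show ?thesis
          by (simp add: power2_norm_eq_inner inner_diff_left inner_diff_right inner_add_left inner_add_right inner_commute)
      qed
      have "(norm d)\<^sup>2 \<le> 2 * ((norm ((\<delta> * e) *\<^sub>R V))\<^sup>2 + (norm ((\<delta>\<^sup>2 / 2) *\<^sub>R g0))\<^sup>2)"
        unfolding d_def by (rule para)
      also have "(norm ((\<delta> * e) *\<^sub>R V))\<^sup>2 = \<delta>\<^sup>2 * (e\<^sup>2 * c)"
        by (simp add: c_def power_mult_distrib)
      also have "(norm ((\<delta>\<^sup>2 / 2) *\<^sub>R g0))\<^sup>2 = (\<delta>\<^sup>2)\<^sup>2 / 4 * n0"
        by (simp add: n0_def power_mult_distrib power_divide)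
      finally have "(norm d)\<^sup>2 \<le> 2 * (\<delta>\<^sup>2 * (e\<^sup>2 * c)) + (\<delta>\<^sup>2)\<^sup>2 / 2 * n0" by (simp add: algebra_simps)
      moreover have "\<delta>\<^sup>2 * (e\<^sup>2 * c) \<le> \<delta>\<^sup>2 * (1 * c)"
        using e20 c0 by (intro mult_left_mono mult_right_mono) auto
      moreover have "(\<delta>\<^sup>2)\<^sup>2 / 2 * n0 \<le> 1 / 100000 * a"
      proof (rule mult_mono[OF _ n0a])
        have "\<delta>\<^sup>2 \<le> 1 / 1000" using \<delta>2' xx x2 by linarith
        then have "(\<delta>\<^sup>2)\<^sup>2 \<le> (1 / 1000)\<^sup>2" by (intro power_mono) auto
        then show "(\<delta>\<^sup>2)\<^sup>2 / 2 \<le> 1 / 100000" by (simp add: power2_eq_square)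
      qed (use c0 in auto)
      ultimately show ?thesis by linarith
    qed
    \<comment> \<open>Young's inequality with a small weight: one percent of \<open>a\<close> is
      given up against a large multiple of the small square of \<open>norm d\<close>.\<close>
    have "0 \<le> (norm ((1 / 100) *\<^sub>R X + d))\<^sup>2 * 100" by simp
    also have "\<dots> = a / 100 + 2 * inner X d + 100 * (norm d)\<^sup>2"
      by (simp add: a_def power2_norm_eq_inner inner_add_left inner_add_right inner_commute[of d X])
    finally have "- (a / 100) - 100 * (norm d)\<^sup>2 \<le> 2 * inner X d" by simp
    moreover have "(norm y)\<^sup>2 = a + 2 * inner X d + (norm d)\<^sup>2"
      by (simp add: yd a_def power2_norm_eq_inner inner_add_left inner_add_right inner_commute[of d X])
    ultimately have "989 / 1000 * a - 198 * \<delta>\<^sup>2 * c \<le> (norm y)\<^sup>2" using d2 c0 by linarith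
    then have "m * (989 / 1000 * a - 198 * \<delta>\<^sup>2 * c) \<le> s1"
      using s1(1) m mult_left_mono[of _ _ m] by (smt (verit))
    then have "m * (1989 / 1000 * a - 198 * \<delta>\<^sup>2 * c) \<le> p0 + s1"
      using p0(1) by (simp add: algebra_simps)
    then have "\<beta> * \<delta> * (49 / 100 * (m * (1989 / 1000 * a - 198 * \<delta>\<^sup>2 * c))) \<le> \<beta> * \<delta> * (49 / 100 * (p0 + s1))"
      using \<beta>\<delta> by (intro mult_left_mono) auto
    then show ?thesis by linarith
  qed
  also have "\<dots> = a + 2 * \<beta> * (x * e + e\<^sup>2) * b + (A * e\<^sup>2 + x) * c - k * (194922 / 100000 * a) + k * (19404 / 100 * \<delta>\<^sup>2 * c)"
    by (simp add: k_def \<delta>x algebra_simps power2_eq_square)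
  also have "\<dots> \<le> a + 2 * \<beta> * (x * e + e\<^sup>2) * b + (1 - 48 / 100 * x) * c - k * (194922 / 100000 * a)"
  proof -
    have "k * (19404 / 100 * \<delta>\<^sup>2) \<le> x / 8 * (19404 / 100 * (1 / 10000))"
    proof (rule mult_mono[OF k0(2)])
      have "\<delta>\<^sup>2 \<le> 1 / 50000" using \<delta>2' xx x2 by linarith
      then show "19404 / 100 * \<delta>\<^sup>2 \<le> 19404 / 100 * (1 / 10000)" by simp
    qed (use x0 in auto)
    then have "A * e\<^sup>2 + x + k * (19404 / 100 * \<delta>\<^sup>2) \<le> 1 - 48 / 100 * x"
      using Ae2 xx x0 by simp
    from mult_right_mono[OF this c0(1)] show ?thesis by (simp add: algebra_simps)
  qed
  \<comment> \<open>Of the gain of about \<open>1.949 * k * a\<close>, one \<open>k * a\<close> is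
    the claimed decay and the rest pays for the cross term, which is at most
    \<open>0.6 * k * (a + c)\<close>. For \<open>c\<close> the decay \<open>0.48 * x\<close> is
    enough, because \<open>k \<le> x / 8\<close>.\<close>
  also have "\<dots> \<le> (1 - k) * (a + 2 * \<beta> * b + c)"
  proof -
    define B where "B = x * e + e\<^sup>2 - (1 - k)"
    have xe: "x * (1 - x / 2) \<le> x * e" "x * e \<le> x * (1 - x / 2 + x\<^sup>2 / 8)"
      using e1 x0 by (auto intro!: mult_left_mono)
    have x3: "x * x\<^sup>2 \<le> x\<^sup>2" using x2 x0 by (simp add: mult_le_cancel_right1)
    have "x * (1 - x / 2 + x\<^sup>2 / 8) = x - x\<^sup>2 / 2 + x * x\<^sup>2 / 8" "x * (1 - x / 2) = x - x\<^sup>2 / 2"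
      by (simp_all add: algebra_simps power2_eq_square)
    moreover have "p + q - 1 \<le> s \<and> - s \<le> p + q - 1"
      if "p \<le> x - s / 2 + t / 8" "x - s / 2 \<le> p" "q \<le> 1 - x + s / 2" "1 - x \<le> q" "t \<le> s" "0 \<le> s" for p q s t :: real
      using that by linarith
    ultimately have "x * e + e\<^sup>2 - 1 \<le> x\<^sup>2 \<and> - x\<^sup>2 \<le> x * e + e\<^sup>2 - 1"
      using xe e21 x3 by (metis zero_le_power2)
    then have B: "\<bar>B\<bar> \<le> k + x\<^sup>2" using k0 unfolding B_def by linarith
    have "2 * \<bar>b\<bar> \<le> a + c"
    proof -
      have "\<bar>b\<bar> \<le> norm X * norm V" unfolding b_def by (rule Cauchy_Schwarz_ineq2)
      moreover have "0 \<le> (norm X - norm V)\<^sup>2" by simp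
      ultimately show ?thesis by (simp add: a_def c_def power2_diff)
    qed
    then have "\<bar>B\<bar> * (2 * \<bar>b\<bar>) \<le> (k + x\<^sup>2) * (a + c)" using B by (intro mult_mono) auto
    then have "\<beta> * (\<bar>B\<bar> * (2 * \<bar>b\<bar>)) \<le> \<beta> * ((k + x\<^sup>2) * (a + c))" using \<beta> by (intro mult_left_mono) auto
    moreover have "2 * \<beta> * B * b \<le> \<beta> * (\<bar>B\<bar> * (2 * \<bar>b\<bar>))"
      using \<beta> abs_ge_self[of "B * b"] by (simp add: abs_mult)
    ultimately have Bb: "2 * \<beta> * B * b \<le> \<beta> * (k + x\<^sup>2) * (a + c)" by (simp add: mult.assoc)
    have \<beta>k: "\<beta> * (k + x\<^sup>2) \<le> 6 / 10 * k"
    proof -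
      have "\<beta> * k \<le> 1 / 2 * k" using \<beta> k0 by (intro mult_right_mono) auto
      \<comment> \<open>Here the step-size bound is used with its factor \<open>m\<close>: the error
        \<open>x^2\<close> left by the cancellation has to be small compared with \<open>k\<close>,
        which contains \<open>m\<close>.\<close>
      moreover have "33 * (\<beta> * x\<^sup>2) \<le> k"
      proof -
        have "33 * (x * \<gamma>\<^sup>2) * \<beta> \<le> m * \<beta>" by (rule mult_right_mono[OF xm]) (use \<beta> in simp)
        moreover have "(x * \<gamma>\<^sup>2) * \<beta> = x * \<gamma>" using \<beta>(3) by (simp add: power2_eq_square mult.assoc mult.commute)
        moreover have "2 * x \<le> x * \<gamma>" using \<gamma> x0 by simp
        ultimately have "66 * x \<le> m * \<beta>" by linarith
        then have "66 * x * (x * \<beta>) \<le> m * \<beta> * (x * \<beta>)" using x0 \<beta> by (intro mult_right_mono) auto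
        then show ?thesis by (simp add: k_def \<delta>x power2_eq_square algebra_simps)
      qed
      ultimately show ?thesis using k0 by (simp add: distrib_left)
    qed
    have "\<beta> * (k + x\<^sup>2) * (a + c) \<le> 6 / 10 * k * (a + c)" using \<beta>k c0 by (intro mult_right_mono) auto
    moreover have "k * c \<le> x / 8 * c" using k0 c0 by (intro mult_right_mono) auto
    moreover have "0 \<le> k * a" "0 \<le> x * c" using k0 c0 x0 by auto
    moreover have "2 * \<beta> * (x * e + e\<^sup>2) * b = 2 * \<beta> * B * b + 2 * \<beta> * (1 - k) * b" by (simp add: B_def algebra_simps)
    ultimately show ?thesis using Bb by (simp add: algebra_simps)
  qed
  also have "(1 - k) * (a + 2 * \<beta> * b + c) = (1 - m * \<delta> / (2 * \<gamma>)) * ((norm X)\<^sup>2 + 2 / \<gamma> * inner X V + (norm V)\<^sup>2)"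
    by (simp add: k_def a_def b_def c_def \<beta>_def)
  finally show ?thesis by (simp add: \<beta>_def)
qed

section \<open>Contractive random maps\<close>

text \<open>Closed sets generate the Borel sets, and the indicator of a nonempty closed set is the
  limit of the bounded Lipschitz functions \<open>max 0 (1 - real n * infdist z X)\<close>. The
  empty set is separate because \<open>infdist\<close> to it is 0.\<close>

lemma prob_measure_eqI_bdd_lipschitz:
  fixes \<mu> \<nu> :: "'a::euclidean_space measure"
  assumes "prob_space \<mu>" "prob_space \<nu>" and s: "sets \<mu> = sets borel" "sets \<nu> = sets borel"
    and eq: "\<And>f. bdd_lipschitz f \<Longrightarrow> (\<integral>z. f z \<partial>\<mu>) = (\<integral>z. f z \<partial>\<nu>)"
  shows "\<mu> = \<nu>"
proof (rule measure_eqI_generator_eq)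
  interpret M: prob_space \<mu> by fact
  interpret N: prob_space \<nu> by fact
  show "Int_stable (Collect closed :: 'a set set)" by (auto simp: Int_stable_def)
  show "sets \<mu> = sigma_sets UNIV (Collect closed)" "sets \<nu> = sigma_sets UNIV (Collect closed)"
    unfolding s by (simp_all add: borel_eq_closed)
  show "range (\<lambda>_::nat. UNIV) \<subseteq> Collect closed" by auto
  show "emeasure \<mu> UNIV \<noteq> \<infinity>" by simp
  have meas: "measure \<rho> X = lim (\<lambda>n. \<integral>z. max 0 (1 - real n * infdist z X) \<partial>\<rho>)"
    if \<rho>: "prob_space \<rho>" "sets \<rho> = sets borel" and X: "closed X" "X \<noteq> {}" for \<rho> and X :: "'a set"
  proof -
    interpret prob_space \<rho> by fact
    note [measurable_cong] = \<rho>(2)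
    have Xb[measurable]: "X \<in> sets borel" using X by auto
    have [measurable]: "(\<lambda>z. infdist z X) \<in> borel_measurable borel"
      by (intro borel_measurable_continuous_onI continuous_intros)
    have "(\<lambda>n. \<integral>z. max 0 (1 - real n * infdist z X) \<partial>\<rho>) \<longlonglongrightarrow> (\<integral>z. indicator X z \<partial>\<rho>)"
    proof (rule integral_dominated_convergence[where w = "\<lambda>_. 1"])
      show "AE z in \<rho>. (\<lambda>n. max 0 (1 - real n * infdist z X)) \<longlonglongrightarrow> indicator X z"
      proof (rule AE_I2, rule tendsto_eventually)
        fix z
        show "\<forall>\<^sub>F n in sequentially. max 0 (1 - real n * infdist z X) = indicator X z"
        proof (cases "z \<in> X")
          case False
          then have p: "infdist z X > 0"
            using in_closed_iff_infdist_zero[OF X] infdist_nonneg[of z X] by (metis less_eq_real_def)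
          obtain k where k: "1 < real k * infdist z X" using ex_less_of_nat_mult[OF p] by auto
          have "1 \<le> real n * infdist z X" if "n \<ge> k" for n
          proof -
            have "real k * infdist z X \<le> real n * infdist z X" by (rule mult_right_mono) (use that p in auto)
            then show ?thesis using k by linarith
          qed
          then show ?thesis using False by (intro eventually_sequentiallyI[of k]) auto
        qed (simp add: infdist_zero)
      qed
      show "AE z in \<rho>. norm (max 0 (1 - real n * infdist z X)) \<le> 1" for n
        by (intro AE_I2) (simp add: infdist_nonneg)
    qed auto
    then show ?thesis using sets_eq_imp_space_eq[OF \<rho>(2)] by (simp add: limI)
  qed
  fix X :: "'a set" assume "X \<in> Collect closed"
  then have X: "closed X" by simp
  show "emeasure \<mu> X = emeasure \<nu> X"
  proof (cases "X = {}")
    case False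
    have "bdd_lipschitz (\<lambda>z. max 0 (1 - real n * infdist z X))" for n
    proof (rule bdd_lipschitzI)
      show "\<bar>max 0 (1 - real n * infdist x X)\<bar> \<le> 1" for x by (simp add: infdist_nonneg)
      show "max 0 (1 - real n * infdist x X) - max 0 (1 - real n * infdist y X) \<le> real n * norm (x - y)" for x y
      proof -
        have "infdist y X \<le> infdist x X + norm (x - y)"
          using infdist_triangle[of y X x] by (simp add: dist_norm norm_minus_commute)
        then have "real n * infdist y X \<le> real n * (infdist x X + norm (x - y))" by (rule mult_left_mono) simp
        moreover have "0 \<le> real n * norm (x - y)" by simp
        moreover have "max 0 (1 - p) - max 0 (1 - q) \<le> s" if "q \<le> p + s" "0 \<le> s" for p q s :: real
          using that by (auto simp: max_def)
        ultimately show ?thesis by (simp add: distrib_left)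
      qed
    qed simp
    then show ?thesis
      using meas[OF assms(1) s(1) X False] meas[OF assms(2) s(2) X False] eq
      by (simp add: M.emeasure_eq_measure N.emeasure_eq_measure)
  qed simp
qed auto

text \<open>What the general argument takes from the OBABO step: \<open>r\<close> and
  \<open>l\<close> are Lipschitz constants in the state and in the noise, both with respect to
  \<open>N\<close>, and \<open>a\<close>, \<open>b\<close> compare \<open>N\<close> with the
  Euclidean norm, in which contraction is not assumed.\<close>

locale random_map =
  fixes \<nu> :: "'c::euclidean_space measure" and F :: "'b::euclidean_space \<times> 'c \<Rightarrow> 'b"
    and N :: "'b \<Rightarrow> real" and r l a b :: real
  assumes noise: "sup_conv_ineq \<nu> (\<lambda>w. (norm w)\<^sup>2 / 2)" and noise_integrable: "integrable \<nu> norm"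
    and N_triangle: "\<And>x y. N (x + y) \<le> N x + N y"
    and N_lower: "\<And>x. a * norm x \<le> N x" and N_upper: "\<And>x. N x \<le> b * norm x"
    and a_pos: "0 < a" and l_pos: "0 < l" and r: "0 \<le> r" "r < 1"
    and contract: "\<And>z z' g. N (F (z', g) - F (z, g)) \<le> r * N (z' - z)"
    and noise_lip: "\<And>z g g'. N (F (z, g') - F (z, g)) \<le> l * norm (g' - g)"
begin

lemma prob_noise: "prob_space \<nu>" and sets_noise [measurable_cong]: "sets \<nu> = sets borel"
  using noise by (auto simp: sup_conv_ineq_def)

lemma space_noise [simp]: "space \<nu> = UNIV"
  using sets_eq_imp_space_eq[OF sets_noise] by simp

sublocale noise: prob_space \<nu> by (rule prob_noise)

lemma N_nonneg: "0 \<le> N x"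
  using N_lower[of x] a_pos by (smt (verit) mult_nonneg_nonneg norm_ge_zero)

lemma N_zero [simp]: "N 0 = 0"
  using N_upper[of 0] N_nonneg[of 0] by simp

lemma b_pos: "0 < b"
proof -
  obtain e :: 'b where e: "e \<in> Basis" using nonempty_Basis by blast
  have "a * norm e \<le> b * norm e" using N_lower[of e] N_upper[of e] by linarith
  then show ?thesis using e a_pos by simp
qed

lemma cost: "N (F (z', g') - F (z, g)) \<le> r * N (z' - z) + l * norm (g' - g)"
  using N_triangle[of "F (z', g') - F (z, g')" "F (z, g') - F (z, g)"] contract[of z' g' z] noise_lip[of z g' g]
  by simp

lemma F_lipschitz: "((r * b + l) / a)-lipschitz_on UNIV F"
proof (rule lipschitz_onI)
  show "0 \<le> (r * b + l) / a" using r b_pos l_pos a_pos by simp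
  fix p p' :: "'b \<times> 'c"
  obtain z g z' g' where p: "p = (z, g)" "p' = (z', g')" by fastforce
  have "a * norm (F p - F p') \<le> r * N (z - z') + l * norm (g - g')"
    using N_lower[of "F p - F p'"] cost[of z g z' g'] by (simp add: p)
  also have "\<dots> \<le> r * (b * norm (z - z')) + l * norm (g - g')"
    using N_upper[of "z - z'"] r l_pos by (intro add_mono mult_left_mono) auto
  also have "\<dots> \<le> r * (b * norm (p - p')) + l * norm (p - p')"
    using r b_pos l_pos norm_fst_le[of "z - z'" "g - g'"] norm_snd_le[of "g - g'" "z - z'"]
    by (intro add_mono mult_left_mono) (auto simp: p)
  finally show "dist (F p) (F p') \<le> (r * b + l) / a * dist p p'"
    using a_pos by (simp add: dist_norm field_simps)
qed

lemma F_measurable [measurable]: "F \<in> measurable (borel \<Otimes>\<^sub>M borel) borel"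
  using borel_measurable_continuous_onI[OF lipschitz_on_continuous_on[OF F_lipschitz]]
  by (simp only: borel_prod)

definition kernel :: "'b \<Rightarrow> 'b measure" where
  "kernel z = distr \<nu> borel (\<lambda>g. F (z, g))"

lemma kernel_measurable [measurable]: "kernel \<in> measurable borel (subprob_algebra borel)"
proof -
  have "\<nu> \<in> space (subprob_algebra \<nu>)"
    by (simp add: space_subprob_algebra noise.subprob_space_axioms prob_space_imp_subprob_space prob_noise)
  then show ?thesis unfolding kernel_def
    by (intro measurable_distr2[where M = \<nu>] measurable_const) (simp_all add: split_beta')
qed

lemma emeasure_distr_F:
  assumes "prob_space \<mu>" and [measurable_cong]: "sets \<mu> = sets borel" and [measurable]: "A \<in> sets borel"
  shows "emeasure (distr (\<mu> \<Otimes>\<^sub>M \<nu>) borel F) A = (\<integral>\<^sup>+z. (\<integral>\<^sup>+g. indicator A (F (z, g)) \<partial>\<nu>) \<partial>\<mu>)"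
proof -
  interpret M: prob_space \<mu> by fact
  interpret P: pair_prob_space \<mu> \<nu> ..
  have "emeasure (distr (\<mu> \<Otimes>\<^sub>M \<nu>) borel F) A = (\<integral>\<^sup>+p. indicator A p \<partial>distr (\<mu> \<Otimes>\<^sub>M \<nu>) borel F)" by simp
  also have "\<dots> = (\<integral>\<^sup>+p. indicator A (F p) \<partial>(\<mu> \<Otimes>\<^sub>M \<nu>))"
    by (rule nn_integral_distr) measurable
  also have "\<dots> = (\<integral>\<^sup>+z. (\<integral>\<^sup>+g. indicator A (F (z, g)) \<partial>\<nu>) \<partial>\<mu>)"
    by (rule noise.nn_integral_fst[symmetric]) measurable
  finally show ?thesis .
qed

text \<open>Brings invariance, which is stated with \<open>\<bind>\<close>, into the form of an
  image of a product measure, to which Fubini and \<open>sup_conv_ineq_compose\<close>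
  apply.\<close>

lemma bind_kernel:
  assumes "prob_space \<mu>" and s [measurable_cong]: "sets \<mu> = sets borel"
  shows "\<mu> \<bind> kernel = distr (\<mu> \<Otimes>\<^sub>M \<nu>) borel F"
proof (rule measure_eqI)
  interpret prob_space \<mu> by fact
  have k: "kernel \<in> measurable \<mu> (subprob_algebra borel)" by measurable
  then show sb: "sets (\<mu> \<bind> kernel) = sets (distr (\<mu> \<Otimes>\<^sub>M \<nu>) borel F)"
    using sets_bind[of \<mu> kernel borel] not_empty by (simp add: kernel_def)
  fix A assume "A \<in> sets (\<mu> \<bind> kernel)"
  then have A [measurable]: "A \<in> sets borel" using sb by simp
  have "emeasure (\<mu> \<bind> kernel) A = (\<integral>\<^sup>+z. emeasure (kernel z) A \<partial>\<mu>)"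
    by (rule emeasure_bind[OF not_empty k A])
  also have "\<dots> = (\<integral>\<^sup>+z. (\<integral>\<^sup>+g. indicator A (F (z, g)) \<partial>\<nu>) \<partial>\<mu>)"
  proof (rule nn_integral_cong)
    fix z
    have "emeasure (kernel z) A = (\<integral>\<^sup>+y. indicator A y \<partial>kernel z)" by (simp add: kernel_def)
    also have "\<dots> = (\<integral>\<^sup>+g. indicator A (F (z, g)) \<partial>\<nu>)"
      unfolding kernel_def by (rule nn_integral_distr) measurable
    finally show "emeasure (kernel z) A = (\<integral>\<^sup>+g. indicator A (F (z, g)) \<partial>\<nu>)" .
  qed
  also have "\<dots> = emeasure (distr (\<mu> \<Otimes>\<^sub>M \<nu>) borel F) A"
    by (rule emeasure_distr_F[symmetric]) fact+
  finally show "emeasure (\<mu> \<bind> kernel) A = emeasure (distr (\<mu> \<Otimes>\<^sub>M \<nu>) borel F) A" .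
qed

section \<open>The noise stream, the backward iterates and their limit law\<close>

abbreviation noises :: "'c stream measure" where "noises \<equiv> stream_space \<nu>"

sublocale noises: prob_space noises by (rule noise.prob_space_stream_space)

text \<open>The head of the stream is independent of the tail, so a state built from the tail and
  moved by the head has the law obtained by one step of the chain. For this reason the recursion can
  run along the stream.\<close>

lemma distr_step:
  assumes X [measurable]: "X \<in> measurable noises borel"
  shows "distr noises borel (\<lambda>\<omega>. F (X (stl \<omega>), shd \<omega>)) = distr (distr noises borel X \<Otimes>\<^sub>M \<nu>) borel F"
proof (rule measure_eqI)
  interpret pair_sigma_finite noises \<nu> ..
  interpret D: prob_space "distr noises borel X" by (rule noises.prob_space_distr) measurable
  fix A assume "A \<in> sets (distr noises borel (\<lambda>\<omega>. F (X (stl \<omega>), shd \<omega>)))"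
  then have A [measurable]: "A \<in> sets borel" by simp
  have "emeasure (distr noises borel (\<lambda>\<omega>. F (X (stl \<omega>), shd \<omega>))) A
      = (\<integral>\<^sup>+\<omega>. indicator A \<omega> \<partial>distr noises borel (\<lambda>\<omega>. F (X (stl \<omega>), shd \<omega>)))" by simp
  also have "\<dots> = (\<integral>\<^sup>+\<omega>. indicator A (F (X (stl \<omega>), shd \<omega>)) \<partial>noises)"
    by (rule nn_integral_distr) measurable
  also have "\<dots> = (\<integral>\<^sup>+g. (\<integral>\<^sup>+\<omega>. indicator A (F (X \<omega>, g)) \<partial>noises) \<partial>\<nu>)"

  proof (subst noise.nn_integral_stream_space)
    show "(\<lambda>\<omega>. indicator A (F (X (stl \<omega>), shd \<omega>)) :: ennreal) \<in> borel_measurable noises" by measurable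
  qed simp
  also have "\<dots> = (\<integral>\<^sup>+\<omega>. (\<integral>\<^sup>+g. indicator A (F (X \<omega>, g)) \<partial>\<nu>) \<partial>noises)"
    by (rule Fubini') measurable
  also have "\<dots> = (\<integral>\<^sup>+z. (\<integral>\<^sup>+g. indicator A (F (z, g)) \<partial>\<nu>) \<partial>distr noises borel X)"
    by (rule nn_integral_distr[symmetric]) measurable
  also have "\<dots> = emeasure (distr (distr noises borel X \<Otimes>\<^sub>M \<nu>) borel F) A"
    by (rule emeasure_distr_F[symmetric]) (auto intro: D.prob_space_axioms)
  finally show "emeasure (distr noises borel (\<lambda>\<omega>. F (X (stl \<omega>), shd \<omega>))) A
    = emeasure (distr (distr noises borel X \<Otimes>\<^sub>M \<nu>) borel F) A" .
qed simp

text \<open>The chain run backwards in time: each step adds a new \<^emph>\<open>first\<close> noise, so that by contraction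
  the iterates converge almost surely, to a random variable with the stationary law.\<close>

primrec backward :: "nat \<Rightarrow> 'c stream \<Rightarrow> 'b" where
  "backward 0 \<omega> = 0"
| "backward (Suc n) \<omega> = F (backward n (stl \<omega>), shd \<omega>)"

lemma backward_measurable [measurable]: "backward n \<in> measurable noises borel"
  by (induction n) simp_all

text \<open>The two iterates share their \<open>n\<close> outer maps and differ only in the
  innermost argument, which is 0 in one and \<open>F (0, \<omega> !! n)\<close> in the other; each
  outer map contracts by \<open>r\<close>.\<close>

lemma backward_increment: "N (backward (Suc n) \<omega> - backward n \<omega>) \<le> r ^ n * N (F (0, \<omega> !! n))"
proof (induction n arbitrary: \<omega>)
  case (Suc n)
  have "N (backward (Suc (Suc n)) \<omega> - backward (Suc n) \<omega>) \<le> r * N (backward (Suc n) (stl \<omega>) - backward n (stl \<omega>))"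
    using contract by simp
  also have "\<dots> \<le> r * (r ^ n * N (F (0, stl \<omega> !! n)))" using Suc r by (intro mult_left_mono) auto
  finally show ?case by simp
qed simp

lemma N_continuous: "continuous_on UNIV N"
proof -
  have "b-lipschitz_on UNIV N"
  proof (rule lipschitz_on_realI)
    show "N x - N y \<le> b * norm (x - y)" for x y
      using N_triangle[of "x - y" y] N_upper[of "x - y"] by simp
  qed (use b_pos in simp)
  then show ?thesis by (rule lipschitz_on_continuous_on)
qed

lemma N_measurable [measurable]: "N \<in> borel_measurable borel"
  by (rule borel_measurable_continuous_onI[OF N_continuous])

lemma nn_integral_snth:
  assumes [measurable]: "h \<in> borel_measurable \<nu>"
  shows "(\<integral>\<^sup>+\<omega>. h (\<omega> !! n) \<partial>noises) = (\<integral>\<^sup>+g. h g \<partial>\<nu>)"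
proof (induction n)
  case 0
  then show ?case by (subst noise.nn_integral_stream_space) (auto simp: noises.emeasure_space_1)
next
  case (Suc n)
  then show ?case by (subst noise.nn_integral_stream_space) (use noise.emeasure_space_1 in auto)
qed

lemma integrable_N_first_step: "integrable \<nu> (\<lambda>g. N (F (0, g)))"
proof (rule Bochner_Integration.integrable_bound)
  show "integrable \<nu> (\<lambda>g. N (F (0, 0)) + l * norm g)" using noise_integrable by simp
  show "AE g in \<nu>. norm (N (F (0, g))) \<le> norm (N (F (0, 0)) + l * norm g)"
  proof (rule AE_I2)
    fix g
    have "N (F (0, g)) \<le> N (F (0, g) - F (0, 0)) + N (F (0, 0))"
      using N_triangle[of "F (0, g) - F (0, 0)" "F (0, 0)"] by simp
    then show "norm (N (F (0, g))) \<le> norm (N (F (0, 0)) + l * norm g)"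
      using noise_lip[of 0 g 0] N_nonneg l_pos by (simp)
  qed
qed measurable

text \<open>Valued in \<open>ennreal\<close>, so that it is defined on every stream. Where it is
  finite the iterates converge, and it bounds the norm of their limit; its finite mean therefore
  yields both almost sure convergence and a first moment of the limit law.\<close>

definition total_variation :: "'c stream \<Rightarrow> ennreal" where
  "total_variation \<omega> = (\<Sum>n. ennreal (N (backward (Suc n) \<omega> - backward n \<omega>)))"

lemma total_variation_measurable [measurable]: "total_variation \<in> borel_measurable noises"
  unfolding total_variation_def by measurable

lemma total_variation_integrable: "(\<integral>\<^sup>+\<omega>. total_variation \<omega> \<partial>noises) < \<infinity>"
proof -
  let ?c = "\<integral>g. N (F (0, g)) \<partial>\<nu>"
  have c: "0 \<le> ?c" by (intro integral_nonneg_AE AE_I2 N_nonneg)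
  have "(\<integral>\<^sup>+\<omega>. total_variation \<omega> \<partial>noises) = (\<Sum>n. \<integral>\<^sup>+\<omega>. ennreal (N (backward (Suc n) \<omega> - backward n \<omega>)) \<partial>noises)"
    unfolding total_variation_def by (rule nn_integral_suminf) measurable
  also have "\<dots> \<le> (\<Sum>n. ennreal (r ^ n * ?c))"
  proof (intro suminf_le allI)
    fix n
    have "(\<integral>\<^sup>+\<omega>. ennreal (N (backward (Suc n) \<omega> - backward n \<omega>)) \<partial>noises)
      \<le> (\<integral>\<^sup>+\<omega>. ennreal (r ^ n * N (F (0, \<omega> !! n))) \<partial>noises)"
      by (intro nn_integral_mono ennreal_leI backward_increment)
    also have "\<dots> = (\<integral>\<^sup>+g. ennreal (r ^ n * N (F (0, g))) \<partial>\<nu>)"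
      by (rule nn_integral_snth) measurable
    also have "\<dots> = ennreal (\<integral>g. r ^ n * N (F (0, g)) \<partial>\<nu>)"
      by (intro nn_integral_eq_integral integrable_mult_right integrable_N_first_step)
        (use r N_nonneg in simp)
    finally show "(\<integral>\<^sup>+\<omega>. ennreal (N (backward (Suc n) \<omega> - backward n \<omega>)) \<partial>noises) \<le> ennreal (r ^ n * ?c)"
      by simp
  qed auto
  also have "\<dots> = ennreal (\<Sum>n. r ^ n * ?c)"
    by (rule suminf_ennreal2) (use r c in \<open>auto intro!: summable_mult2 summable_geometric\<close>)
  also have "\<dots> < \<infinity>" by simp
  finally show ?thesis .
qed

definition limit :: "'c stream \<Rightarrow> 'b" where
  "limit \<omega> = lim (\<lambda>n. backward n \<omega>)"

lemma limit_measurable [measurable]: "limit \<in> measurable noises borel"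
  unfolding limit_def by (rule borel_measurable_lim_metric) measurable

lemma backward_converges:
  assumes "total_variation \<omega> < \<infinity>"
  shows "(\<lambda>n. backward n \<omega>) \<longlonglongrightarrow> limit \<omega>" "ennreal (a * norm (limit \<omega>)) \<le> total_variation \<omega>"
proof -
  let ?d = "\<lambda>n. backward (Suc n) \<omega> - backward n \<omega>"
  have sN: "summable (\<lambda>n. N (?d n))"
    by (rule summable_suminf_not_top) (use assms N_nonneg in \<open>auto simp: total_variation_def\<close>)
  have "summable (\<lambda>n. norm (?d n))"
  proof (rule summable_comparison_test')
    show "summable (\<lambda>n. N (?d n) / a)" using sN by (rule summable_divide)
    show "norm (norm (?d n)) \<le> N (?d n) / a" for n using N_lower[of "?d n"] a_pos by (simp add: field_simps)
  qed
  then have "summable ?d" by (rule summable_norm_cancel)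
  then have "(\<lambda>n. \<Sum>k<n. ?d k) \<longlonglongrightarrow> suminf ?d" by (rule summable_LIMSEQ)
  then have "(\<lambda>n. backward n \<omega>) \<longlonglongrightarrow> suminf ?d"
    using sum_lessThan_telescope[of "\<lambda>n. backward n \<omega>"] by simp
  then show conv: "(\<lambda>n. backward n \<omega>) \<longlonglongrightarrow> limit \<omega>" by (simp add: limit_def limI)
  have fin: "N (backward n \<omega>) \<le> (\<Sum>k<n. N (?d k))" for n
  proof (induction n)
    case (Suc n)
    have "N (backward (Suc n) \<omega>) \<le> N (?d n) + N (backward n \<omega>)"
      using N_triangle[of "?d n" "backward n \<omega>"] by simp
    then show ?case using Suc by simp
  qed simp
  have "a * norm (limit \<omega>) \<le> suminf (\<lambda>n. N (?d n))"
  proof (rule LIMSEQ_le)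
    show "(\<lambda>n. a * norm (backward n \<omega>)) \<longlonglongrightarrow> a * norm (limit \<omega>)" by (intro tendsto_intros conv)
    show "(\<lambda>n. \<Sum>k<n. N (?d k)) \<longlonglongrightarrow> suminf (\<lambda>n. N (?d n))" by (rule summable_LIMSEQ[OF sN])
    show "\<exists>n0. \<forall>n\<ge>n0. a * norm (backward n \<omega>) \<le> (\<Sum>k<n. N (?d k))"
      using order_trans[OF N_lower fin] by blast
  qed
  then have "ennreal (a * norm (limit \<omega>)) \<le> ennreal (suminf (\<lambda>n. N (?d n)))" by (rule ennreal_leI)
  also have "\<dots> = total_variation \<omega>"
    unfolding total_variation_def by (rule suminf_ennreal2[symmetric]) (use sN N_nonneg in auto)
  finally show "ennreal (a * norm (limit \<omega>)) \<le> total_variation \<omega>" .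
qed

lemma AE_total_variation: "AE \<omega> in noises. total_variation \<omega> < \<infinity>"
  using nn_integral_noteq_infinite[of total_variation noises] total_variation_integrable
  by (auto simp: less_top)

definition stationary :: "'b measure" where
  "stationary = distr noises borel limit"

lemma prob_stationary: "prob_space stationary" and sets_stationary [measurable_cong]: "sets stationary = sets borel"
  unfolding stationary_def by (auto intro: noises.prob_space_distr)

text \<open>By continuity of \<open>F\<close>,
  \<open>limit (g ## \<omega>) = F (limit \<omega>, g)\<close> on every convergent stream. The left
  side has the law \<open>stationary\<close>, the right side the law one step later.\<close>

lemma invariant_stationary: "invariant_prob kernel stationary"
proof -
  have "stationary \<bind> kernel = distr noises borel (\<lambda>\<omega>. F (limit (stl \<omega>), shd \<omega>))"
    unfolding bind_kernel[OF prob_stationary sets_stationary]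
    by (simp add: stationary_def distr_step)
  also have "\<dots> = stationary" unfolding stationary_def
  proof (rule distr_cong_AE[symmetric])
    show "AE \<omega> in noises. limit \<omega> = F (limit (stl \<omega>), shd \<omega>)"
    proof (subst noise.AE_stream_space)
      show "AE g in \<nu>. AE \<omega> in noises. limit (g ## \<omega>) = F (limit (stl (g ## \<omega>)), shd (g ## \<omega>))"
      proof (rule AE_I2)
        fix g
        show "AE \<omega> in noises. limit (g ## \<omega>) = F (limit (stl (g ## \<omega>)), shd (g ## \<omega>))"
          using AE_total_variation
        proof eventually_elim
          case (elim \<omega>)
          have "(\<lambda>n. F (backward n \<omega>, g)) \<longlonglongrightarrow> F (limit \<omega>, g)"
            by (rule continuous_on_tendsto_compose[OF lipschitz_on_continuous_on[OF F_lipschitz]])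
              (auto intro!: tendsto_Pair backward_converges elim)
          then have "(\<lambda>n. backward (Suc n) (g ## \<omega>)) \<longlonglongrightarrow> F (limit \<omega>, g)" by simp
          then have "(\<lambda>n. backward n (g ## \<omega>)) \<longlonglongrightarrow> F (limit \<omega>, g)" by (rule LIMSEQ_imp_Suc)
          then show ?case by (simp add: limit_def limI)
        qed
      qed
    qed measurable
  qed auto
  finally show ?thesis using prob_stationary sets_stationary by (simp add: invariant_prob_def)
qed

lemma integrable_norm_stationary: "integrable stationary norm"
proof -
  have "(\<integral>\<^sup>+\<omega>. ennreal (a * norm (limit \<omega>)) \<partial>noises) \<le> (\<integral>\<^sup>+\<omega>. total_variation \<omega> \<partial>noises)"
    by (rule nn_integral_mono_AE) (use AE_total_variation in eventually_elim, rule backward_converges)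
  then have "(\<integral>\<^sup>+\<omega>. ennreal (a * norm (limit \<omega>)) \<partial>noises) < \<infinity>"
    using total_variation_integrable by (rule le_less_trans)
  then have "integrable noises (\<lambda>\<omega>. a * norm (limit \<omega>))"
    using a_pos by (intro integrableI_bounded) (auto simp: abs_mult)
  then have "integrable noises (\<lambda>\<omega>. norm (limit \<omega>))" using a_pos by simp
  then show ?thesis unfolding stationary_def by (subst integrable_distr_eq) auto
qed

section \<open>Log-Sobolev inequality for the stationary law\<close>

definition stationary_cost :: "'b \<Rightarrow> real" where
  "stationary_cost w = (1 - r\<^sup>2) / (2 * l\<^sup>2) * (N w)\<^sup>2"

lemma r2: "0 \<le> r\<^sup>2" "r\<^sup>2 < 1"
  using r by (auto simp: power_less_one_iff)

lemma stationary_cost_nonneg: "stationary_cost 0 = 0" "0 \<le> stationary_cost w"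
  using r2 by (auto simp: stationary_cost_def)

text \<open>Cauchy--Schwarz: \<open>(r A + l B)\<^sup>2 \<le> (r\<^sup>2 c + l\<^sup>2) (A\<^sup>2 / c + B\<^sup>2)\<close>, and \<open>c = l\<^sup>2 / (1 - r\<^sup>2)\<close> is the fixed
  point of \<open>c \<mapsto> r\<^sup>2 c + l\<^sup>2\<close>.\<close>

lemma stationary_cost_step:
  "stationary_cost (F (z', g') - F (z, g)) \<le> stationary_cost (z' - z) + (norm (g' - g))\<^sup>2 / 2"
proof -
  let ?A = "N (z' - z)" and ?B = "norm (g' - g)"
  have "(N (F (z', g') - F (z, g)))\<^sup>2 \<le> (r * ?A + l * ?B)\<^sup>2"
    by (rule power_mono[OF cost N_nonneg])
  then have "(1 - r\<^sup>2) * (N (F (z', g') - F (z, g)))\<^sup>2 \<le> (1 - r\<^sup>2) * (r * ?A + l * ?B)\<^sup>2"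
    using r2 by (intro mult_left_mono) auto
  also have "\<dots> \<le> (1 - r\<^sup>2) * ?A\<^sup>2 + l\<^sup>2 * ?B\<^sup>2"
  proof -
    have "0 \<le> ((1 - r\<^sup>2) * ?A - r * l * ?B)\<^sup>2" by simp
    also have "\<dots> = (1 - r\<^sup>2) * ?A\<^sup>2 + l\<^sup>2 * ?B\<^sup>2 - (1 - r\<^sup>2) * (r * ?A + l * ?B)\<^sup>2"
      by (simp add: power2_eq_square algebra_simps)
    finally show ?thesis by simp
  qed
  finally have "(1 - r\<^sup>2) * (N (F (z', g') - F (z, g)))\<^sup>2 / (2 * l\<^sup>2) \<le> ((1 - r\<^sup>2) * ?A\<^sup>2 + l\<^sup>2 * ?B\<^sup>2) / (2 * l\<^sup>2)"
    by (rule divide_right_mono) simp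
  then show ?thesis using l_pos by (simp add: stationary_cost_def add_divide_distrib)
qed

text \<open>Nothing deteriorates with \<open>n\<close>: a point mass satisfies the inequality for
  the stationary cost as well, and each step reproduces that cost.\<close>

lemma sup_conv_ineq_backward: "sup_conv_ineq (distr noises borel (backward n)) stationary_cost"
proof (induction n)
  case 0
  have "distr noises borel (backward 0) = return borel 0"
  proof (rule measure_eqI)
    fix A assume "A \<in> sets (distr noises borel (backward 0))"
    then show "emeasure (distr noises borel (backward 0)) A = emeasure (return borel 0) A"
      by (cases "0 \<in> A") (auto simp: emeasure_distr noises.emeasure_space_1 vimage_def)
  qed simp
  then show ?case using sup_conv_ineq_return[of stationary_cost, OF stationary_cost_nonneg] by simp
next
  case (Suc n)
  have "distr noises borel (backward (Suc n)) = distr (distr noises borel (backward n) \<Otimes>\<^sub>M \<nu>) borel F"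
    using distr_step[of "backward n"] by (simp add: backward.simps(2)[abs_def])
  moreover have "sup_conv_ineq (distr (distr noises borel (backward n) \<Otimes>\<^sub>M \<nu>) borel F) stationary_cost"
    by (rule sup_conv_ineq_compose[OF Suc noise F_lipschitz stationary_cost_nonneg _ _ stationary_cost_nonneg stationary_cost_step])
      auto
  ultimately show ?case by (simp only:)
qed

text \<open>Test function and sup-convolution do not depend on the measure, so for fixed
  \<open>f\<close> and \<open>t\<close> both sides are integrals of fixed bounded continuous
  functions and converge along the backward iterates.\<close>

lemma sup_conv_ineq_stationary: "sup_conv_ineq stationary stationary_cost"
proof -
  have "(\<integral>z. exp (f z / t) \<partial>stationary) powr t
      \<le> (\<integral>z. exp (sup_conv (\<lambda>w. t / (1 - t) * stationary_cost w) f z) \<partial>stationary)"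
    if f: "bdd_lipschitz f" and t: "0 < t" "t < 1" for f t
  proof -
    let ?S = "sup_conv (\<lambda>w. t / (1 - t) * stationary_cost w) f"
    have S: "bdd_lipschitz ?S"
      by (rule bdd_lipschitz_sup_conv[OF _ _ f]) (use t stationary_cost_nonneg in auto)
    have lim: "(\<lambda>n. \<integral>z. h (k z) \<partial>distr noises borel (backward n)) \<longlonglongrightarrow> (\<integral>z. h (k z) \<partial>stationary)"
      if k: "bdd_lipschitz k" and h: "continuous_on UNIV h" for h :: "real \<Rightarrow> real" and k
    proof -
      note [measurable] = bdd_lipschitz_measurable[OF k] borel_measurable_continuous_onI[OF h]
      obtain B where B: "\<And>x. \<bar>k x\<bar> \<le> B" using bdd_lipschitzE[OF k] by metis
      have "compact (h ` {-B..B})" by (rule compact_continuous_image[OF continuous_on_subset[OF h]]) auto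
      then have "bounded (h ` {-B..B})" by (rule compact_imp_bounded)
      then obtain D where "\<forall>y\<in>h ` {-B..B}. norm y \<le> D" unfolding bounded_iff by blast
      then have D: "\<bar>h y\<bar> \<le> D" if "y \<in> {-B..B}" for y using that by simp
      have "(\<lambda>n. \<integral>\<omega>. h (k (backward n \<omega>)) \<partial>noises) \<longlonglongrightarrow> (\<integral>\<omega>. h (k (limit \<omega>)) \<partial>noises)"
      proof (rule integral_dominated_convergence[where w = "\<lambda>_. D"])
        show "AE \<omega> in noises. (\<lambda>n. h (k (backward n \<omega>))) \<longlonglongrightarrow> h (k (limit \<omega>))"
          using AE_total_variation
        proof eventually_elim
          case (elim \<omega>)
          show ?case
            by (intro continuous_on_tendsto_compose[OF h] continuous_on_tendsto_compose[OF bdd_lipschitz_continuous[OF k, of UNIV]]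
                backward_converges elim) auto
        qed
        show "AE \<omega> in noises. norm (h (k (backward n \<omega>))) \<le> D" for n
        proof (rule AE_I2)
          fix \<omega>
          have "k (backward n \<omega>) \<in> {-B..B}" using B[of "backward n \<omega>"] by (auto simp: abs_le_iff)
          then show "norm (h (k (backward n \<omega>))) \<le> D" using D by simp
        qed
      qed measurable
      then show ?thesis by (simp add: stationary_def integral_distr)
    qed
    have "(\<lambda>n. (\<integral>z. exp (f z / t) \<partial>distr noises borel (backward n)) powr t) \<longlonglongrightarrow> (\<integral>z. exp (f z / t) \<partial>stationary) powr t"
    proof (intro tendsto_powr' tendsto_const lim[OF f, of "\<lambda>x. exp (x / t)"])
      show "continuous_on UNIV (\<lambda>x. exp (x / t))" using t by (intro continuous_intros) auto
    qed (use t in auto)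
    moreover have "(\<lambda>n. \<integral>z. exp (?S z) \<partial>distr noises borel (backward n)) \<longlonglongrightarrow> (\<integral>z. exp (?S z) \<partial>stationary)"
      by (intro lim[OF S] continuous_intros)
    ultimately show ?thesis
      by (rule LIMSEQ_le) (use sup_conv_ineq_backward f t in \<open>auto simp: sup_conv_ineq_def\<close>)
  qed
  then show ?thesis using prob_stationary sets_stationary by (simp add: sup_conv_ineq_def)
qed

lemma log_sobolev_stationary: "log_sobolev stationary (2 * (l\<^sup>2 / ((1 - r\<^sup>2) * a\<^sup>2)))"
proof (rule log_sobolev_if_sup_conv_ineq[OF sup_conv_ineq_stationary stationary_cost_nonneg(1)])
  show "0 < l\<^sup>2 / ((1 - r\<^sup>2) * a\<^sup>2)" using l_pos r2 a_pos by simp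
  show "(norm w)\<^sup>2 / (2 * (l\<^sup>2 / ((1 - r\<^sup>2) * a\<^sup>2))) \<le> stationary_cost w" for w
  proof -
    have "(a * norm w)\<^sup>2 \<le> (N w)\<^sup>2" using N_lower[of w] a_pos by (intro power_mono) auto
    then have "(1 - r\<^sup>2) / (2 * l\<^sup>2) * (a * norm w)\<^sup>2 \<le> stationary_cost w"
      unfolding stationary_cost_def using r2 by (intro mult_left_mono) auto
    moreover have "(norm w)\<^sup>2 / (2 * (l\<^sup>2 / ((1 - r\<^sup>2) * a\<^sup>2))) = (1 - r\<^sup>2) / (2 * l\<^sup>2) * (a * norm w)\<^sup>2"
      using r2 l_pos a_pos by (simp add: field_simps power_mult_distrib)
    ultimately show ?thesis by (simp only:)
  qed
qed

end

section \<open>Markov chains and Wasserstein distance\<close>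

lemma space_history [simp]: "space (history M Z k) = space M"
  by (simp add: history_def space_measure_of_conv)

lemma sets_history:
  "sets (history M Z k) = sigma_sets (space M) (\<Union>i\<in>{..k}. {Z i -` A \<inter> space M | A. A \<in> sets borel})"
  unfolding history_def by (rule sets_measure_of) auto

lemma subalgebra_history:
  assumes Z: "\<And>k. Z k \<in> borel_measurable M"
  shows "subalgebra M (history M Z k)"
  unfolding subalgebra_def sets_history
  by (auto intro!: sets.sigma_sets_subset measurable_sets[OF Z])

lemma measurable_history:
  assumes "i \<le> k"
  shows "Z i \<in> borel_measurable (history M Z k)"
proof (rule measurableI)
  fix A :: "'b set" assume "A \<in> sets borel"
  then show "Z i -` A \<inter> space (history M Z k) \<in> sets (history M Z k)"
    unfolding sets_history space_history using assms by (auto intro!: sigma_sets.Basic)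
qed simp

text \<open>\<open>markov_chain\<close> speaks only of conditional probabilities of single events at
  the next time. Two equalities of measures, first on the next state and then on the history, extend
  it to products of a history variable with a function of the next state; nonnegativity makes
  integrability conditions unnecessary.\<close>

lemma markov_chain_nn_integral:
  fixes P :: "'a::topological_space \<Rightarrow> 'a measure"
  assumes mc: "markov_chain M \<mu>0 P Z"
    and P [measurable]: "P \<in> measurable borel (subprob_algebra borel)" and "\<And>z. prob_space (P z)"
    and W: "W \<in> borel_measurable (history M Z k)" and f [measurable]: "f \<in> borel_measurable borel"
  shows "(\<integral>\<^sup>+\<omega>. W \<omega> * f (Z (Suc k) \<omega>) \<partial>M) = (\<integral>\<^sup>+\<omega>. W \<omega> * (\<integral>\<^sup>+y. f y \<partial>P (Z k \<omega>)) \<partial>M)"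
proof -
  from mc have "prob_space M" and Z [measurable]: "\<And>k. Z k \<in> borel_measurable M"
    and ce: "\<And>A. A \<in> sets borel \<Longrightarrow> AE \<omega> in M.
        real_cond_exp M (history M Z k) (\<lambda>\<omega>'. indicator A (Z (Suc k) \<omega>')) \<omega> = measure (P (Z k \<omega>)) A"
    by (auto simp: markov_chain_def)
  interpret prob_space M by fact
  interpret P: prob_space "P z" for z by fact
  have sub: "subalgebra M (history M Z k)" by (rule subalgebra_history[OF Z])
  interpret finite_measure_subalgebra M "history M Z k" by unfold_locales (rule sub)
  have PZ [measurable]: "(\<lambda>\<omega>. P (Z k \<omega>)) \<in> measurable M (subprob_algebra borel)" by measurable
  have Pn [measurable]: "(\<lambda>\<omega>. \<integral>\<^sup>+y. g y \<partial>P (Z k \<omega>)) \<in> borel_measurable M"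
    if [measurable]: "g \<in> borel_measurable borel" for g by measurable
  have sP: "sets (P z) = sets borel" for z
    using measurable_space[OF P, of z] by (simp add: space_subprob_algebra)
  have event: "emeasure M (B \<inter> (Z (Suc k) -` A \<inter> space M)) = (\<integral>\<^sup>+\<omega>. indicator B \<omega> * emeasure (P (Z k \<omega>)) A \<partial>M)"
    if B: "B \<in> sets (history M Z k)" and A [measurable]: "A \<in> sets borel" for A B
  proof -
    have [measurable]: "B \<in> sets M" using B sub by (auto simp: subalgebra_def)
    have [measurable]: "(\<lambda>\<omega>. measure (P (Z k \<omega>)) A) \<in> borel_measurable M"
      using measurable_compose[OF PZ measurable_measure_subprob_algebra[OF A]] .
    have i: "integrable M (\<lambda>\<omega>. indicator A (Z (Suc k) \<omega>) :: real)"
      by (rule integrable_const_bound[of _ 1]) auto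
    have "ennreal (\<integral>\<omega>. indicator B \<omega> * indicator A (Z (Suc k) \<omega>) \<partial>M)
        = ennreal (\<integral>\<omega>. indicator B \<omega> * measure (P (Z k \<omega>)) A \<partial>M)"
    proof -
      have "(\<integral>\<omega>\<in>B. indicator A (Z (Suc k) \<omega>) \<partial>M)
         = (\<integral>\<omega>\<in>B. real_cond_exp M (history M Z k) (\<lambda>\<omega>. indicator A (Z (Suc k) \<omega>)) \<omega> \<partial>M)"
        by (rule real_cond_exp_intA[OF i B])
      also have "\<dots> = (\<integral>\<omega>\<in>B. measure (P (Z k \<omega>)) A \<partial>M)"
        unfolding set_lebesgue_integral_def
        by (rule integral_cong_AE) (use ce[OF A] in \<open>measurable, auto\<close>)
      finally show ?thesis by (simp add: set_lebesgue_integral_def)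
    qed
    moreover have "ennreal (\<integral>\<omega>. indicator B \<omega> * measure (P (Z k \<omega>)) A \<partial>M) = (\<integral>\<^sup>+\<omega>. indicator B \<omega> * emeasure (P (Z k \<omega>)) A \<partial>M)"
    proof -
      have "integrable M (\<lambda>\<omega>. indicator B \<omega> * measure (P (Z k \<omega>)) A)"
        by (rule integrable_const_bound[of _ 1]) (auto simp: indicator_def)
      then have "(\<integral>\<^sup>+\<omega>. ennreal (indicator B \<omega> * measure (P (Z k \<omega>)) A) \<partial>M) = ennreal (\<integral>\<omega>. indicator B \<omega> * measure (P (Z k \<omega>)) A \<partial>M)"
        by (rule nn_integral_eq_integral) auto
      then show ?thesis by (simp add: ennreal_mult P.emeasure_eq_measure ennreal_indicator)
    qed
    moreover have "emeasure M (B \<inter> (Z (Suc k) -` A \<inter> space M)) = ennreal (\<integral>\<omega>. indicator B \<omega> * indicator A (Z (Suc k) \<omega>) \<partial>M)"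
    proof -
      have "(\<integral>\<omega>. indicator B \<omega> * indicator A (Z (Suc k) \<omega>) \<partial>M) = (\<integral>\<omega>. (indicator :: _ \<Rightarrow> _ \<Rightarrow> real) (B \<inter> (Z (Suc k) -` A \<inter> space M)) \<omega> \<partial>M)"
        by (intro Bochner_Integration.integral_cong) (auto simp: indicator_def)
      then show ?thesis by (simp add: emeasure_eq_measure)
    qed
    ultimately show ?thesis by simp
  qed
  have set: "(\<integral>\<^sup>+\<omega>. indicator B \<omega> * f (Z (Suc k) \<omega>) \<partial>M) = (\<integral>\<^sup>+\<omega>. indicator B \<omega> * (\<integral>\<^sup>+y. f y \<partial>P (Z k \<omega>)) \<partial>M)"
    if B: "B \<in> sets (history M Z k)" for B
  proof -
    have [measurable]: "B \<in> sets M" using B sub by (auto simp: subalgebra_def)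
    \<comment> \<open>Weighting \<open>M\<close> by the event \<open>B\<close> turns the claim for
      all \<open>f\<close> at once into the equality of two laws of the next state.\<close>
    let ?D = "density M (indicator B)"
    have k': "(\<lambda>\<omega>. P (Z k \<omega>)) \<in> measurable ?D (subprob_algebra borel)" by simp
    have ne: "space ?D \<noteq> {}" using not_empty by simp
    have eq: "distr ?D borel (Z (Suc k)) = ?D \<bind> (\<lambda>\<omega>. P (Z k \<omega>))"
    proof (rule measure_eqI)
      show sb: "sets (distr ?D borel (Z (Suc k))) = sets (?D \<bind> (\<lambda>\<omega>. P (Z k \<omega>)))"
        by (subst sets_bind[of _ _ borel]) (use sP ne in auto)
      fix A assume "A \<in> sets (distr ?D borel (Z (Suc k)))"
      then have A [measurable]: "A \<in> sets borel" by simp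
      have "emeasure (distr ?D borel (Z (Suc k))) A = emeasure ?D (Z (Suc k) -` A \<inter> space M)"
        by (subst emeasure_distr) auto
      also have "\<dots> = emeasure M (B \<inter> (Z (Suc k) -` A \<inter> space M))"
        by (subst emeasure_density) (auto simp: indicator_inter_arith[symmetric] simp del: nn_integral_indicator simp flip: nn_integral_indicator)
      also have "\<dots> = (\<integral>\<^sup>+\<omega>. emeasure (P (Z k \<omega>)) A \<partial>?D)"
        by (subst nn_integral_density) (auto simp: event[OF B A] intro!: measurable_compose[OF PZ measurable_emeasure_subprob_algebra])
      also have "\<dots> = emeasure (?D \<bind> (\<lambda>\<omega>. P (Z k \<omega>))) A"
        by (rule emeasure_bind[OF ne k' A, symmetric])
      finally show "emeasure (distr ?D borel (Z (Suc k))) A = emeasure (?D \<bind> (\<lambda>\<omega>. P (Z k \<omega>))) A" .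
    qed
    have "(\<integral>\<^sup>+\<omega>. indicator B \<omega> * f (Z (Suc k) \<omega>) \<partial>M) = (\<integral>\<^sup>+\<omega>. f (Z (Suc k) \<omega>) \<partial>?D)"
      by (subst nn_integral_density) auto
    also have "\<dots> = (\<integral>\<^sup>+y. f y \<partial>distr ?D borel (Z (Suc k)))"
      by (rule nn_integral_distr[symmetric]) auto
    also have "\<dots> = (\<integral>\<^sup>+\<omega>. (\<integral>\<^sup>+y. f y \<partial>P (Z k \<omega>)) \<partial>?D)"
      unfolding eq by (rule nn_integral_bind[OF f k'])
    also have "\<dots> = (\<integral>\<^sup>+\<omega>. indicator B \<omega> * (\<integral>\<^sup>+y. f y \<partial>P (Z k \<omega>)) \<partial>M)"
      by (subst nn_integral_density) auto
    finally show ?thesis .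
  qed
  \<comment> \<open>The same device for the history: the two densities give every history event the
    same mass, hence define the same measure on the history and integrate \<open>W\<close>
    alike.\<close>
  let ?R = "\<lambda>h. restr_to_subalg (density M h) (history M Z k)"
  have subd: "subalgebra (density M h) (history M Z k)" for h
    using sub by (simp add: subalgebra_def)
  have R_eq: "?R (\<lambda>\<omega>. f (Z (Suc k) \<omega>)) = ?R (\<lambda>\<omega>. \<integral>\<^sup>+y. f y \<partial>P (Z k \<omega>))"
  proof (rule measure_eqI)
    fix B assume "B \<in> sets (?R (\<lambda>\<omega>. f (Z (Suc k) \<omega>)))"
    then have B: "B \<in> sets (history M Z k)" by (simp add: sets_restr_to_subalg[OF subd])
    then have "B \<in> sets M" using sub by (auto simp: subalgebra_def)
    then show "emeasure (?R (\<lambda>\<omega>. f (Z (Suc k) \<omega>))) B = emeasure (?R (\<lambda>\<omega>. \<integral>\<^sup>+y. f y \<partial>P (Z k \<omega>))) B"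
      using set[OF B] by (simp add: emeasure_restr_to_subalg[OF subd B] emeasure_density mult.commute)
  qed (simp add: sets_restr_to_subalg[OF subd])
  have R_int: "(\<integral>\<^sup>+\<omega>. W \<omega> \<partial>?R h) = (\<integral>\<^sup>+\<omega>. W \<omega> * h \<omega> \<partial>M)"
    if [measurable]: "h \<in> borel_measurable M" for h
  proof -
    have [measurable]: "W \<in> borel_measurable M" by (rule measurable_from_subalg[OF sub W])
    have "(\<integral>\<^sup>+\<omega>. W \<omega> \<partial>?R h) = (\<integral>\<^sup>+\<omega>. W \<omega> \<partial>density M h)" by (rule nn_integral_subalgebra2[OF subd W])
    then show ?thesis by (simp add: nn_integral_density mult.commute)
  qed
  have "(\<integral>\<^sup>+\<omega>. W \<omega> * f (Z (Suc k) \<omega>) \<partial>M) = (\<integral>\<^sup>+\<omega>. W \<omega> \<partial>?R (\<lambda>\<omega>. f (Z (Suc k) \<omega>)))"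
    by (rule R_int[symmetric]) measurable
  also have "\<dots> = (\<integral>\<^sup>+\<omega>. W \<omega> * (\<integral>\<^sup>+y. f y \<partial>P (Z k \<omega>)) \<partial>M)"
    unfolding R_eq by (rule R_int[OF Pn[OF f]])
  finally show ?thesis .
qed

text \<open>The easy half of Kantorovich duality, proved for each coupling. Dividing by
  \<open>D\<close> before taking the infimum keeps the argument valid in \<open>ennreal\<close>, an
  infinite distance included.\<close>

lemma wasserstein1_bound:
  fixes \<mu> \<nu> :: "'a::euclidean_space measure"
  assumes h: "D-lipschitz_on UNIV h" and D: "0 < D" and i: "integrable \<mu> h" "integrable \<nu> h"
  shows "ennreal \<bar>(\<integral>z. h z \<partial>\<mu>) - (\<integral>z. h z \<partial>\<nu>)\<bar> \<le> ennreal D * wasserstein1 \<mu> \<nu>"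
proof -
  have hb [measurable]: "h \<in> borel_measurable borel"
    by (rule borel_measurable_continuous_onI[OF lipschitz_on_continuous_on[OF h]])
  have le: "ennreal \<bar>(\<integral>z. h z \<partial>\<mu>) - (\<integral>z. h z \<partial>\<nu>)\<bar> \<le> ennreal D * (\<integral>\<^sup>+p. ennreal (dist (fst p) (snd p)) \<partial>\<Gamma>)"
    if \<Gamma>: "\<Gamma> \<in> couplings \<mu> \<nu>" for \<Gamma>
  proof -
    from \<Gamma> have s [measurable_cong]: "sets \<Gamma> = sets (borel \<Otimes>\<^sub>M borel)"
      and m: "distr \<Gamma> borel fst = \<mu>" "distr \<Gamma> borel snd = \<nu>" by (auto simp: couplings_def)
    have mfst: "fst \<in> measurable \<Gamma> borel" "snd \<in> measurable \<Gamma> borel" by measurable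
    have i1: "integrable \<Gamma> (\<lambda>p. h (fst p))"
      using i(1) integrable_distr_eq[OF mfst(1) hb] by (simp add: m)
    have i2: "integrable \<Gamma> (\<lambda>p. h (snd p))"
      using i(2) integrable_distr_eq[OF mfst(2) hb] by (simp add: m)
    have "(\<integral>z. h z \<partial>\<mu>) - (\<integral>z. h z \<partial>\<nu>) = (\<integral>p. h (fst p) \<partial>\<Gamma>) - (\<integral>p. h (snd p) \<partial>\<Gamma>)"
      using integral_distr[OF mfst(1) hb] integral_distr[OF mfst(2) hb] by (simp add: m)
    also have "\<dots> = (\<integral>p. h (fst p) - h (snd p) \<partial>\<Gamma>)" using i1 i2 by simp
    finally have "ennreal \<bar>(\<integral>z. h z \<partial>\<mu>) - (\<integral>z. h z \<partial>\<nu>)\<bar> = ennreal (norm (\<integral>p. h (fst p) - h (snd p) \<partial>\<Gamma>))" by simp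
    also have "\<dots> \<le> (\<integral>\<^sup>+p. ennreal (norm (h (fst p) - h (snd p))) \<partial>\<Gamma>)"
      by (rule integral_norm_bound_ennreal) (use i1 i2 in simp)
    also have "\<dots> \<le> (\<integral>\<^sup>+p. ennreal D * ennreal (dist (fst p) (snd p)) \<partial>\<Gamma>)"
      using lipschitz_onD[OF h] D by (intro nn_integral_mono) (simp add: ennreal_mult[symmetric] dist_real_def ennreal_leI)
    also have "\<dots> = ennreal D * (\<integral>\<^sup>+p. ennreal (dist (fst p) (snd p)) \<partial>\<Gamma>)"
      by (rule nn_integral_cmult) measurable
    finally show ?thesis .
  qed
  have "ennreal (1 / D) * ennreal \<bar>(\<integral>z. h z \<partial>\<mu>) - (\<integral>z. h z \<partial>\<nu>)\<bar> \<le> wasserstein1 \<mu> \<nu>"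
    unfolding wasserstein1_def
  proof (rule INF_greatest)
    fix \<Gamma> assume "\<Gamma> \<in> couplings \<mu> \<nu>"
    from mult_left_mono[OF le[OF this], of "ennreal (1 / D)"] D
    show "ennreal (1 / D) * ennreal \<bar>(\<integral>z. h z \<partial>\<mu>) - (\<integral>z. h z \<partial>\<nu>)\<bar> \<le> (\<integral>\<^sup>+p. ennreal (dist (fst p) (snd p)) \<partial>\<Gamma>)"
      by (simp add: mult.assoc[symmetric] ennreal_mult[symmetric])
  qed
  from mult_left_mono[OF this, of "ennreal D"] D show ?thesis
    by (simp add: mult.assoc[symmetric] ennreal_mult[symmetric])
qed

lemma lipschitz_integrable:
  fixes h :: "'a::euclidean_space \<Rightarrow> real"
  assumes "prob_space \<mu>" and [measurable_cong]: "sets \<mu> = sets borel" and i: "integrable \<mu> norm"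
    and h: "D-lipschitz_on UNIV h"
  shows "integrable \<mu> h"
proof -
  interpret prob_space \<mu> by fact
  have [measurable]: "h \<in> borel_measurable borel"
    by (rule borel_measurable_continuous_onI[OF lipschitz_on_continuous_on[OF h]])
  show ?thesis
  proof (rule Bochner_Integration.integrable_bound)
    show "integrable \<mu> (\<lambda>z. \<bar>h 0\<bar> + D * norm z)" using i by simp
    have "norm (h z) \<le> norm (\<bar>h 0\<bar> + D * norm z)" for z
      using lipschitz_on_abs_diff[OF h, of z 0] by simp
    then show "AE z in \<mu>. norm (h z) \<le> norm (\<bar>h 0\<bar> + D * norm z)" by simp
  qed measurable
qed

text \<open>A coupling of finite cost carries the first moment from one marginal to the other. For
  the concentration bound this is the source of the first moment of the initial law.\<close>

lemma integrable_norm_if_wasserstein1_finite: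
  fixes \<mu> \<nu> :: "'a::euclidean_space measure"
  assumes W: "wasserstein1 \<mu> \<nu> < \<infinity>" and i: "integrable \<nu> norm"
  shows "integrable \<mu> norm"
proof -
  obtain \<Gamma> where \<Gamma>: "\<Gamma> \<in> couplings \<mu> \<nu>" "(\<integral>\<^sup>+p. ennreal (dist (fst p) (snd p)) \<partial>\<Gamma>) < \<infinity>"
    using W unfolding wasserstein1_def INF_less_iff by blast
  from \<Gamma> have s [measurable_cong]: "sets \<Gamma> = sets (borel \<Otimes>\<^sub>M borel)"
    and m: "distr \<Gamma> borel fst = \<mu>" "distr \<Gamma> borel snd = \<nu>" by (auto simp: couplings_def)
  have mfst: "fst \<in> measurable \<Gamma> borel" "snd \<in> measurable \<Gamma> borel" by measurable
  have i2: "integrable \<Gamma> (\<lambda>p. norm (snd p))"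
    using i integrable_distr_eq[OF mfst(2), of norm] by (simp add: m)
  have "integrable \<Gamma> (\<lambda>p. dist (fst p) (snd p))"
    using \<Gamma>(2) by (intro integrableI_bounded) auto
  then have "integrable \<Gamma> (\<lambda>p. dist (fst p) (snd p) + norm (snd p))" using i2 by simp
  then have "integrable \<Gamma> (\<lambda>p. norm (fst p))"
  proof (rule Bochner_Integration.integrable_bound)
    have "norm (norm (fst p)) \<le> norm (dist (fst p) (snd p) + norm (snd p))" for p :: "'a \<times> 'a"
      using norm_triangle_ineq[of "fst p - snd p" "snd p"] by (simp add: dist_norm)
    then show "AE p in \<Gamma>. norm (norm (fst p)) \<le> norm (dist (fst p) (snd p) + norm (snd p))" by simp
  qed measurable
  then show ?thesis using integrable_distr_eq[OF mfst(1), of norm] by (simp add: m)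
qed

section \<open>Concentration\<close>

context random_map
begin

definition transition :: "('b \<Rightarrow> real) \<Rightarrow> 'b \<Rightarrow> real" where
  "transition f z = (\<integral>g. f (F (z, g)) \<partial>\<nu>)"

text \<open>Measured in \<open>N\<close> because each step gains the factor \<open>r\<close> there;
  in the Euclidean norm every step would also lose the ratio \<open>b / a\<close>.\<close>

definition N_lipschitz :: "real \<Rightarrow> ('b \<Rightarrow> real) \<Rightarrow> bool" where
  "N_lipschitz K f \<longleftrightarrow> 0 \<le> K \<and> (\<forall>x y. f x - f y \<le> K * N (x - y))"

lemma N_lipschitz_on: "N_lipschitz K f \<Longrightarrow> (K * b)-lipschitz_on UNIV f"
proof (rule lipschitz_on_realI)
  assume f: "N_lipschitz K f"
  then show "0 \<le> K * b" using b_pos by (simp add: N_lipschitz_def)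
  show "f x - f y \<le> K * b * norm (x - y)" for x y
    using f mult_left_mono[OF N_upper[of "x - y"], of K] by (auto simp: N_lipschitz_def intro: order_trans simp: mult.assoc)
qed

lemma lipschitz_N_lipschitz: "K-lipschitz_on UNIV f \<Longrightarrow> N_lipschitz (K / a) f"
proof -
  assume f: "K-lipschitz_on UNIV f"
  have K: "0 \<le> K" by (rule lipschitz_on_nonneg[OF f])
  have "f x - f y \<le> K / a * N (x - y)" for x y
  proof -
    have "f x - f y \<le> K * norm (x - y)" using lipschitz_on_abs_diff[OF f, of x y] by linarith
    also have "\<dots> \<le> K * (N (x - y) / a)" using N_lower[of "x - y"] a_pos K
      by (intro mult_left_mono) (auto simp: field_simps)
    finally show ?thesis by simp
  qed
  then show ?thesis using K a_pos by (simp add: N_lipschitz_def)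
qed

lemma N_lipschitz_measurable: "N_lipschitz K f \<Longrightarrow> f \<in> borel_measurable borel"
  by (rule borel_measurable_continuous_onI[OF lipschitz_on_continuous_on[OF N_lipschitz_on]])

lemma N_lipschitz_noise: "N_lipschitz K f \<Longrightarrow> (K * l)-lipschitz_on UNIV (\<lambda>g. f (F (z, g)))"
proof (rule lipschitz_on_realI)
  assume f: "N_lipschitz K f"
  then show "0 \<le> K * l" using l_pos by (simp add: N_lipschitz_def)
  show "f (F (z, g)) - f (F (z, g')) \<le> K * l * norm (g - g')" for g g'
    using f mult_left_mono[OF noise_lip[of z g g'], of K] by (auto simp: N_lipschitz_def intro: order_trans simp: mult.assoc)
qed

lemma N_lipschitz_integrable: "N_lipschitz K f \<Longrightarrow> integrable \<nu> (\<lambda>g. f (F (z, g)))"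
  by (rule lipschitz_integrable[OF prob_noise sets_noise noise_integrable N_lipschitz_noise])

lemma N_lipschitz_transition:
  assumes f: "N_lipschitz K f"
  shows "N_lipschitz (r * K) (transition f)"
  unfolding N_lipschitz_def
proof (intro conjI allI)
  from f have K: "0 \<le> K" "\<And>x y. f x - f y \<le> K * N (x - y)" by (auto simp: N_lipschitz_def)
  then show "0 \<le> r * K" using r by simp
  fix x y
  have "transition f x - transition f y = (\<integral>g. f (F (x, g)) - f (F (y, g)) \<partial>\<nu>)"
    unfolding transition_def using N_lipschitz_integrable[OF f] by simp
  also have "\<dots> \<le> (\<integral>g. r * K * N (x - y) \<partial>\<nu>)"
  proof (rule integral_mono)
    show "f (F (x, g)) - f (F (y, g)) \<le> r * K * N (x - y)" for g
      using K(2)[of "F (x, g)" "F (y, g)"] mult_left_mono[OF contract[of x g y] K(1)]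
      by (simp add: mult_ac)
  qed (use N_lipschitz_integrable[OF f] in auto)
  finally show "transition f x - transition f y \<le> r * K * N (x - y)" using noise.prob_space by simp
qed

lemma N_lipschitz_transition_power:
  assumes "N_lipschitz K f"
  shows "N_lipschitz (r ^ n * K) ((transition ^^ n) f)"
proof (induction n)
  case (Suc n)
  then show ?case using N_lipschitz_transition[OF Suc] by (simp add: mult.assoc)
qed (use assms in simp)

lemma integral_transition:
  assumes inv: "invariant_prob kernel \<mu>" and f [measurable]: "f \<in> borel_measurable borel"
    and i: "integrable \<mu> f"
  shows "(\<integral>z. transition f z \<partial>\<mu>) = (\<integral>z. f z \<partial>\<mu>)"
proof -
  from inv have ps: "prob_space \<mu>" and s [measurable_cong]: "sets \<mu> = sets borel"
    and eq: "distr (\<mu> \<Otimes>\<^sub>M \<nu>) borel F = \<mu>"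
    by (auto simp: invariant_prob_def bind_kernel)
  interpret M: prob_space \<mu> by fact
  interpret P: pair_prob_space \<mu> \<nu> ..
  have m: "F \<in> measurable (\<mu> \<Otimes>\<^sub>M \<nu>) borel" by measurable
  have "integrable (\<mu> \<Otimes>\<^sub>M \<nu>) (\<lambda>p. f (F p))" using i integrable_distr_eq[OF m f] by (simp add: eq)
  then have "(\<integral>z. transition f z \<partial>\<mu>) = (\<integral>p. f (F p) \<partial>(\<mu> \<Otimes>\<^sub>M \<nu>))"
    unfolding transition_def by (rule P.integral_fst')
  also have "\<dots> = (\<integral>z. f z \<partial>\<mu>)" using integral_distr[OF m f] by (simp add: eq)
  finally show ?thesis .
qed

lemma transition_bounded:
  assumes "N_lipschitz K f" "\<And>z. \<bar>f z\<bar> \<le> B"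
  shows "\<bar>transition f z\<bar> \<le> B"
proof -
  have "\<bar>transition f z\<bar> \<le> (\<integral>g. \<bar>f (F (z, g))\<bar> \<partial>\<nu>)" unfolding transition_def by (rule integral_abs_bound)
  also have "\<dots> \<le> (\<integral>g. B \<partial>\<nu>)"
    by (rule integral_mono) (use assms(2) N_lipschitz_integrable[OF assms(1)] in auto)
  finally show ?thesis using noise.prob_space by simp
qed

lemma transition_power_bounded:
  assumes "N_lipschitz K f" "\<And>z. \<bar>f z\<bar> \<le> B"
  shows "\<bar>(transition ^^ n) f z\<bar> \<le> B"
proof (induction n arbitrary: z)
  case (Suc n)
  show ?case using transition_bounded[OF N_lipschitz_transition_power[OF assms(1)] Suc] by simp
qed (use assms in simp)

text \<open>Iterating \<open>transition\<close> flattens \<open>f\<close>: the difference to the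
  value at 0 vanishes pointwise. The integral of \<open>f\<close> under any invariant law is
  therefore the limit of \<open>(transition ^^ n) f 0\<close>. Bounded test functions are used
  because an arbitrary invariant law comes without moments.\<close>

lemma invariant_unique:
  assumes \<mu>: "invariant_prob kernel \<mu>" and \<mu>': "invariant_prob kernel \<mu>'"
  shows "\<mu> = \<mu>'"
proof (rule prob_measure_eqI_bdd_lipschitz)
  show "prob_space \<mu>" "prob_space \<mu>'" "sets \<mu> = sets borel" "sets \<mu>' = sets borel"
    using assms by (auto simp: invariant_prob_def)
  fix f :: "'b \<Rightarrow> real" assume f: "bdd_lipschitz f"
  obtain B where B: "\<And>x. \<bar>f x\<bar> \<le> B" using bdd_lipschitzE[OF f] by metis
  from f obtain K where "K-lipschitz_on UNIV f" unfolding bdd_lipschitz_def by auto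
  then have K: "N_lipschitz (K / a) f" by (rule lipschitz_N_lipschitz)
  let ?f = "\<lambda>n. (transition ^^ n) f"
  have lim: "(\<lambda>n. (\<integral>z. f z \<partial>\<rho>) - ?f n 0) \<longlonglongrightarrow> 0" if \<rho>: "invariant_prob kernel \<rho>" for \<rho>
  proof -
    from \<rho> have ps: "prob_space \<rho>" and s [measurable_cong]: "sets \<rho> = sets borel" by (auto simp: invariant_prob_def)
    interpret prob_space \<rho> by fact
    note [measurable] = N_lipschitz_measurable[OF N_lipschitz_transition_power[OF K]]
    have i: "integrable \<rho> (?f n)" for n
      by (rule integrable_const_bound[of _ B]) (use transition_power_bounded[OF K B] in auto)
    have same: "(\<integral>z. ?f n z \<partial>\<rho>) = (\<integral>z. f z \<partial>\<rho>)" for n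
    proof (induction n)
      case (Suc n)
      then show ?case
        using integral_transition[OF \<rho> N_lipschitz_measurable[OF N_lipschitz_transition_power[OF K, of n]] i[of n]] by simp
    qed simp
    have "(\<lambda>n. \<integral>z. ?f n z - ?f n 0 \<partial>\<rho>) \<longlonglongrightarrow> (\<integral>z. 0 \<partial>\<rho>)"
    proof (rule integral_dominated_convergence[where w = "\<lambda>_. 2 * B"])
      show "AE z in \<rho>. (\<lambda>n. ?f n z - ?f n 0) \<longlonglongrightarrow> 0"
      proof (rule AE_I2)
        fix z
        \<comment> \<open>\<open>N\<close> need not be even, so differences in the two directions
          bring in both \<open>N z\<close> and \<open>N (- z)\<close>.\<close>
        have lim0: "(\<lambda>n. r ^ n * (K / a * (N z + N (- z)))) \<longlonglongrightarrow> 0 * (K / a * (N z + N (- z)))"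
          by (intro tendsto_mult LIMSEQ_power_zero tendsto_const) (use r in auto)
        have bd: "\<bar>?f n z - ?f n 0\<bar> \<le> r ^ n * (K / a * (N z + N (- z)))" for n
        proof -
          have L: "0 \<le> r ^ n * (K / a)" "?f n z - ?f n 0 \<le> r ^ n * (K / a) * N z" "?f n 0 - ?f n z \<le> r ^ n * (K / a) * N (- z)"
            using N_lipschitz_transition_power[OF K, of n] unfolding N_lipschitz_def
            by (metis, metis diff_zero, metis diff_0)
          have "0 \<le> r ^ n * (K / a) * N z" "0 \<le> r ^ n * (K / a) * N (- z)"
            by (intro mult_nonneg_nonneg[OF L(1) N_nonneg])+
          then show ?thesis using L unfolding distrib_left mult.assoc[symmetric] by linarith
        qed
        show "(\<lambda>n. ?f n z - ?f n 0) \<longlonglongrightarrow> 0"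
        proof (rule Lim_null_comparison)
          show "\<forall>\<^sub>F n in sequentially. norm (?f n z - ?f n 0) \<le> r ^ n * (K / a * (N z + N (- z)))"
            using bd by (intro always_eventually allI) (simp only: real_norm_def)
          show "(\<lambda>n. r ^ n * (K / a * (N z + N (- z)))) \<longlonglongrightarrow> 0" using lim0 by (simp only: mult_zero_left)
        qed
      qed
      have "norm (?f n z - ?f n 0) \<le> 2 * B" for n z
        using transition_power_bounded[OF K B, of n z] transition_power_bounded[OF K B, of n 0] by simp
      then show "AE z in \<rho>. norm (?f n z - ?f n 0) \<le> 2 * B" for n by simp
    qed auto
    then show ?thesis using i same prob_space by simp
  qed
  from tendsto_diff[OF lim[OF \<mu>] lim[OF \<mu>']]
  show "(\<integral>z. f z \<partial>\<mu>) = (\<integral>z. f z \<partial>\<mu>')" by (simp add: LIMSEQ_const_iff)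
qed

lemma stationary_eq_THE: "(THE \<pi>. invariant_prob kernel \<pi>) = stationary"
  by (rule the_equality[of "invariant_prob kernel", OF invariant_stationary invariant_unique[OF _ invariant_stationary]])

section \<open>Exponential moments of the martingale increments\<close>

lemma N_lipschitz_const: "N_lipschitz 0 (\<lambda>_. c)"
  by (simp add: N_lipschitz_def)

lemma N_lipschitz_add: "N_lipschitz K f \<Longrightarrow> N_lipschitz K' h \<Longrightarrow> N_lipschitz (K + K') (\<lambda>z. f z + h z)"
  unfolding N_lipschitz_def by (auto simp: distrib_right) (metis add_diff_add add_mono)

lemma N_lipschitz_mono: "N_lipschitz K f \<Longrightarrow> K \<le> K' \<Longrightarrow> N_lipschitz K' f"
  unfolding N_lipschitz_def using N_nonneg by (meson mult_right_mono order_trans)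

lemma prob_kernel: "prob_space (kernel z)"
  unfolding kernel_def by (rule noise.prob_space_distr) measurable

text \<open>The standard Gaussian has log-Sobolev constant 2, and Herbst's bound for a
  \<open>(K * l)\<close>-Lipschitz function of the noise gives the variance proxy
  \<open>(K * l)^2\<close> of one martingale increment.\<close>

lemma kernel_exp_moment:
  assumes f: "N_lipschitz K f"
  shows "(\<integral>\<^sup>+y. ennreal (exp (t * f y)) \<partial>kernel z) \<le> ennreal (exp (t * transition f z + t\<^sup>2 * (K * l)\<^sup>2 / 2))"
proof -
  note [measurable] = N_lipschitz_measurable[OF f]
  have ls: "log_sobolev \<nu> (2 * 1)"
    by (rule log_sobolev_if_sup_conv_ineq[OF noise]) auto
  have lip: "(\<bar>t\<bar> * (K * l))-lipschitz_on UNIV (\<lambda>g. t * f (F (z, g)))"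
    using lipschitz_on_cmult_real[OF N_lipschitz_noise[OF f, of z], of t] by simp
  have i: "integrable \<nu> (\<lambda>g. t * f (F (z, g)))" using N_lipschitz_integrable[OF f] by simp
  have "(\<integral>\<^sup>+y. ennreal (exp (t * f y)) \<partial>kernel z) = (\<integral>\<^sup>+g. ennreal (exp (t * f (F (z, g)))) \<partial>\<nu>)"
    unfolding kernel_def by (rule nn_integral_distr) measurable
  also have "\<dots> \<le> ennreal (exp ((\<integral>g. t * f (F (z, g)) \<partial>\<nu>) + (2 * 1) * (\<bar>t\<bar> * (K * l))\<^sup>2 / 4))"
    by (rule log_sobolev_exp_moment[OF ls _ lip i]) simp
  also have "(\<integral>g. t * f (F (z, g)) \<partial>\<nu>) + (2 * 1) * (\<bar>t\<bar> * (K * l))\<^sup>2 / 4 = t * transition f z + t\<^sup>2 * (K * l)\<^sup>2 / 2"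
    by (simp add: transition_def power_mult_distrib)
  finally show ?thesis .
qed

text \<open>The conditional expectation, given the present state, of the sum of the next
  \<open>n\<close> values of \<open>\<phi>\<close>. It starts at 1 because the empirical mean in the
  theorem leaves out \<open>Z 0\<close>.\<close>

definition future :: "('b \<Rightarrow> real) \<Rightarrow> nat \<Rightarrow> 'b \<Rightarrow> real" where
  "future \<phi> n z = (\<Sum>i=1..n. (transition ^^ i) \<phi> z)"

context
  fixes \<phi> :: "'b \<Rightarrow> real" assumes \<phi>: "1-lipschitz_on UNIV \<phi>"
begin

text \<open>The influence of the present state decays by the factor \<open>r\<close> at each step,
  so the Lipschitz constants form a geometric series and stay bounded uniformly in the horizon
  \<open>n\<close>.\<close>

lemma N_lipschitz_future_sum:
  "N_lipschitz ((\<Sum>i\<le>n. r ^ i) / a) (\<lambda>z. \<phi> z + future \<phi> n z)"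
proof (induction n)
  case 0
  then show ?case using lipschitz_N_lipschitz[OF \<phi>] by (simp add: future_def)
next
  case (Suc n)
  then show ?case
    using N_lipschitz_add[OF Suc N_lipschitz_transition_power[OF lipschitz_N_lipschitz[OF \<phi>], of "Suc n"]]
    by (simp add: future_def add.assoc add_divide_distrib)
qed

lemma geometric_le: "(\<Sum>i\<le>n. r ^ i) \<le> 1 / (1 - r)"
proof -
  have "(\<Sum>i\<le>n. r ^ i) = (1 - r ^ Suc n) / (1 - r)"
    using r by (subst lessThan_Suc_atMost[symmetric], subst sum_gp_strict) auto
  also have "\<dots> \<le> 1 / (1 - r)" using r by (intro divide_right_mono) auto
  finally show ?thesis .
qed

lemma N_lipschitz_total: "N_lipschitz (1 / (a * (1 - r))) (\<lambda>z. \<phi> z + future \<phi> n z)"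
  by (rule N_lipschitz_mono[OF N_lipschitz_future_sum])
    (use divide_right_mono[OF geometric_le, of a n] a_pos in \<open>simp add: mult.commute\<close>)

text \<open>This is the martingale property: integrating out one step lengthens the horizon by one,
  so the values seen so far plus \<open>future\<close> of the remaining horizon have constant
  conditional mean.\<close>

lemma transition_total: "transition (\<lambda>z. \<phi> z + future \<phi> n z) = future \<phi> (Suc n)"
proof (induction n)
  case 0
  show ?case by (simp add: future_def)
next
  case (Suc n)
  have "transition (\<lambda>z. \<phi> z + future \<phi> (Suc n) z) z
      = transition (\<lambda>z. \<phi> z + future \<phi> n z) z + transition ((transition ^^ Suc n) \<phi>) z" for z
    unfolding transition_def[of _ z] future_def
    using N_lipschitz_integrable[OF N_lipschitz_future_sum[of n], of z]
      N_lipschitz_integrable[OF N_lipschitz_transition_power[OF lipschitz_N_lipschitz[OF \<phi>], of "Suc n"], of z]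
    by (simp add: add.assoc[symmetric] future_def)
  then show ?case unfolding Suc by (auto simp: future_def fun_eq_iff)
qed

lemma N_lipschitz_future: "N_lipschitz (1 / (a * (1 - r))) (future \<phi> n)"
proof (cases n)
  case 0
  then have "future \<phi> n = (\<lambda>_. 0)" by (simp add: future_def fun_eq_iff)
  then show ?thesis using N_lipschitz_mono[OF N_lipschitz_const, of "1 / (a * (1 - r))" 0] a_pos r by simp
next
  case (Suc m)
  have "N_lipschitz (r * (1 / (a * (1 - r)))) (future \<phi> (Suc m))"
    unfolding transition_total[symmetric] by (rule N_lipschitz_transition[OF N_lipschitz_total])
  then show ?thesis unfolding Suc
    by (rule N_lipschitz_mono) (use a_pos r in \<open>intro mult_left_le_one_le, auto\<close>)
qed

lemma integral_future: "(\<integral>z. future \<phi> n z \<partial>stationary) = real n * (\<integral>z. \<phi> z \<partial>stationary)"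
proof -
  have K: "N_lipschitz (1 / a) \<phi>" using lipschitz_N_lipschitz[OF \<phi>] by simp
  have i: "integrable stationary ((transition ^^ k) \<phi>)" for k
    by (rule lipschitz_integrable[OF prob_stationary sets_stationary integrable_norm_stationary
          N_lipschitz_on[OF N_lipschitz_transition_power[OF K]]])
  have "(\<integral>z. (transition ^^ k) \<phi> z \<partial>stationary) = (\<integral>z. \<phi> z \<partial>stationary)" for k
  proof (induction k)
    case (Suc k)
    then show ?case
      using integral_transition[OF invariant_stationary N_lipschitz_measurable[OF N_lipschitz_transition_power[OF K, of k]] i[of k]]
      by simp
  qed simp
  then show ?thesis unfolding future_def using i by (simp)
qed

text \<open>The last noise is integrated out first. Each time \<open>j\<close> drops by one and the
  horizon \<open>m\<close> grows by one, hence the generalisation over \<open>m\<close>; the case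
  used is \<open>m = 0\<close>. Every noise contributes one factor, and a function of
  \<open>Z 0\<close> remains.\<close>

lemma chain_exp_moment:
  assumes mc: "markov_chain M \<mu>0 kernel Z"
  shows "(\<integral>\<^sup>+\<omega>. ennreal (exp (t * ((\<Sum>k=1..j. \<phi> (Z k \<omega>)) + future \<phi> m (Z j \<omega>)))) \<partial>M)
    \<le> ennreal (exp (real j * (t\<^sup>2 * (l / (a * (1 - r)))\<^sup>2 / 2))) * (\<integral>\<^sup>+\<omega>. ennreal (exp (t * future \<phi> (j + m) (Z 0 \<omega>))) \<partial>M)"
proof (induction j arbitrary: m)
  case 0
  then show ?case by simp
next
  case (Suc j)
  from mc have Z [measurable]: "\<And>k. Z k \<in> borel_measurable M" by (auto simp: markov_chain_def)
  let ?c = "t\<^sup>2 * (l / (a * (1 - r)))\<^sup>2 / 2"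
  have m\<phi> [measurable]: "\<phi> \<in> borel_measurable borel"
    by (rule borel_measurable_continuous_onI[OF lipschitz_on_continuous_on[OF \<phi>]])
  note mf [measurable] = N_lipschitz_measurable[OF N_lipschitz_future]
  \<comment> \<open>The factor that is already determined at time \<open>j\<close>.\<close>
  define W where "W \<omega> = ennreal (exp (t * (\<Sum>k=1..j. \<phi> (Z k \<omega>))))" for \<omega>
  have W: "W \<in> borel_measurable (history M Z j)"
  proof -
    have "(\<lambda>\<omega>. \<phi> (Z k \<omega>)) \<in> borel_measurable (history M Z j)" if "k \<in> {1..j}" for k
      by (rule measurable_compose[OF measurable_history m\<phi>]) (use that in simp)
    then have "(\<lambda>\<omega>. \<Sum>k=1..j. \<phi> (Z k \<omega>)) \<in> borel_measurable (history M Z j)"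
      by (rule borel_measurable_sum)
    then show ?thesis unfolding W_def by measurable
  qed
  have Wm [measurable]: "W \<in> borel_measurable M" unfolding W_def by measurable
  have "(\<integral>\<^sup>+\<omega>. ennreal (exp (t * ((\<Sum>k=1..Suc j. \<phi> (Z k \<omega>)) + future \<phi> m (Z (Suc j) \<omega>)))) \<partial>M)
      = (\<integral>\<^sup>+\<omega>. W \<omega> * ennreal (exp (t * (\<phi> (Z (Suc j) \<omega>) + future \<phi> m (Z (Suc j) \<omega>)))) \<partial>M)"
    unfolding W_def by (intro nn_integral_cong) (simp add: ennreal_mult[symmetric] exp_add[symmetric] algebra_simps)
  also have "\<dots> = (\<integral>\<^sup>+\<omega>. W \<omega> * (\<integral>\<^sup>+y. ennreal (exp (t * (\<phi> y + future \<phi> m y))) \<partial>kernel (Z j \<omega>)) \<partial>M)"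
    by (rule markov_chain_nn_integral[OF mc kernel_measurable prob_kernel W, where f = "\<lambda>y. ennreal (exp (t * (\<phi> y + future \<phi> m y)))"])
      measurable
  also have "\<dots> \<le> (\<integral>\<^sup>+\<omega>. ennreal (exp ?c) * ennreal (exp (t * ((\<Sum>k=1..j. \<phi> (Z k \<omega>)) + future \<phi> (Suc m) (Z j \<omega>)))) \<partial>M)"
  proof (rule nn_integral_mono)
    fix \<omega>
    have "W \<omega> * (\<integral>\<^sup>+y. ennreal (exp (t * (\<phi> y + future \<phi> m y))) \<partial>kernel (Z j \<omega>))
      \<le> W \<omega> * ennreal (exp (t * future \<phi> (Suc m) (Z j \<omega>) + ?c))"
      using kernel_exp_moment[OF N_lipschitz_total[of m], where t = t and z = "Z j \<omega>"]
      by (intro mult_left_mono) (simp_all add: transition_total)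
    also have "\<dots> = ennreal (exp ?c) * ennreal (exp (t * ((\<Sum>k=1..j. \<phi> (Z k \<omega>)) + future \<phi> (Suc m) (Z j \<omega>))))"
      unfolding W_def by (simp add: ennreal_mult[symmetric] exp_add[symmetric] algebra_simps)
    finally show "W \<omega> * (\<integral>\<^sup>+y. ennreal (exp (t * (\<phi> y + future \<phi> m y))) \<partial>kernel (Z j \<omega>))
      \<le> ennreal (exp ?c) * ennreal (exp (t * ((\<Sum>k=1..j. \<phi> (Z k \<omega>)) + future \<phi> (Suc m) (Z j \<omega>))))" .
  qed
  also have "\<dots> = ennreal (exp ?c) * (\<integral>\<^sup>+\<omega>. ennreal (exp (t * ((\<Sum>k=1..j. \<phi> (Z k \<omega>)) + future \<phi> (Suc m) (Z j \<omega>)))) \<partial>M)"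
    by (rule nn_integral_cmult) measurable
  also have "\<dots> \<le> ennreal (exp ?c) * (ennreal (exp (real j * ?c)) * (\<integral>\<^sup>+\<omega>. ennreal (exp (t * future \<phi> (j + Suc m) (Z 0 \<omega>))) \<partial>M))"
    by (intro mult_left_mono Suc) simp
  also have "\<dots> = ennreal (exp (real (Suc j) * ?c)) * (\<integral>\<^sup>+\<omega>. ennreal (exp (t * future \<phi> (Suc j + m) (Z 0 \<omega>))) \<partial>M)"
  proof -
    have "exp c * exp (real j * c) = exp (real (Suc j) * c)" for c :: real
      unfolding exp_add[symmetric] by (simp add: distrib_right)
    then have "ennreal (exp c) * ennreal (exp (real j * c)) = ennreal (exp (real (Suc j) * c))" for c :: real
      by (metis ennreal_mult exp_ge_zero)
    then show ?thesis unfolding mult.assoc[symmetric] by (simp only: add_Suc_shift)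
  qed
  finally show ?case .
qed

text \<open>Exponential Markov inequality, with \<open>\<sigma>\<close> selecting the tail. The
  centre is the mean of the sum under the actual initial law, so the bias against the stationary
  mean does not occur yet.\<close>

lemma chain_tail:
  assumes mc: "markov_chain M \<mu>0 kernel Z" and ls: "log_sobolev \<mu>0 C" and C: "0 < C" and i: "integrable \<mu>0 norm"
    and D: "b / (a * (1 - r)) \<le> D" and V: "real n * (l / (a * (1 - r)))\<^sup>2 / 2 + C * D\<^sup>2 / 4 \<le> V" "0 < V"
    and s: "0 \<le> s" and sgn: "\<bar>\<sigma>\<bar> = (1 :: real)"
  shows "measure M {\<omega> \<in> space M. s \<le> \<sigma> * ((\<Sum>k=1..n. \<phi> (Z k \<omega>)) - (\<integral>z. future \<phi> n z \<partial>\<mu>0))} \<le> exp (- s\<^sup>2 / (4 * V))"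
proof -
  from mc have "prob_space M" and Z [measurable]: "\<And>k. Z k \<in> borel_measurable M" and Z0: "distr M borel (Z 0) = \<mu>0"
    by (auto simp: markov_chain_def)
  interpret prob_space M by fact
  have [measurable]: "\<phi> \<in> borel_measurable borel"
    by (rule borel_measurable_continuous_onI[OF lipschitz_on_continuous_on[OF \<phi>]])
  note mf [measurable] = N_lipschitz_measurable[OF N_lipschitz_future]
  from ls have ps0: "prob_space \<mu>0" "sets \<mu>0 = sets borel" by (auto simp: log_sobolev_def)
  have fut: "(b / (a * (1 - r)))-lipschitz_on UNIV (future \<phi> n)"
    using N_lipschitz_on[OF N_lipschitz_future[of n]] by simp
  have futD: "D-lipschitz_on UNIV (future \<phi> n)" by (rule lipschitz_on_le[OF fut D])
  have if0: "integrable \<mu>0 (future \<phi> n)" by (rule lipschitz_integrable[OF ps0 i futD])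
  define e where "e = (\<integral>z. future \<phi> n z \<partial>\<mu>0)"
  define S where "S \<omega> = (\<Sum>k=1..n. \<phi> (Z k \<omega>))" for \<omega>
  have [measurable]: "S \<in> borel_measurable M" unfolding S_def by measurable
  \<comment> \<open>The minimiser of \<open>x^2 * V - x * s\<close>.\<close>
  define x where "x = s / (2 * V)"
  have x: "0 \<le> x" using s V by (simp add: x_def)
  define t where "t = \<sigma> * x"
  have t2: "t\<^sup>2 = x\<^sup>2" using sgn by (simp add: t_def power_mult_distrib) (metis abs_square_eq_1 mult_1 power2_abs one_power2)
  have mom: "(\<integral>\<^sup>+\<omega>. ennreal (exp (t * S \<omega>)) \<partial>M) \<le> ennreal (exp (t * e + x\<^sup>2 * V))"
  proof -
    let ?c = "t\<^sup>2 * (l / (a * (1 - r)))\<^sup>2 / 2"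
    have lipt: "(\<bar>t\<bar> * D)-lipschitz_on UNIV (\<lambda>z. t * future \<phi> n z)"
      by (rule lipschitz_on_cmult_real[OF futD])
    have "(\<integral>\<^sup>+\<omega>. ennreal (exp (t * S \<omega>)) \<partial>M) \<le> ennreal (exp (real n * ?c)) * (\<integral>\<^sup>+\<omega>. ennreal (exp (t * future \<phi> n (Z 0 \<omega>))) \<partial>M)"
      using chain_exp_moment[OF mc, where t = t and j = n and m = 0] by (simp add: S_def future_def[of \<phi> 0])
    also have "(\<integral>\<^sup>+\<omega>. ennreal (exp (t * future \<phi> n (Z 0 \<omega>))) \<partial>M) = (\<integral>\<^sup>+z. ennreal (exp (t * future \<phi> n z)) \<partial>\<mu>0)"
      unfolding Z0[symmetric] by (rule nn_integral_distr[symmetric]) measurable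
    also have "\<dots> \<le> ennreal (exp ((\<integral>z. t * future \<phi> n z \<partial>\<mu>0) + C * (\<bar>t\<bar> * D)\<^sup>2 / 4))"
      by (rule log_sobolev_exp_moment[OF ls _ lipt]) (use C if0 in auto)
    finally have "(\<integral>\<^sup>+\<omega>. ennreal (exp (t * S \<omega>)) \<partial>M)
        \<le> ennreal (exp (real n * ?c)) * ennreal (exp ((\<integral>z. t * future \<phi> n z \<partial>\<mu>0) + C * (\<bar>t\<bar> * D)\<^sup>2 / 4))"
      by (simp add: mult_left_mono)
    also have "\<dots> = ennreal (exp (t * e + t\<^sup>2 * (real n * (l / (a * (1 - r)))\<^sup>2 / 2 + C * D\<^sup>2 / 4)))"
      by (simp add: ennreal_mult[symmetric] exp_add[symmetric] e_def power_mult_distrib algebra_simps)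
    also have "\<dots> \<le> ennreal (exp (t * e + t\<^sup>2 * V))"
      using V(1) by (intro ennreal_leI) (simp add: mult_left_mono)
    finally show ?thesis by (simp add: t2)
  qed
  have "emeasure M {\<omega> \<in> space M. s \<le> \<sigma> * (S \<omega> - e)} \<le> emeasure M {\<omega> \<in> space M. 1 \<le> ennreal (exp (- (x * s + t * e))) * ennreal (exp (t * S \<omega>))}"
  proof (intro emeasure_mono Collect_mono impI conjI)
    fix \<omega> assume \<omega>: "\<omega> \<in> space M \<and> s \<le> \<sigma> * (S \<omega> - e)"
    then show "\<omega> \<in> space M" by simp
    have "x * s \<le> x * (\<sigma> * (S \<omega> - e))" using \<omega> x by (intro mult_left_mono) auto
    then have "0 \<le> - (x * s + t * e) + t * S \<omega>" by (simp add: t_def algebra_simps)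
    then have "1 \<le> exp (- (x * s + t * e) + t * S \<omega>)" by simp
    then show "1 \<le> ennreal (exp (- (x * s + t * e))) * ennreal (exp (t * S \<omega>))"
      by (simp add: ennreal_mult[symmetric] exp_add[symmetric] ennreal_1[symmetric] del: ennreal_1)
  qed measurable
  also have "\<dots> \<le> ennreal (exp (- (x * s + t * e))) * (\<integral>\<^sup>+\<omega>. ennreal (exp (t * S \<omega>)) * indicator (space M) \<omega> \<partial>M)"
    by (rule nn_integral_Markov_inequality) simp_all
  also have "\<dots> = ennreal (exp (- (x * s + t * e))) * (\<integral>\<^sup>+\<omega>. ennreal (exp (t * S \<omega>)) \<partial>M)"
    by (rule arg_cong2[where f = "(*)"], rule refl, rule nn_integral_cong) simp
  also have "\<dots> \<le> ennreal (exp (- (x * s + t * e))) * ennreal (exp (t * e + x\<^sup>2 * V))"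
    by (intro mult_left_mono mom) simp
  also have "\<dots> = ennreal (exp (x\<^sup>2 * V - x * s))"
    by (simp add: ennreal_mult[symmetric] exp_add[symmetric])
  also have "x\<^sup>2 * V - x * s = - s\<^sup>2 / (4 * V)"
    using V(2) by (simp add: x_def field_simps power2_eq_square)
  finally show ?thesis unfolding S_def e_def by (simp add: emeasure_eq_measure)
qed

text \<open>The mean of \<open>future \<phi> n\<close> is the mean of the sum under
  \<open>\<mu>0\<close>, and \<open>n\<close> times the stationary mean of \<open>\<phi>\<close>
  under \<open>stationary\<close>. As \<open>future \<phi> n\<close> is \<open>D\<close>-Lipschitz,
  replacing one centre by the other costs at most \<open>D\<close> times the Wasserstein distance;
  the two tails give the factor 2.\<close>

theorem chain_concentration:
  assumes mc: "markov_chain M \<mu>0 kernel Z" and ls: "log_sobolev \<mu>0 C" and C: "0 < C"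
    and D: "b / (a * (1 - r)) \<le> D" and V: "real n * (l / (a * (1 - r)))\<^sup>2 / 2 + C * D\<^sup>2 / 4 \<le> V"
    and n: "1 \<le> n" and u: "0 \<le> u"
  shows "measure M {\<omega> \<in> space M. ennreal u + ennreal (D / real n) * wasserstein1 \<mu>0 stationary
      \<le> ennreal \<bar>(1 / real n) * (\<Sum>k=1..n. \<phi> (Z k \<omega>)) - (\<integral>z. \<phi> z \<partial>stationary)\<bar>}
    \<le> 2 * exp (- (real n * u)\<^sup>2 / (4 * V))"
proof -
  from mc have "prob_space M" and Z [measurable]: "\<And>k. Z k \<in> borel_measurable M"
    by (auto simp: markov_chain_def)
  interpret prob_space M by fact
  have [measurable]: "\<phi> \<in> borel_measurable borel"
    by (rule borel_measurable_continuous_onI[OF lipschitz_on_continuous_on[OF \<phi>]])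
  have D0: "0 < D" using D b_pos a_pos r by (smt (verit) divide_pos_pos mult_pos_pos)
  have V0: "0 < V"
  proof -
    have "0 < C * D\<^sup>2 / 4" using C D0 by simp
    moreover have "0 \<le> real n * (l / (a * (1 - r)))\<^sup>2 / 2" by simp
    ultimately show ?thesis using V by linarith
  qed
  let ?E = "{\<omega> \<in> space M. ennreal u + ennreal (D / real n) * wasserstein1 \<mu>0 stationary
      \<le> ennreal \<bar>(1 / real n) * (\<Sum>k=1..n. \<phi> (Z k \<omega>)) - (\<integral>z. \<phi> z \<partial>stationary)\<bar>}"
  show ?thesis
  proof (cases "wasserstein1 \<mu>0 stationary = \<infinity>")
    \<comment> \<open>An infinite distance makes the threshold infinite, so the event is
      empty.\<close>
    case True
    then have E: "?E = {}" using D0 n by (auto simp: ennreal_mult_top top_unique)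
    show ?thesis unfolding E by simp
  next
    case False
    then obtain w where w: "wasserstein1 \<mu>0 stationary = ennreal w" "0 \<le> w"
      by (cases "wasserstein1 \<mu>0 stationary") auto
    have i: "integrable \<mu>0 norm"
      by (rule integrable_norm_if_wasserstein1_finite[OF _ integrable_norm_stationary]) (use w in simp)
    from ls have ps0: "prob_space \<mu>0" "sets \<mu>0 = sets borel" by (auto simp: log_sobolev_def)
    have futD: "D-lipschitz_on UNIV (future \<phi> n)"
      by (rule lipschitz_on_le[OF N_lipschitz_on[OF N_lipschitz_future[of n]]]) (use D in simp)
    define e where "e = (\<integral>z. future \<phi> n z \<partial>\<mu>0)"
    define p where "p = (\<integral>z. \<phi> z \<partial>stationary)"
    define S where "S \<omega> = (\<Sum>k=1..n. \<phi> (Z k \<omega>))" for \<omega>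
    have [measurable]: "S \<in> borel_measurable M" unfolding S_def by measurable
    have "ennreal \<bar>e - real n * p\<bar> \<le> ennreal (D * w)"
      using wasserstein1_bound[OF futD D0 lipschitz_integrable[OF ps0 i futD]
          lipschitz_integrable[OF prob_stationary sets_stationary integrable_norm_stationary futD]] w D0
      by (simp add: e_def p_def integral_future ennreal_mult)
    then have ew: "\<bar>e - real n * p\<bar> \<le> D * w" using w D0 by (simp add: ennreal_le_iff)
    have "?E \<subseteq> {\<omega> \<in> space M. real n * u \<le> 1 * (S \<omega> - e)} \<union> {\<omega> \<in> space M. real n * u \<le> (- 1) * (S \<omega> - e)}"
    proof
      fix \<omega> assume "\<omega> \<in> ?E"
      then have \<omega>: "\<omega> \<in> space M" and "ennreal u + ennreal (D / real n) * ennreal w \<le> ennreal \<bar>1 / real n * S \<omega> - p\<bar>"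
        by (auto simp: w S_def p_def)
      then have "ennreal (u + D / real n * w) \<le> ennreal \<bar>1 / real n * S \<omega> - p\<bar>"
        using u D0 w by (simp add: ennreal_plus ennreal_mult[symmetric])
      then have "u + D / real n * w \<le> \<bar>1 / real n * S \<omega> - p\<bar>"
        by (simp add: ennreal_le_iff)
      then have "real n * (u + D / real n * w) \<le> real n * \<bar>1 / real n * S \<omega> - p\<bar>"
        by (rule mult_left_mono) simp
      also have "\<dots> = \<bar>real n * (1 / real n * S \<omega> - p)\<bar>" by (simp only: abs_mult abs_of_nat)
      also have "real n * (1 / real n * S \<omega> - p) = S \<omega> - real n * p" using n by (simp add: right_diff_distrib)
      also have "real n * (u + D / real n * w) = real n * u + D * w" using n by (simp add: distrib_left)
      finally have "real n * u \<le> \<bar>S \<omega> - e\<bar>" using ew by linarith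
      then show "\<omega> \<in> {\<omega> \<in> space M. real n * u \<le> 1 * (S \<omega> - e)} \<union> {\<omega> \<in> space M. real n * u \<le> (- 1) * (S \<omega> - e)}"
        using \<omega> by (auto simp: abs_if split: if_splits)
    qed
    then have "measure M ?E \<le> measure M ({\<omega> \<in> space M. real n * u \<le> 1 * (S \<omega> - e)} \<union> {\<omega> \<in> space M. real n * u \<le> (- 1) * (S \<omega> - e)})"
      by (intro finite_measure_mono) measurable
    also have "\<dots> \<le> measure M {\<omega> \<in> space M. real n * u \<le> 1 * (S \<omega> - e)} + measure M {\<omega> \<in> space M. real n * u \<le> (- 1) * (S \<omega> - e)}"
      by (intro measure_Un_le) measurable
    also have "\<dots> \<le> exp (- (real n * u)\<^sup>2 / (4 * V)) + exp (- (real n * u)\<^sup>2 / (4 * V))"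
      unfolding S_def e_def by (intro add_mono chain_tail[OF mc ls C i D V V0]) (use u in auto)
    finally show ?thesis by simp
  qed
qed

end

end

section \<open>The OBABO chain\<close>

lemma log_sobolev_mono:
  assumes "log_sobolev \<nu> C" "C \<le> C'"
  shows "log_sobolev \<nu> C'"
proof -
  have "C * (\<integral>z. (slope \<phi> z)\<^sup>2 \<partial>\<nu>) \<le> C' * (\<integral>z. (slope \<phi> z)\<^sup>2 \<partial>\<nu>)" for \<phi> :: "'a \<Rightarrow> real"
    by (intro mult_right_mono assms(2) integral_nonneg_AE AE_I2) simp
  then show ?thesis using assms(1) unfolding log_sobolev_def by (meson order_trans)
qed

lemma integrable_norm_gaussian_pair:
  "integrable (std_gaussian \<Otimes>\<^sub>M std_gaussian :: ('a::euclidean_space \<times> 'a) measure) norm"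
proof (rule integrableI_bounded)
  let ?G = "std_gaussian :: 'a measure"
  interpret G: prob_space ?G by (rule prob_space_std_gaussian)
  have fin: "(\<integral>\<^sup>+x. ennreal (norm x) \<partial>?G) < \<infinity>"
    using integrable_norm_std_gaussian[where 'a = 'a] by (simp add: integrable_iff_bounded)
  have "(\<integral>\<^sup>+p. ennreal (norm (norm p)) \<partial>(?G \<Otimes>\<^sub>M ?G)) \<le> (\<integral>\<^sup>+p. ennreal (norm (fst p)) + ennreal (norm (snd p)) \<partial>(?G \<Otimes>\<^sub>M ?G))"
    by (intro nn_integral_mono) (use norm_Pair_le in \<open>auto simp: ennreal_plus[symmetric] intro!: ennreal_leI simp del: ennreal_plus\<close>)
  also have "\<dots> = (\<integral>\<^sup>+x. (\<integral>\<^sup>+y. ennreal (norm x) + ennreal (norm y) \<partial>?G) \<partial>?G)"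
  proof (subst G.nn_integral_fst[symmetric])
    show "(\<lambda>p. ennreal (norm (fst p)) + ennreal (norm (snd p))) \<in> borel_measurable (?G \<Otimes>\<^sub>M ?G)"
      by measurable
  qed simp
  also have "\<dots> = (\<integral>\<^sup>+x. ennreal (norm x) \<partial>?G) + (\<integral>\<^sup>+x. ennreal (norm x) \<partial>?G)"
    using G.emeasure_space_1 by (simp add: nn_integral_add)
  also have "\<dots> < \<infinity>" using fin by simp
  finally show "(\<integral>\<^sup>+p. ennreal (norm (norm p)) \<partial>(?G \<Otimes>\<^sub>M ?G)) < \<infinity>" .
  have s: "sets (?G \<Otimes>\<^sub>M ?G) = sets borel"
    by (simp only: sets_pair_measure_cong[OF sets_std_gaussian sets_std_gaussian] borel_prod)
  show "norm \<in> borel_measurable (?G \<Otimes>\<^sub>M ?G)" unfolding measurable_cong_sets[OF s refl] by measurable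
qed

locale obabo =
  fixes U :: "'a::euclidean_space \<Rightarrow> real" and m L \<gamma> \<delta> :: real
  assumes C2: "C2_function U"
    and m_pos: "0 < m" and m_le_L: "m \<le> L"
    and lipschitz_grad: "\<And>x y. norm (grad U x - grad U y) \<le> L * norm (x - y)"
    and strongly_convex: "\<And>x y. inner (x - y) (grad U x - grad U y) \<ge> m * (norm (x - y))\<^sup>2"
    and gamma: "\<gamma> \<ge> 2 * sqrt L"
    and delta_pos: "0 < \<delta>" and delta_le: "\<delta> \<le> m / (33 * \<gamma> ^ 3)"
begin

definition step :: "('a \<times> 'a) \<times> ('a \<times> 'a) \<Rightarrow> 'a \<times> 'a" where
  "step p = obabo_step \<delta> \<gamma> U (fst p) (snd p)"

text \<open>The square root of \<open>|x|^2 + (2 / \<gamma>) x \<bullet> v + |v|^2 / L\<close> after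
  completing the square. Written as the norm of a linear image of \<open>z\<close>, it is visibly
  subadditive; the inner root makes sense because \<open>L \<le> \<gamma>^2\<close>.\<close>

definition twisted_norm :: "'a \<times> 'a \<Rightarrow> real" where
  "twisted_norm z = norm (fst z + (1 / \<gamma>) *\<^sub>R snd z, sqrt (1 / L - 1 / \<gamma>\<^sup>2) *\<^sub>R snd z)"

definition contraction_factor :: real where
  "contraction_factor = sqrt (1 - m * \<delta> / (2 * \<gamma>))"

text \<open>The two Gaussians together move the velocity by at most about
  \<open>sqrt 2 * sqrt (\<delta> * \<gamma>)\<close> per unit of noise, and velocities are divided
  by \<open>sqrt L\<close>. \<open>21 / 10\<close> is 2 with room for the effect on the position and
  on the second gradient.\<close>

definition noise_size :: real where
  "noise_size = sqrt (21 / 10 * (\<delta> * \<gamma> / L))"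

definition lower_const :: real where
  "lower_const = sqrt (min 1 (1 / L) / 2)"

definition upper_const :: real where
  "upper_const = sqrt (3 / 2 * max 1 (1 / L))"

lemma L_pos: "0 < L" using m_pos m_le_L by simp

lemma sqrt_L: "0 < sqrt L" "sqrt L * sqrt L = L" "(sqrt L)\<^sup>2 = L"
  using L_pos by auto

lemma gamma_pos: "0 < \<gamma>" using gamma sqrt_L by linarith

lemma gamma_sq: "4 * L \<le> \<gamma>\<^sup>2"
proof -
  have "(2 * sqrt L)\<^sup>2 \<le> \<gamma>\<^sup>2" using gamma sqrt_L by (intro power_mono) auto
  then show ?thesis using L_pos by (simp add: power_mult_distrib)
qed

lemma delta_gamma: "\<delta> * \<gamma> \<le> 1 / 132"
proof -
  have "33 * (\<delta> * \<gamma> ^ 3) \<le> m" using delta_le gamma_pos by (simp add: field_simps)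
  also have "m \<le> \<gamma>\<^sup>2 / 4" using m_le_L gamma_sq by simp
  finally have "(132 * (\<delta> * \<gamma>)) * \<gamma>\<^sup>2 \<le> 1 * \<gamma>\<^sup>2" by (simp add: power2_eq_square power3_eq_cube mult_ac)
  then have "132 * (\<delta> * \<gamma>) \<le> 1" using gamma_pos by (subst (asm) mult_le_cancel_right_pos) auto
  then show ?thesis by simp
qed

lemma delta_sqrt_L: "\<delta> * sqrt L \<le> 1 / 264"
proof -
  have "\<delta> * (2 * sqrt L) \<le> \<delta> * \<gamma>" using gamma delta_pos by (intro mult_left_mono) auto
  then show ?thesis using delta_gamma by simp
qed

lemma rate_bounds: "0 < m * \<delta> / (2 * \<gamma>)" "m * \<delta> / (2 * \<gamma>) < 1"
proof -
  show "0 < m * \<delta> / (2 * \<gamma>)" using m_pos delta_pos gamma_pos by simp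
  have "m * \<delta> \<le> \<gamma>\<^sup>2 * \<delta>" using m_le_L gamma_sq L_pos delta_pos by (intro mult_right_mono) auto
  also have "\<dots> = \<gamma> * (\<delta> * \<gamma>)" by (simp add: power2_eq_square)
  also have "\<dots> \<le> \<gamma> * 1" using delta_gamma gamma_pos by (intro mult_left_mono) auto
  finally show "m * \<delta> / (2 * \<gamma>) < 1" using gamma_pos by simp
qed

lemma GDERIV_U: "GDERIV U x :> grad U x"
  using C2 by (intro GDERIV_grad) (simp add: C2_function_def)

lemma cocoercive_U: "(norm (grad U x - grad U y))\<^sup>2 \<le> L * inner (x - y) (grad U x - grad U y)"
proof (rule cocoercive[OF GDERIV_U lipschitz_grad L_pos])
  show "0 \<le> inner (x - y) (grad U x - grad U y)" for x y
    using strongly_convex[of x y] m_pos by (smt (verit) mult_nonneg_nonneg zero_le_power2)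
qed

lemma twisted_norm_sq:
  "(twisted_norm z)\<^sup>2 = (norm (fst z))\<^sup>2 + 2 / \<gamma> * inner (fst z) (snd z) + (norm (snd z))\<^sup>2 / L"
proof -
  let ?x = "fst z" and ?v = "snd z"
  have "1 / \<gamma>\<^sup>2 \<le> 1 / L" using gamma_sq L_pos by (intro divide_left_mono) (use gamma_pos in auto)
  then have c: "0 \<le> 1 / L - 1 / \<gamma>\<^sup>2" by simp
  have "(twisted_norm z)\<^sup>2 = (norm (?x + (1 / \<gamma>) *\<^sub>R ?v))\<^sup>2 + (norm (sqrt (1 / L - 1 / \<gamma>\<^sup>2) *\<^sub>R ?v))\<^sup>2"
    by (simp add: twisted_norm_def norm_Pair)
  also have "(norm (sqrt (1 / L - 1 / \<gamma>\<^sup>2) *\<^sub>R ?v))\<^sup>2 = (1 / L - 1 / \<gamma>\<^sup>2) * (norm ?v)\<^sup>2"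
    using c by (simp add: power_mult_distrib)
  also have "(norm (?x + (1 / \<gamma>) *\<^sub>R ?v))\<^sup>2 = (norm ?x)\<^sup>2 + 2 / \<gamma> * inner ?x ?v + 1 / \<gamma>\<^sup>2 * (norm ?v)\<^sup>2"
    by (simp add: power2_norm_eq_inner inner_add_left inner_add_right inner_commute[of ?v ?x])
      (simp add: power2_eq_square add_divide_distrib)
  finally show ?thesis by (simp add: algebra_simps)
qed

text \<open>The lower bound on the friction enters the geometry here: the cross term is at most half
  of the diagonal part, whence the factors 1/2 and 3/2 in
  \<open>twisted_norm_bounds\<close>.\<close>

lemma cross_term: "\<bar>2 / \<gamma> * inner x v\<bar> \<le> norm x * (norm v / sqrt L)"
proof -
  have "2 / \<gamma> \<le> 2 / (2 * sqrt L)" by (intro divide_left_mono mult_pos_pos gamma gamma_pos sqrt_L(1)) auto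
  then have "2 / \<gamma> \<le> 1 / sqrt L" by simp
  then have "2 / \<gamma> * \<bar>inner x v\<bar> \<le> 1 / sqrt L * (norm x * norm v)"
    using gamma_pos sqrt_L by (intro mult_mono Cauchy_Schwarz_ineq2) auto
  then show ?thesis using gamma_pos by (simp add: abs_mult)
qed

lemma twisted_norm_bounds:
  "((norm (fst z))\<^sup>2 + (norm (snd z))\<^sup>2 / L) / 2 \<le> (twisted_norm z)\<^sup>2"
  "(twisted_norm z)\<^sup>2 \<le> 3 / 2 * ((norm (fst z))\<^sup>2 + (norm (snd z))\<^sup>2 / L)"
proof -
  let ?p = "norm (fst z)" and ?q = "norm (snd z) / sqrt L"
  have q2: "(norm (snd z))\<^sup>2 / L = ?q\<^sup>2" using L_pos by (simp add: power_divide)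
  have half: "(p + q) / 2 \<le> p + c + q \<and> p + c + q \<le> 3 / 2 * (p + q)" if "\<bar>c\<bar> \<le> (p + q) / 2" for p q c :: real
    using that by argo
  have "p * q \<le> (p\<^sup>2 + q\<^sup>2) / 2" for p q :: real using sum_squares_bound[of p q] by simp
  then have "?p * ?q \<le> (?p\<^sup>2 + ?q\<^sup>2) / 2" .
  then have "\<bar>2 / \<gamma> * inner (fst z) (snd z)\<bar> \<le> (?p\<^sup>2 + ?q\<^sup>2) / 2" using cross_term by (rule order_trans[rotated])
  from half[OF this]
  show "((norm (fst z))\<^sup>2 + (norm (snd z))\<^sup>2 / L) / 2 \<le> (twisted_norm z)\<^sup>2"
    "(twisted_norm z)\<^sup>2 \<le> 3 / 2 * ((norm (fst z))\<^sup>2 + (norm (snd z))\<^sup>2 / L)"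
    unfolding twisted_norm_sq q2 by blast+
qed

lemma twisted_norm_lower: "lower_const * norm z \<le> twisted_norm z"
proof (rule power2_le_imp_le)
  have "min 1 (1 / L) * (norm (fst z))\<^sup>2 \<le> 1 * (norm (fst z))\<^sup>2"
    "min 1 (1 / L) * (norm (snd z))\<^sup>2 \<le> 1 / L * (norm (snd z))\<^sup>2" by (intro mult_right_mono; simp)+
  then have "min 1 (1 / L) / 2 * ((norm (fst z))\<^sup>2 + (norm (snd z))\<^sup>2) \<le> (twisted_norm z)\<^sup>2"
    using twisted_norm_bounds(1)[of z] by (simp add: distrib_left)
  then show "(lower_const * norm z)\<^sup>2 \<le> (twisted_norm z)\<^sup>2"
    using L_pos by (simp add: lower_const_def power_mult_distrib norm_prod_def)
qed (simp add: twisted_norm_def)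

lemma twisted_norm_upper: "twisted_norm z \<le> upper_const * norm z"
proof (rule power2_le_imp_le)
  have "1 * (norm (fst z))\<^sup>2 \<le> max 1 (1 / L) * (norm (fst z))\<^sup>2"
    "1 / L * (norm (snd z))\<^sup>2 \<le> max 1 (1 / L) * (norm (snd z))\<^sup>2" by (intro mult_right_mono; simp)+
  then have "(twisted_norm z)\<^sup>2 \<le> 3 / 2 * max 1 (1 / L) * ((norm (fst z))\<^sup>2 + (norm (snd z))\<^sup>2)"
    using twisted_norm_bounds(2)[of z] by (simp add: distrib_left)
  then show "(twisted_norm z)\<^sup>2 \<le> (upper_const * norm z)\<^sup>2"
    using L_pos by (simp add: upper_const_def power_mult_distrib norm_prod_def)
  show "0 \<le> upper_const * norm z" using L_pos by (simp add: upper_const_def)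
qed

text \<open>The shared Gaussian terms cancel in the difference of the two steps. Dividing velocities
  by \<open>sqrt L\<close> turns \<open>m\<close>, \<open>\<delta>\<close>, \<open>\<gamma>\<close>
  into \<open>m / L\<close>, \<open>\<delta> * sqrt L\<close>, \<open>\<gamma> / sqrt L\<close>; the
  product \<open>\<delta> * \<gamma>\<close>, and with it \<open>\<eta>\<close>, is unchanged, and
  \<open>contraction_scaled\<close> applies.\<close>

lemma step_contract: "twisted_norm (step (z', g) - step (z, g)) \<le> contraction_factor * twisted_norm (z' - z)"
proof (rule power2_le_imp_le)
  obtain x v x' v' g1 g2 where z: "z = (x, v)" "z' = (x', v')" "g = (g1, g2)" by (metis surj_pair)
  define \<eta> where "\<eta> = exp (- \<delta> * \<gamma> / 2)"
  define s where "s = sqrt L"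
  have s: "0 < s" "s * s = L" "s\<^sup>2 = L" using sqrt_L by (auto simp: s_def)
  define X where "X = x' - x"
  define V where "V = v' - v"
  define G0 where "G0 = grad U x' - grad U x"
  define y' where "y' = fst (step (z', g))"
  define y where "y = fst (step (z, g))"
  define G1 where "G1 = grad U y' - grad U y"
  have y': "y' = x' + \<delta> *\<^sub>R (\<eta> *\<^sub>R v' + sqrt (1 - \<eta>\<^sup>2) *\<^sub>R g1) - (\<delta>\<^sup>2 / 2) *\<^sub>R grad U x'"
    and y: "y = x + \<delta> *\<^sub>R (\<eta> *\<^sub>R v + sqrt (1 - \<eta>\<^sup>2) *\<^sub>R g1) - (\<delta>\<^sup>2 / 2) *\<^sub>R grad U x"
    unfolding y'_def y_def by (simp_all add: step_def obabo_step_def z Let_def \<eta>_def)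
  have w': "snd (step (z', g)) = \<eta>\<^sup>2 *\<^sub>R v' - (\<delta> * \<eta> / 2) *\<^sub>R (grad U x' + grad U y') + sqrt (1 - \<eta>\<^sup>2) *\<^sub>R (\<eta> *\<^sub>R g1 + g2)"
    and w: "snd (step (z, g)) = \<eta>\<^sup>2 *\<^sub>R v - (\<delta> * \<eta> / 2) *\<^sub>R (grad U x + grad U y) + sqrt (1 - \<eta>\<^sup>2) *\<^sub>R (\<eta> *\<^sub>R g1 + g2)"
    unfolding y y' by (simp_all add: step_def obabo_step_def z Let_def \<eta>_def)
  define Y where "Y = y' - y"
  define W where "W = snd (step (z', g)) - snd (step (z, g))"
  have Y: "Y = X + (\<delta> * \<eta>) *\<^sub>R V - (\<delta>\<^sup>2 / 2) *\<^sub>R G0"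
    by (simp add: Y_def y y' X_def V_def G0_def algebra_simps)
  have W: "W = \<eta>\<^sup>2 *\<^sub>R V - (\<delta> * \<eta> / 2) *\<^sub>R (G0 + G1)"
    by (simp add: W_def w w' V_def G0_def G1_def algebra_simps)
  have G0: "m * (norm X)\<^sup>2 \<le> inner X G0" "(norm G0)\<^sup>2 \<le> L * inner X G0"
    using strongly_convex[of x' x] cocoercive_U[of x' x] by (auto simp: X_def G0_def)
  have G1: "m * (norm Y)\<^sup>2 \<le> inner Y G1" "(norm G1)\<^sup>2 \<le> L * inner Y G1"
    using strongly_convex[of y' y] cocoercive_U[of y' y] by (auto simp: Y_def G1_def)
  have "(norm Y)\<^sup>2 + 2 / (\<gamma> / s) * inner Y ((1 / s) *\<^sub>R W) + (norm ((1 / s) *\<^sub>R W))\<^sup>2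
    \<le> (1 - m / L * (\<delta> * s) / (2 * (\<gamma> / s))) * ((norm X)\<^sup>2 + 2 / (\<gamma> / s) * inner X ((1 / s) *\<^sub>R V) + (norm ((1 / s) *\<^sub>R V))\<^sup>2)"
  proof (rule contraction_scaled[where e = \<eta> and ?g0.0 = "(1 / L) *\<^sub>R G0" and ?g1.0 = "(1 / L) *\<^sub>R G1"])
    show "2 \<le> \<gamma> / s" using gamma s by (simp add: s_def field_simps)
    show "0 < \<delta> * s" using delta_pos s by simp
    have "\<delta> * s \<le> m / (33 * \<gamma> ^ 3) * s" using delta_le s by (intro mult_right_mono) auto
    also have "\<dots> = m / (s * s) / (33 * (\<gamma> / s) ^ 3)"
      using s(1) gamma_pos by (simp add: field_simps power3_eq_cube)
    finally show "\<delta> * s \<le> m / L / (33 * (\<gamma> / s) ^ 3)" by (simp add: s)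
    show "0 < m / L" "m / L \<le> 1" using m_pos m_le_L L_pos by auto
    show "\<eta> = exp (- (\<delta> * s) * (\<gamma> / s) / 2)" using s by (simp add: \<eta>_def)
    show "Y = X + (\<delta> * s * \<eta>) *\<^sub>R (1 / s) *\<^sub>R V - ((\<delta> * s)\<^sup>2 / 2) *\<^sub>R (1 / L) *\<^sub>R G0"
      unfolding Y using s L_pos by (simp add: power_mult_distrib)
    have c: "1 / s * (\<delta> * \<eta> / 2) = \<delta> * s * \<eta> / 2 * (1 / L)" unfolding s(2)[symmetric] using s(1) by simp
    show "(1 / s) *\<^sub>R W = \<eta>\<^sup>2 *\<^sub>R (1 / s) *\<^sub>R V - (\<delta> * s * \<eta> / 2) *\<^sub>R ((1 / L) *\<^sub>R G0 + (1 / L) *\<^sub>R G1)"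
      by (simp only: W scaleR_diff_right scaleR_add_right[symmetric] scaleR_scaleR c mult.commute[of "1 / s" "\<eta>\<^sup>2"])
    show "m / L * (norm X)\<^sup>2 \<le> inner X ((1 / L) *\<^sub>R G0)" "m / L * (norm Y)\<^sup>2 \<le> inner Y ((1 / L) *\<^sub>R G1)"
      using G0(1) G1(1) L_pos by (simp_all add: field_simps)
    show "(norm ((1 / L) *\<^sub>R G0))\<^sup>2 \<le> inner X ((1 / L) *\<^sub>R G0)" "(norm ((1 / L) *\<^sub>R G1))\<^sup>2 \<le> inner Y ((1 / L) *\<^sub>R G1)"
      using divide_right_mono[OF G0(2), of "L\<^sup>2"] divide_right_mono[OF G1(2), of "L\<^sup>2"] L_pos
      by (simp_all add: power_divide power2_eq_square)
  qed
  moreover have "2 / (\<gamma> / s) * inner A ((1 / s) *\<^sub>R B) = 2 / \<gamma> * inner A B" "(norm ((1 / s) *\<^sub>R B))\<^sup>2 = (norm B)\<^sup>2 / L" for A B :: 'a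
    using s by (simp_all add: power_divide)
  moreover have "m / L * (\<delta> * s) / (2 * (\<gamma> / s)) = m * \<delta> / (2 * \<gamma>)"
    using s(1) unfolding s(2)[symmetric] by (simp add: field_simps)
  ultimately have "(norm Y)\<^sup>2 + 2 / \<gamma> * inner Y W + (norm W)\<^sup>2 / L
    \<le> (1 - m * \<delta> / (2 * \<gamma>)) * ((norm X)\<^sup>2 + 2 / \<gamma> * inner X V + (norm V)\<^sup>2 / L)" by (simp only:)
  moreover have "step (z', g) - step (z, g) = (Y, W)" by (simp add: Y_def W_def y_def y'_def prod_eq_iff)
  moreover have "z' - z = (X, V)" by (simp add: z X_def V_def)
  moreover have "contraction_factor\<^sup>2 = 1 - m * \<delta> / (2 * \<gamma>)" using rate_bounds by (simp add: contraction_factor_def)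
  ultimately show "(twisted_norm (step (z', g) - step (z, g)))\<^sup>2 \<le> (contraction_factor * twisted_norm (z' - z))\<^sup>2"
    by (simp add: twisted_norm_sq power_mult_distrib)
  show "0 \<le> contraction_factor * twisted_norm (z' - z)"
    using rate_bounds by (simp add: contraction_factor_def twisted_norm_def)
qed

text \<open>The noise acts mainly on the velocity: through the position and through the second
  gradient it acts only with additional factors \<open>\<delta> * sqrt L\<close>, each at most
  \<open>1 / 264\<close>.\<close>

lemma step_noise: "twisted_norm (step (z, g') - step (z, g)) \<le> noise_size * norm (g' - g)"
proof -
  obtain x v g1 g2 g1' g2' where z: "z = (x, v)" "g = (g1, g2)" "g' = (g1', g2')" by (metis surj_pair)
  define \<eta> where "\<eta> = exp (- \<delta> * \<gamma> / 2)"
  define \<sigma> where "\<sigma> = sqrt (1 - \<eta>\<^sup>2)"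
  define s where "s = sqrt L"
  have s: "0 < s" "s * s = L" "s\<^sup>2 = L" using sqrt_L by (auto simp: s_def)
  have \<eta>: "0 < \<eta>" "\<eta> \<le> 1" using delta_pos gamma_pos by (auto simp: \<eta>_def)
  have \<eta>2: "\<eta>\<^sup>2 = exp (- (\<delta> * \<gamma>))" by (simp add: \<eta>_def exp_double[symmetric])
  have \<sigma>2: "\<sigma>\<^sup>2 = 1 - \<eta>\<^sup>2" using \<eta> by (simp add: \<sigma>_def power_le_one)
  have \<sigma>: "0 \<le> \<sigma>" "\<sigma>\<^sup>2 \<le> \<delta> * \<gamma>"
    unfolding \<sigma>2 \<eta>2 using exp_ge_add_one_self[of "- (\<delta> * \<gamma>)"] \<eta> by (auto simp: \<sigma>_def power_le_one)
  define P where "P = norm (g' - g)"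
  define y' where "y' = fst (step (z, g'))"
  define y where "y = fst (step (z, g))"
  define G1 where "G1 = grad U y' - grad U y"
  have y': "y' = x + \<delta> *\<^sub>R (\<eta> *\<^sub>R v + \<sigma> *\<^sub>R g1') - (\<delta>\<^sup>2 / 2) *\<^sub>R grad U x"
    and y: "y = x + \<delta> *\<^sub>R (\<eta> *\<^sub>R v + \<sigma> *\<^sub>R g1) - (\<delta>\<^sup>2 / 2) *\<^sub>R grad U x"
    unfolding y'_def y_def by (simp_all add: step_def obabo_step_def z Let_def \<eta>_def \<sigma>_def)
  have w': "snd (step (z, g')) = \<eta>\<^sup>2 *\<^sub>R v - (\<delta> * \<eta> / 2) *\<^sub>R (grad U x + grad U y') + \<sigma> *\<^sub>R (\<eta> *\<^sub>R g1' + g2')"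
    and w: "snd (step (z, g)) = \<eta>\<^sup>2 *\<^sub>R v - (\<delta> * \<eta> / 2) *\<^sub>R (grad U x + grad U y) + \<sigma> *\<^sub>R (\<eta> *\<^sub>R g1 + g2)"
    unfolding y y' by (simp_all add: step_def obabo_step_def z Let_def \<eta>_def \<sigma>_def)
  define Y where "Y = y' - y"
  define W where "W = snd (step (z, g')) - snd (step (z, g))"
  have Y: "Y = (\<delta> * \<sigma>) *\<^sub>R (g1' - g1)" by (simp add: Y_def y y' algebra_simps)
  have W: "W = \<sigma> *\<^sub>R (\<eta> *\<^sub>R (g1' - g1) + (g2' - g2)) - (\<delta> * \<eta> / 2) *\<^sub>R G1"
    by (simp add: W_def w w' G1_def algebra_simps)
  have P2: "P\<^sup>2 = (norm (g1' - g1))\<^sup>2 + (norm (g2' - g2))\<^sup>2" by (simp add: P_def z norm_Pair)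
  have P0: "0 \<le> P" by (simp add: P_def)
  have P1: "norm (g1' - g1) \<le> P"
    by (rule power2_le_imp_le) (use P2 P0 in auto)
  have Yn: "norm Y \<le> \<delta> * \<sigma> * P"
    using P1 delta_pos \<sigma> by (simp add: Y mult_left_mono)
  \<comment> \<open>\<open>1415 / 1000\<close> is slightly more than \<open>sqrt 2\<close>.\<close>
  have sum_le: "norm (g1' - g1) + norm (g2' - g2) \<le> 1415 / 1000 * P"
  proof (rule power2_le_imp_le)
    have "(norm (g1' - g1) + norm (g2' - g2))\<^sup>2 \<le> 2 * P\<^sup>2"
      unfolding P2 power2_sum using sum_squares_bound[of "norm (g1' - g1)" "norm (g2' - g2)"] by simp
    also have "\<dots> \<le> (1415 / 1000 * P)\<^sup>2" by (simp add: power_mult_distrib power_divide)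
    finally show "(norm (g1' - g1) + norm (g2' - g2))\<^sup>2 \<le> (1415 / 1000 * P)\<^sup>2" .
  qed (use P0 in simp)
  have Wn: "norm W \<le> \<sigma> * (1415 / 1000 * P) + \<delta> / 2 * (L * (\<delta> * \<sigma> * P))"
  proof -
    have "norm W \<le> norm (\<sigma> *\<^sub>R (\<eta> *\<^sub>R (g1' - g1) + (g2' - g2))) + norm ((\<delta> * \<eta> / 2) *\<^sub>R G1)"
      unfolding W by (rule norm_triangle_ineq4)
    also have "norm (\<sigma> *\<^sub>R (\<eta> *\<^sub>R (g1' - g1) + (g2' - g2))) \<le> \<sigma> * (1415 / 1000 * P)"
    proof -
      have "norm (\<eta> *\<^sub>R (g1' - g1) + (g2' - g2)) \<le> \<eta> * norm (g1' - g1) + norm (g2' - g2)"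
        using norm_triangle_ineq[of "\<eta> *\<^sub>R (g1' - g1)" "g2' - g2"] \<eta> by simp
      also have "\<eta> * norm (g1' - g1) \<le> 1 * norm (g1' - g1)" using \<eta> by (intro mult_right_mono) auto
      finally have "norm (\<eta> *\<^sub>R (g1' - g1) + (g2' - g2)) \<le> 1415 / 1000 * P" using sum_le by linarith
      then have "\<sigma> * norm (\<eta> *\<^sub>R (g1' - g1) + (g2' - g2)) \<le> \<sigma> * (1415 / 1000 * P)"
        by (rule mult_left_mono) (rule \<sigma>)
      then show ?thesis using \<sigma>(1) by (simp only: norm_scaleR abs_of_nonneg)
    qed
    also have "norm ((\<delta> * \<eta> / 2) *\<^sub>R G1) \<le> \<delta> / 2 * (L * (\<delta> * \<sigma> * P))"
    proof -
      have "norm G1 \<le> L * (\<delta> * \<sigma> * P)"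
      proof -
        have "norm G1 \<le> L * norm Y" using lipschitz_grad[of y' y] by (simp only: G1_def Y_def)
        also have "\<dots> \<le> L * (\<delta> * \<sigma> * P)" by (rule mult_left_mono[OF Yn]) (use L_pos in simp)
        finally show ?thesis .
      qed
      moreover have "\<delta> * \<eta> / 2 \<le> \<delta> / 2" using \<eta> delta_pos by simp
      ultimately have "\<delta> * \<eta> / 2 * norm G1 \<le> \<delta> / 2 * (L * (\<delta> * \<sigma> * P))"
        using delta_pos by (intro mult_mono) auto
      then show ?thesis using delta_pos \<eta> by simp
    qed
    finally show ?thesis by simp
  qed
  have "(twisted_norm (step (z, g') - step (z, g)))\<^sup>2 \<le> (norm Y + norm W / s)\<^sup>2"
  proof -
    have "step (z, g') - step (z, g) = (Y, W)" by (simp add: Y_def W_def y_def y'_def prod_eq_iff)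
    then have "(twisted_norm (step (z, g') - step (z, g)))\<^sup>2 = (norm Y)\<^sup>2 + 2 / \<gamma> * inner Y W + (norm W)\<^sup>2 / L"
      by (simp add: twisted_norm_sq)
    also have "\<dots> \<le> (norm Y)\<^sup>2 + 2 * (norm Y * (norm W / s)) + (norm W)\<^sup>2 / L"
    proof -
      have "2 / \<gamma> * inner Y W \<le> norm Y * (norm W / s)"
        unfolding s_def by (rule order_trans[OF abs_ge_self cross_term])
      moreover have "0 \<le> norm Y * (norm W / s)" using s by simp
      ultimately show ?thesis by linarith
    qed
    also have "\<dots> = (norm Y + norm W / s)\<^sup>2" using s by (simp add: power2_sum power_divide)
    finally show ?thesis .
  qed
  then have "twisted_norm (step (z, g') - step (z, g)) \<le> norm Y + norm W / s"
    by (rule power2_le_imp_le) (use s in simp)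
  also have "\<dots> \<le> \<delta> * \<sigma> * P + (\<sigma> * (1415 / 1000 * P) + \<delta> / 2 * (L * (\<delta> * \<sigma> * P))) / s"
    using Yn Wn s by (intro add_mono divide_right_mono) auto
  also have "\<dots> = \<sigma> / s * P * (\<delta> * s + 1415 / 1000 + (\<delta> * s)\<^sup>2 / 2)"
    unfolding s(2)[symmetric] using s(1) by (simp add: field_simps power2_eq_square)
  also have "\<dots> \<le> \<sigma> / s * P * sqrt (21 / 10)"
  proof (rule mult_left_mono)
    have d: "0 \<le> \<delta> * s" "\<delta> * s \<le> 1 / 264" using delta_sqrt_L delta_pos s by (auto simp: s_def)
    then have "(\<delta> * s)\<^sup>2 \<le> (1 / 264)\<^sup>2" by (intro power_mono)
    then have "\<delta> * s + 1415 / 1000 + (\<delta> * s)\<^sup>2 / 2 \<le> 144 / 100" using d(2) by (simp add: power2_eq_square)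
    also have "144 / 100 \<le> sqrt (21 / 10)" by (rule real_le_rsqrt) (simp add: power2_eq_square)
    finally show "\<delta> * s + 1415 / 1000 + (\<delta> * s)\<^sup>2 / 2 \<le> sqrt (21 / 10)" .
  qed (use \<sigma> s P0 in auto)
  also have "\<dots> \<le> sqrt (\<delta> * \<gamma>) / s * P * sqrt (21 / 10)"
    using real_le_rsqrt[OF \<sigma>(2)] s P0 by (intro mult_right_mono divide_right_mono) auto
  also have "\<dots> = noise_size * norm (g' - g)"
    unfolding noise_size_def s_def P_def real_sqrt_mult real_sqrt_divide by (simp only: times_divide_eq_left times_divide_eq_right mult_ac)
  finally show ?thesis .
qed

sublocale chain: random_map "std_gaussian \<Otimes>\<^sub>M std_gaussian" step twisted_norm contraction_factor noise_size lower_const upper_const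
proof
  show "sup_conv_ineq (std_gaussian \<Otimes>\<^sub>M std_gaussian :: ('a \<times> 'a) measure) (\<lambda>w. (norm w)\<^sup>2 / 2)"
    by (rule sup_conv_ineq_gaussian_pair)
  show "integrable (std_gaussian \<Otimes>\<^sub>M std_gaussian :: ('a \<times> 'a) measure) norm"
    by (rule integrable_norm_gaussian_pair)
  show "twisted_norm (x + y) \<le> twisted_norm x + twisted_norm y" for x y
  proof -
    let ?A = "\<lambda>z :: 'a \<times> 'a. (fst z + (1 / \<gamma>) *\<^sub>R snd z, sqrt (1 / L - 1 / \<gamma>\<^sup>2) *\<^sub>R snd z)"
    have "?A (x + y) = ?A x + ?A y" by (simp add: scaleR_add_right)
    then show ?thesis unfolding twisted_norm_def by (metis norm_triangle_ineq)
  qed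
  show "lower_const * norm x \<le> twisted_norm x" for x by (rule twisted_norm_lower)
  show "twisted_norm x \<le> upper_const * norm x" for x by (rule twisted_norm_upper)
  show "0 < lower_const" "0 < noise_size" using L_pos delta_pos gamma_pos by (simp_all add: lower_const_def noise_size_def)
  show "0 \<le> contraction_factor" "contraction_factor < 1" using rate_bounds by (simp_all add: contraction_factor_def)
  show "twisted_norm (step (z', g) - step (z, g)) \<le> contraction_factor * twisted_norm (z' - z)" for z z' g
    by (rule step_contract)
  show "twisted_norm (step (z, g') - step (z, g)) \<le> noise_size * norm (g' - g)" for z g g'
    by (rule step_noise)
qed

lemma obabo_kernel_eq: "obabo_kernel \<delta> \<gamma> U = chain.kernel"
  by (simp add: fun_eq_iff obabo_kernel_def chain.kernel_def step_def)

lemma obabo_invariant_eq: "obabo_invariant \<delta> \<gamma> U = chain.stationary"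
  unfolding obabo_invariant_def obabo_kernel_eq by (rule chain.stationary_eq_THE)

section \<open>Comparison with the constants of the theorem\<close>

lemma one_minus_factor_sq: "1 - contraction_factor\<^sup>2 = m * \<delta> / (2 * \<gamma>)"
  using rate_bounds by (simp add: contraction_factor_def)

text \<open>The rate for squared distances loses a factor 2 for distances, by
  \<open>1 - r^2 \<le> 2 * (1 - r)\<close>.\<close>

lemma one_minus_factor: "m * \<delta> / (4 * \<gamma>) \<le> 1 - contraction_factor"
proof -
  have r: "0 \<le> contraction_factor" "contraction_factor < 1" using chain.r by auto
  have "m * \<delta> / (2 * \<gamma>) = (1 - contraction_factor) * (1 + contraction_factor)"
    unfolding one_minus_factor_sq[symmetric] by (simp add: power2_eq_square algebra_simps)
  also have "\<dots> \<le> (1 - contraction_factor) * 2" using r by (intro mult_left_mono) auto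
  finally show ?thesis by simp
qed

lemma lower_const_sq: "lower_const\<^sup>2 = min 1 (1 / L) / 2"
  and upper_const_sq: "upper_const\<^sup>2 = 3 / 2 * max 1 (1 / L)"
  and noise_size_sq: "noise_size\<^sup>2 = 21 / 10 * (\<delta> * \<gamma> / L)"
  using L_pos delta_pos gamma_pos by (simp_all add: lower_const_def upper_const_def noise_size_def)

lemma max_L: "L powr (1 / 2) > 0" "(max (L powr (1 / 2)) (L powr (- 1 / 2)))\<^sup>2 = max L (1 / L)"
proof -
  have 1: "(L powr (1 / 2))\<^sup>2 = L" "(L powr (- 1 / 2))\<^sup>2 = 1 / L"
    using L_pos by (simp_all add: powr_power powr_minus_divide power_divide)
  have "(max x y)\<^sup>2 = max (x\<^sup>2) (y\<^sup>2)" if "0 \<le> x" "0 \<le> y" for x y :: real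
    using that by (cases "x \<le> y") (simp_all add: max_absorb1 max_absorb2 power_mono)
  from this[of "L powr (1 / 2)" "L powr (- 1 / 2)"] show "(max (L powr (1 / 2)) (L powr (- 1 / 2)))\<^sup>2 = max L (1 / L)"
    by (simp only: 1 powr_ge_zero)
qed (use L_pos in simp)

text \<open>The noise enters twice per step, so \<open>noise_size\<^sup>2\<close> is about \<open>2 \<delta> \<gamma> / L\<close>; this is compensated by
  the contraction rate \<open>m / (2 \<gamma>)\<close>, which is better than \<open>\<kappa> = m / (3 \<gamma>)\<close>.\<close>

lemma noise_ratio: "noise_size\<^sup>2 / ((1 - contraction_factor\<^sup>2) * lower_const\<^sup>2) \<le> 42 / 5 * (\<gamma>\<^sup>2 / m * max L (1 / L))"
proof -
  have "noise_size\<^sup>2 / ((1 - contraction_factor\<^sup>2) * lower_const\<^sup>2) = 42 / 5 * (\<gamma>\<^sup>2 / m * (1 / (L * min 1 (1 / L))))"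
    unfolding noise_size_sq one_minus_factor_sq lower_const_sq using m_pos delta_pos gamma_pos L_pos
    by (simp add: power2_eq_square min_def field_simps)
  also have "\<dots> \<le> 42 / 5 * (\<gamma>\<^sup>2 / m * max L (1 / L))"
  proof (intro mult_left_mono)
    show "1 / (L * min 1 (1 / L)) \<le> max L (1 / L)"
      using L_pos by (cases "L \<le> 1") (simp_all add: min_def le_max_iff_disj)
  qed (use m_pos in auto)
  finally show ?thesis .
qed

text \<open>The origin of \<open>K1\<close>: its square equals this bound on the squared ratio of
  the two comparison constants between \<open>twisted_norm\<close> and the Euclidean norm.\<close>

lemma norm_ratio: "(upper_const / lower_const)\<^sup>2 \<le> 3 * max L (1 / L)"
proof -
  have "(upper_const / lower_const)\<^sup>2 = 3 * (max 1 (1 / L) / min 1 (1 / L))"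
    unfolding power_divide lower_const_sq upper_const_sq by simp
  also have "max 1 (1 / L) / min 1 (1 / L) \<le> max L (1 / L)"
    using L_pos by (auto simp: min_def max_def field_simps)
  finally show ?thesis by simp
qed

text \<open>The comparisons come down to \<open>84 / 5\<close> against 18 in the first claim, 4
  against 6 in the second and \<open>168 / 5\<close> against 54 in the third. In the last two,
  \<open>1 / (1 - r)\<close> is at most \<open>4 * \<gamma> / (m * \<delta>)\<close>, while
  \<open>1 / (\<kappa> * \<delta>)\<close> is \<open>3 * \<gamma> / (m * \<delta>)\<close>.\<close>

lemma constants_bound:
  assumes K1: "K1 = sqrt 3 * max (L powr (1/2)) (L powr (- 1/2))"
    and kappa: "\<kappa> = m / (3 * \<gamma>)"
    and ClS: "ClS = 6 / m * K1\<^sup>2 * \<gamma>\<^sup>2 * (1 + \<delta> + \<delta>\<^sup>2 * L / 2)\<^sup>2"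
  shows "2 * (noise_size\<^sup>2 / ((1 - contraction_factor\<^sup>2) * lower_const\<^sup>2)) \<le> ClS"
    and "upper_const / (lower_const * (1 - contraction_factor)) \<le> 2 * K1 / (\<kappa> * \<delta>)"
    and "(noise_size / (lower_const * (1 - contraction_factor)))\<^sup>2 / 2 \<le> ClS / (\<kappa> * \<delta>)"
proof -
  let ?r = contraction_factor
  define M where "M = max L (1 / L)"
  have M: "0 < M" using L_pos by (simp add: M_def less_max_iff_disj)
  have K12: "K1\<^sup>2 = 3 * M" unfolding K1 power_mult_distrib max_L M_def by simp
  have K10: "0 \<le> K1" unfolding K1 using max_L(1) by (intro mult_nonneg_nonneg) (auto simp: le_max_iff_disj)
  \<comment> \<open>\<open>18\<close> is the 6 of \<open>ClS\<close> times the 3 of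
    \<open>K1^2 = 3 * M\<close>; the bracket is at least 1.\<close>
  have ClS_ge: "18 * (\<gamma>\<^sup>2 / m * M) \<le> ClS"
  proof -
    have "1 \<le> (1 + \<delta> + \<delta>\<^sup>2 * L / 2)\<^sup>2" using delta_pos L_pos by (intro one_le_power) simp
    then have "18 * (\<gamma>\<^sup>2 / m * M) * 1 \<le> 18 * (\<gamma>\<^sup>2 / m * M) * (1 + \<delta> + \<delta>\<^sup>2 * L / 2)\<^sup>2"
      using m_pos M by (intro mult_left_mono) auto
    then show ?thesis unfolding ClS K12 by (simp add: mult_ac)
  qed
  have gM: "0 < \<gamma>\<^sup>2 / m * M" using gamma_pos m_pos M by simp
  show 1: "2 * (noise_size\<^sup>2 / ((1 - ?r\<^sup>2) * lower_const\<^sup>2)) \<le> ClS"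
  proof -
    have "2 * x \<le> c" if "x \<le> 42 / 5 * y" "18 * y \<le> c" "0 < y" for x y c :: real using that by linarith
    from this[OF noise_ratio[folded M_def] ClS_ge gM] show ?thesis .
  qed
  have r: "0 \<le> ?r" "?r < 1" "0 < 1 - ?r" using chain.r by auto
  have g: "0 < m * \<delta> / (4 * \<gamma>)" using m_pos delta_pos gamma_pos by simp
  have inv: "1 / (1 - ?r) \<le> 4 * \<gamma> / (m * \<delta>)"
  proof -
    have "1 / (1 - ?r) \<le> 1 / (m * \<delta> / (4 * \<gamma>))"
      by (intro divide_left_mono one_minus_factor mult_pos_pos g r) simp
    then show ?thesis by simp
  qed
  have kd: "1 / (\<kappa> * \<delta>) = 3 * \<gamma> / (m * \<delta>)" by (simp add: kappa)
  have gmd: "0 < \<gamma> / (m * \<delta>)" using m_pos delta_pos gamma_pos by simp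
  show "upper_const / (lower_const * (1 - ?r)) \<le> 2 * K1 / (\<kappa> * \<delta>)"
  proof -
    have "upper_const / lower_const \<le> K1"
      by (rule power2_le_imp_le) (use norm_ratio K12 K10 in \<open>simp_all add: M_def\<close>)
    then have "upper_const / lower_const * (1 / (1 - ?r)) \<le> K1 * (4 * \<gamma> / (m * \<delta>))"
      using inv r K10 by (intro mult_mono) auto
    also have "\<dots> \<le> K1 * (2 * (1 / (\<kappa> * \<delta>)))"
    proof (rule mult_left_mono[OF _ K10])
      have "4 * \<gamma> / (m * \<delta>) = 4 * (\<gamma> / (m * \<delta>))" "2 * (3 * \<gamma> / (m * \<delta>)) = 6 * (\<gamma> / (m * \<delta>))" by simp_all
      then show "4 * \<gamma> / (m * \<delta>) \<le> 2 * (1 / (\<kappa> * \<delta>))" unfolding kd using gmd by argo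
    qed
    finally show ?thesis by (simp add: mult_ac)
  qed
  show "(noise_size / (lower_const * (1 - ?r)))\<^sup>2 / 2 \<le> ClS / (\<kappa> * \<delta>)"
  proof -
    \<comment> \<open>One factor \<open>1 - r\<close> is completed to \<open>1 - r^2\<close>, which
      recovers the ratio of the log-Sobolev bound; the other is left for \<open>inv\<close>.\<close>
    have "(noise_size / (lower_const * (1 - ?r)))\<^sup>2 / 2
      = noise_size\<^sup>2 / ((1 - ?r\<^sup>2) * lower_const\<^sup>2) * ((1 + ?r) / 2 * (1 / (1 - ?r)))"
    proof -
      have "1 - ?r\<^sup>2 = (1 - ?r) * (1 + ?r)" by (simp add: power2_eq_square algebra_simps)
      then show ?thesis using r chain.a_pos by (simp add: power_divide power_mult_distrib) (simp add: power2_eq_square)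
    qed
    also have "\<dots> \<le> (42 / 5 * (\<gamma>\<^sup>2 / m * M)) * (1 * (4 * \<gamma> / (m * \<delta>)))"
    proof (rule mult_mono[OF noise_ratio[folded M_def]])
      show "(1 + ?r) / 2 * (1 / (1 - ?r)) \<le> 1 * (4 * \<gamma> / (m * \<delta>))"
        using inv r gmd by (intro mult_mono) auto
      show "0 \<le> 42 / 5 * (\<gamma>\<^sup>2 / m * M)" by (rule mult_nonneg_nonneg) (use gM in simp_all)
    qed (use r in simp)
    also have "\<dots> \<le> (18 * (\<gamma>\<^sup>2 / m * M)) * (3 * \<gamma> / (m * \<delta>))"
    proof -
      have "42 / 5 * A * (1 * (4 * B)) \<le> 18 * A * (3 * B)" if "0 < A * B" for A B :: real
        using that by simp
      moreover have "4 * \<gamma> / (m * \<delta>) = 4 * (\<gamma> / (m * \<delta>))" "3 * \<gamma> / (m * \<delta>) = 3 * (\<gamma> / (m * \<delta>))"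
        by simp_all
      ultimately show ?thesis using mult_pos_pos[OF gM gmd] by (simp only:)
    qed
    also have "\<dots> \<le> ClS * (1 / (\<kappa> * \<delta>))"
      unfolding kd using ClS_ge gmd by (intro mult_right_mono) auto
    finally show ?thesis by simp
  qed
qed

end

theorem theorem6:
  fixes U :: "'a::euclidean_space \<Rightarrow> real"
    and m L \<gamma> \<delta> K1 \<kappa> ClS :: real
    and \<pi>\<delta> :: "('a \<times> 'a) measure"
  assumes C2: "C2_function U"
    and m_pos: "0 < m" and m_le_L: "m \<le> L"
    and lipschitz_grad: "\<And>x y. norm (grad U x - grad U y) \<le> L * norm (x - y)"
    and strongly_convex: "\<And>x y. inner (x - y) (grad U x - grad U y) \<ge> m * (norm (x - y))\<^sup>2"
    and gamma: "\<gamma> \<ge> 2 * sqrt L"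
    and delta_pos: "0 < \<delta>" and delta_le: "\<delta> \<le> m / (33 * \<gamma> ^ 3)"
    and invariant_measure: "\<pi>\<delta> = obabo_invariant \<delta> \<gamma> U"
    and K1: "K1 = sqrt 3 * max (L powr (1/2)) (L powr (- 1/2))"
    and kappa: "\<kappa> = m / (3 * \<gamma>)"
    and ClS: "ClS = 6 / m * K1\<^sup>2 * \<gamma>\<^sup>2 * (1 + \<delta> + \<delta>\<^sup>2 * L / 2)\<^sup>2"
  shows "log_sobolev \<pi>\<delta> ClS \<and>
    (\<forall>(\<mu>0 :: ('a \<times> 'a) measure) C' (M :: 'w measure) Z (\<phi> :: 'a \<times> 'a \<Rightarrow> real) (n::nat) (u::real).
       C' > 0 \<longrightarrow> log_sobolev \<mu>0 C' \<longrightarrow> markov_chain M \<mu>0 (obabo_kernel \<delta> \<gamma> U) Z \<longrightarrow>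
       1-lipschitz_on UNIV \<phi> \<longrightarrow> n \<ge> 1 \<longrightarrow> u \<ge> 0 \<longrightarrow>
       measure M {\<omega> \<in> space M.
           ennreal \<bar>(1 / real n) * (\<Sum>k=1..n. \<phi> (Z k \<omega>)) - (\<integral>z. \<phi> z \<partial>\<pi>\<delta>)\<bar>
             \<ge> ennreal u + ennreal (2 * K1 / (real n * \<kappa> * \<delta>)) * wasserstein1 \<mu>0 \<pi>\<delta>}
         \<le> 2 * exp (- (real n * u\<^sup>2 * \<kappa> * \<delta>) / (4 * ClS + 4 * K1\<^sup>2 * C' / (real n * \<kappa> * \<delta>))))"
proof -
  interpret obabo U m L \<gamma> \<delta>
    by unfold_locales (fact C2 m_pos m_le_L lipschitz_grad strongly_convex gamma delta_pos delta_le)+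
  have \<pi>: "\<pi>\<delta> = chain.stationary" unfolding invariant_measure by (rule obabo_invariant_eq)
  note const = constants_bound[OF K1 kappa ClS]
  have k_pos: "0 < \<kappa>" using m_pos gamma_pos by (simp add: kappa)
  have kd: "0 < \<kappa> * \<delta>" using k_pos delta_pos by simp
  show ?thesis unfolding \<pi> obabo_kernel_eq
  proof (intro conjI allI impI)
    show "log_sobolev chain.stationary ClS"
      by (rule log_sobolev_mono[OF chain.log_sobolev_stationary const(1)])
    fix \<mu>0 C' and M :: "'w measure" and Z and \<phi> :: "'a \<times> 'a \<Rightarrow> real" and n :: nat and u :: real
    assume C': "C' > 0" and ls: "log_sobolev \<mu>0 C'" and mc: "markov_chain M \<mu>0 chain.kernel Z"
      and \<phi>: "1-lipschitz_on UNIV \<phi>" and n: "n \<ge> 1" and u: "u \<ge> 0"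
    \<comment> \<open>Chosen so that the exponent comes out exactly:
      \<open>4 * V * (\<kappa> * \<delta>)\<close> is \<open>n\<close> times the denominator in the
      claim.\<close>
    define V where "V = real n * (ClS / (\<kappa> * \<delta>)) + C' * (2 * K1 / (\<kappa> * \<delta>))\<^sup>2 / 4"
    have V: "real n * (noise_size / (lower_const * (1 - contraction_factor)))\<^sup>2 / 2 + C' * (2 * K1 / (\<kappa> * \<delta>))\<^sup>2 / 4 \<le> V"
      unfolding V_def using mult_left_mono[OF const(3), of "real n"] by simp
    have V_pos: "0 < V"
    proof -
      have Dp: "0 < 2 * K1 / (\<kappa> * \<delta>)" using const(2) chain.b_pos chain.a_pos chain.r
        by (smt (verit) divide_pos_pos mult_pos_pos)
      then have "0 < C' * (2 * K1 / (\<kappa> * \<delta>))\<^sup>2 / 4"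
        by (intro divide_pos_pos[OF mult_pos_pos[OF C' zero_less_power[OF Dp]]]) simp
      moreover have "0 \<le> real n * (noise_size / (lower_const * (1 - contraction_factor)))\<^sup>2 / 2" by simp
      ultimately show ?thesis using V by linarith
    qed
    have D: "2 * K1 / (\<kappa> * \<delta>) / real n = 2 * K1 / (real n * \<kappa> * \<delta>)" by (simp add: mult_ac)
    have scaled: "real n * (4 * ClS + 4 * K1\<^sup>2 * C' / (real n * \<kappa> * \<delta>)) = 4 * V * (\<kappa> * \<delta>)"
      unfolding V_def using k_pos delta_pos n by (simp add: field_simps power2_eq_square)
    have eq: "- (real n * u)\<^sup>2 / (4 * V) = - (real n * u\<^sup>2 * \<kappa> * \<delta>) / (4 * ClS + 4 * K1\<^sup>2 * C' / (real n * \<kappa> * \<delta>))"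
    proof -
      have k: "- (real n * u)\<^sup>2 / q = - (real n * u\<^sup>2 * \<kappa> * \<delta>) / p" if "real n * p = q * (\<kappa> * \<delta>)" "0 < q" for p q
      proof -
        have "0 < real n * p" using that kd by simp
        then have "p \<noteq> 0" by auto
        have "- (real n * u)\<^sup>2 * p = - (real n * u\<^sup>2) * (real n * p)" by (simp add: power2_eq_square)
        also have "\<dots> = - (real n * u\<^sup>2 * \<kappa> * \<delta>) * q" unfolding that(1) by simp
        finally show ?thesis using \<open>p \<noteq> 0\<close> that(2) by (simp add: frac_eq_eq)
      qed
      show ?thesis by (rule k[OF scaled]) (use V_pos in simp)
    qed
    show "measure M {\<omega> \<in> space M.
           ennreal \<bar>(1 / real n) * (\<Sum>k=1..n. \<phi> (Z k \<omega>)) - (\<integral>z. \<phi> z \<partial>chain.stationary)\<bar>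
             \<ge> ennreal u + ennreal (2 * K1 / (real n * \<kappa> * \<delta>)) * wasserstein1 \<mu>0 chain.stationary}
         \<le> 2 * exp (- (real n * u\<^sup>2 * \<kappa> * \<delta>) / (4 * ClS + 4 * K1\<^sup>2 * C' / (real n * \<kappa> * \<delta>)))"
      using chain.chain_concentration[OF \<phi> mc ls C' const(2) V n u] unfolding D eq .
  qed
qed

end
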